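(* Let $F_1$ and $F_2$ be two $C^2$ Finsler metrics on a manifold $M$ with the same unparametrized geodesics. If the velocity field of every geodesic passes through some open set in the tangent bundle where $F_1$ equals $F_2$, then the metrics agree everywhere modulo the addition of a closed $1$-form, that is, there is a closed $1$-form $\beta$ on $M$ such that $F_2(v_x)=F_1(v_x)+\beta_x(v_x)$ for all $x \in M$ and $v_x\in T_xM$.
   Context: An asymmetric norm on a finite-dimensional real vector space is a nonnegative, positively homogeneous (of degree one), subadditive function vanishing only at the origin. It is a Minkowski norm if its square is $C^2$ with positive-definite Hessian outside the origin. A $C^2$ Finsler metric on $M$ is a continuous function $F:TM\to[0,\infty)$ that is $C^2$ outside the zero section and restricts to a Minkowski norm on each tangent space; it need not be reversible. Geodesics are the extremals (with nowhere-zero velocity) of $\gamma\mapsto\int F(\gamma')\,dt$ (taken to be maximally extended); two metrics have the same unparametrized geodesics if their geodesics coincide as oriented curves up to orientation-preserving reparametrization.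
   Formalization: The manifold M is assumed to have dimension at least 2; in dimension 1 the claim fails, e.g. M = R, F1 = |v|, F2 = (1+b(x))|v| with b a bump function, where F2 - F1 is not a 1-form. *)

theory Defs
  imports "HOL-Analysis.Analysis"
begin

section \<open>Maps of class C^k\<close>

text \<open>Only used for open sets \<open>S\<close>.\<close>

fun Ck_on :: "nat \<Rightarrow> ('a::euclidean_space \<Rightarrow> 'b::real_normed_vector) \<Rightarrow> 'a set \<Rightarrow> bool" where
  "Ck_on 0 f S \<longleftrightarrow> continuous_on S f"
| "Ck_on (Suc k) f S \<longleftrightarrow>
     (\<forall>x\<in>S. f differentiable (at x)) \<and> (\<forall>v. Ck_on k (\<lambda>x. frechet_derivative f (at x) v) S)"

section \<open>Smooth manifolds\<close>

text \<open>The manifold is the whole type \<open>'m\<close>, whose class makes it Hausdorff and second countable; it is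
  modelled on the Euclidean space \<open>'e\<close>. A chart is a pair of a domain and a coordinate map, the
  latter being irrelevant outside the domain.\<close>

type_synonym ('m, 'e) chart = "'m set \<times> ('m \<Rightarrow> 'e)"

abbreviation chart_dom :: "('m, 'e) chart \<Rightarrow> 'm set" where "chart_dom \<equiv> fst"
abbreviation chart_map :: "('m, 'e) chart \<Rightarrow> 'm \<Rightarrow> 'e" where "chart_map \<equiv> snd"

definition chart_range :: "('m, 'e) chart \<Rightarrow> 'e set" where
  "chart_range c = chart_map c ` chart_dom c"

definition chart_inv :: "('m, 'e) chart \<Rightarrow> 'e \<Rightarrow> 'm" where
  "chart_inv c = inv_into (chart_dom c) (chart_map c)"

definition is_chart :: "('m::topological_space, 'e::euclidean_space) chart \<Rightarrow> bool" where
  "is_chart c \<longleftrightarrow> open (chart_dom c) \<and> open (chart_range c) \<and>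
     homeomorphism (chart_dom c) (chart_range c) (chart_map c) (chart_inv c)"

definition transition :: "('m, 'e) chart \<Rightarrow> ('m, 'e) chart \<Rightarrow> 'e \<Rightarrow> 'e" where
  "transition c c' = chart_map c' \<circ> chart_inv c"

definition smooth_atlas ::
  "('m::{t2_space,second_countable_topology}, 'e::euclidean_space) chart set \<Rightarrow> bool" where
  "smooth_atlas A \<longleftrightarrow> (\<forall>c\<in>A. is_chart c) \<and> (\<Union>c\<in>A. chart_dom c) = UNIV \<and>
     (\<forall>c\<in>A. \<forall>c'\<in>A. \<forall>k. Ck_on k (transition c c') (chart_map c ` (chart_dom c \<inter> chart_dom c')))"

definition Ck_map :: "('m::topological_space, 'e::euclidean_space) chart set \<Rightarrow> nat \<Rightarrow>
    'p::euclidean_space set \<Rightarrow> ('p \<Rightarrow> 'm) \<Rightarrow> bool" where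
  "Ck_map A k S f \<longleftrightarrow> continuous_on S f \<and>
     (\<forall>c\<in>A. Ck_on k (chart_map c \<circ> f) (S \<inter> f -` chart_dom c))"

section \<open>The tangent bundle\<close>

text \<open>A tangent vector consists of its base point and the family of its coordinate vectors in the
  charts around that point, which transform by the derivatives of the transition maps. The
  component at any other index is \<open>0\<close>, so that a vector is determined by its coordinates.\<close>

type_synonym ('m, 'e) tangent = "'m \<times> (('m, 'e) chart \<Rightarrow> 'e)"

definition tangent_bundle ::
  "('m::topological_space, 'e::euclidean_space) chart set \<Rightarrow> ('m, 'e) tangent set" where
  "tangent_bundle A = {(x, v).
     (\<forall>c\<in>A. \<forall>c'\<in>A. x \<in> chart_dom c \<inter> chart_dom c' \<longrightarrow>
        v c' = frechet_derivative (transition c c') (at (chart_map c x)) (v c)) \<and>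
     (\<forall>c. \<not> (c \<in> A \<and> x \<in> chart_dom c) \<longrightarrow> v c = 0)}"

text \<open>The tangent vector whose coordinates in the chart \<open>c\<close> are \<open>(p, u)\<close>. Its restriction to a
  fixed \<open>p\<close> is the linear isomorphism from \<open>'e\<close> to a tangent space by which linear structure and
  differentiability on that tangent space are expressed.\<close>

definition chart_vec :: "('m::topological_space, 'e::euclidean_space) chart set \<Rightarrow>
    ('m, 'e) chart \<Rightarrow> 'e \<times> 'e \<Rightarrow> ('m, 'e) tangent" where
  "chart_vec A c = (\<lambda>(p, u). (chart_inv c p,
     \<lambda>c'. if c' \<in> A \<and> chart_inv c p \<in> chart_dom c'
          then frechet_derivative (transition c c') (at p) u else 0))"

definition tangent_topology ::
  "('m::topological_space, 'e::euclidean_space) chart set \<Rightarrow> ('m, 'e) tangent topology" where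
  "tangent_topology A = topology (\<lambda>W. W \<subseteq> tangent_bundle A \<and>
     (\<forall>c\<in>A. open ((chart_range c \<times> UNIV) \<inter> chart_vec A c -` W)))"

section \<open>Finsler metrics\<close>

definition asymmetric_norm :: "('e::euclidean_space \<Rightarrow> real) \<Rightarrow> bool" where
  "asymmetric_norm N \<longleftrightarrow> (\<forall>v. 0 \<le> N v) \<and> (\<forall>t\<ge>0. \<forall>v. N (t *\<^sub>R v) = t * N v) \<and>
     (\<forall>v w. N (v + w) \<le> N v + N w) \<and> (\<forall>v. N v = 0 \<longleftrightarrow> v = 0)"

definition hessian :: "('e::euclidean_space \<Rightarrow> real) \<Rightarrow> 'e \<Rightarrow> 'e \<Rightarrow> 'e \<Rightarrow> real" where
  "hessian f w u v =
     frechet_derivative (\<lambda>y. frechet_derivative f (at y) u) (at w) v"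

definition minkowski_norm :: "('e::euclidean_space \<Rightarrow> real) \<Rightarrow> bool" where
  "minkowski_norm N \<longleftrightarrow> asymmetric_norm N \<and> Ck_on 2 (\<lambda>v. (N v)\<^sup>2) (- {0}) \<and>
     (\<forall>w u. w \<noteq> 0 \<longrightarrow> u \<noteq> 0 \<longrightarrow> hessian (\<lambda>v. (N v)\<^sup>2) w u u > 0)"

definition C2_finsler :: "('m::topological_space, 'e::euclidean_space) chart set \<Rightarrow>
    (('m, 'e) tangent \<Rightarrow> real) \<Rightarrow> bool" where
  "C2_finsler A F \<longleftrightarrow> continuous_map (tangent_topology A) euclideanreal F \<and>
     (\<forall>c\<in>A. Ck_on 2 (F \<circ> chart_vec A c) (chart_range c \<times> (- {0})) \<and>
        (\<forall>p\<in>chart_range c. minkowski_norm (\<lambda>u. F (chart_vec A c (p, u)))))"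

section \<open>Geodesics\<close>

definition velocity :: "('m::topological_space, 'e::euclidean_space) chart set \<Rightarrow>
    (real \<Rightarrow> 'm) \<Rightarrow> real \<Rightarrow> ('m, 'e) tangent" where
  "velocity A \<gamma> t = (\<gamma> t,
     \<lambda>c. if c \<in> A \<and> \<gamma> t \<in> chart_dom c then vector_derivative (chart_map c \<circ> \<gamma>) (at t) else 0)"

definition open_interval :: "real set \<Rightarrow> bool" where
  "open_interval I \<longleftrightarrow> open I \<and> is_interval I \<and> I \<noteq> {}"

text \<open>A variation of \<open>\<gamma>\<close> supported in the compact interval \<open>{a..b}\<close>.\<close>

definition variation :: "('m::topological_space, 'e::euclidean_space) chart set \<Rightarrow> real set \<Rightarrow>
    (real \<Rightarrow> 'm) \<Rightarrow> real \<Rightarrow> real \<Rightarrow> real \<Rightarrow> (real \<times> real \<Rightarrow> 'm) \<Rightarrow> bool" where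
  "variation A I \<gamma> a b \<epsilon> \<Gamma> \<longleftrightarrow> Ck_map A 2 ({-\<epsilon><..<\<epsilon>} \<times> I) \<Gamma> \<and>
     (\<forall>t\<in>I. \<Gamma> (0, t) = \<gamma> t) \<and>
     (\<forall>s\<in>{-\<epsilon><..<\<epsilon>}. \<forall>t\<in>I. t \<notin> {a<..<b} \<longrightarrow> \<Gamma> (s, t) = \<gamma> t)"

text \<open>Regular critical points of the length functional, in an arbitrary regular parametrization.
  (The integrand is differentiable in \<open>s\<close> near \<open>0\<close>, since the velocities do not vanish there.)\<close>

definition extremal :: "('m::topological_space, 'e::euclidean_space) chart set \<Rightarrow>
    (('m, 'e) tangent \<Rightarrow> real) \<Rightarrow> real set \<Rightarrow> (real \<Rightarrow> 'm) \<Rightarrow> bool" where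
  "extremal A F I \<gamma> \<longleftrightarrow> open_interval I \<and> Ck_map A 2 I \<gamma> \<and>
     (\<forall>t\<in>I. snd (velocity A \<gamma> t) \<noteq> (\<lambda>_. 0)) \<and>
     (\<forall>a b \<epsilon> \<Gamma>. a < b \<longrightarrow> {a..b} \<subseteq> I \<longrightarrow> \<epsilon> > 0 \<longrightarrow> variation A I \<gamma> a b \<epsilon> \<Gamma> \<longrightarrow>
        ((\<lambda>s. integral {a..b} (\<lambda>t. F (velocity A (\<lambda>r. \<Gamma> (s, r)) t)))
           has_real_derivative 0) (at 0))"

definition reparametrization :: "(real \<Rightarrow> real) \<Rightarrow> real set \<Rightarrow> real set \<Rightarrow> bool" where
  "reparametrization \<phi> I J \<longleftrightarrow> Ck_on 2 \<phi> I \<and> (\<forall>t\<in>I. deriv \<phi> t > 0) \<and> \<phi> ` I = J"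

text \<open>Maximality is that of the oriented unparametrized curve: no extremal traverses the curve and
  then continues, even after the curve is reparametrized.\<close>

definition geodesic :: "('m::topological_space, 'e::euclidean_space) chart set \<Rightarrow>
    (('m, 'e) tangent \<Rightarrow> real) \<Rightarrow> real set \<Rightarrow> (real \<Rightarrow> 'm) \<Rightarrow> bool" where
  "geodesic A F I \<gamma> \<longleftrightarrow> extremal A F I \<gamma> \<and>
     (\<forall>J \<delta> \<phi> K. extremal A F J \<delta> \<longrightarrow> reparametrization \<phi> I K \<longrightarrow> K \<subseteq> J \<longrightarrow>
        (\<forall>t\<in>I. \<gamma> t = \<delta> (\<phi> t)) \<longrightarrow> K = J)"

definition same_oriented_curve ::
  "real set \<Rightarrow> (real \<Rightarrow> 'm) \<Rightarrow> real set \<Rightarrow> (real \<Rightarrow> 'm) \<Rightarrow> bool" where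
  "same_oriented_curve I \<gamma> J \<delta> \<longleftrightarrow> (\<exists>\<phi>. reparametrization \<phi> I J \<and> (\<forall>t\<in>I. \<gamma> t = \<delta> (\<phi> t)))"

definition same_unparametrized_geodesics ::
  "('m::topological_space, 'e::euclidean_space) chart set \<Rightarrow>
    (('m, 'e) tangent \<Rightarrow> real) \<Rightarrow> (('m, 'e) tangent \<Rightarrow> real) \<Rightarrow> bool" where
  "same_unparametrized_geodesics A F G \<longleftrightarrow>
     (\<forall>I \<gamma>. geodesic A F I \<gamma> \<longrightarrow> (\<exists>J \<delta>. geodesic A G J \<delta> \<and> same_oriented_curve I \<gamma> J \<delta>)) \<and>
     (\<forall>J \<delta>. geodesic A G J \<delta> \<longrightarrow> (\<exists>I \<gamma>. geodesic A F I \<gamma> \<and> same_oriented_curve J \<delta> I \<gamma>))"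

section \<open>Closed 1-forms\<close>

definition one_form :: "('m::topological_space, 'e::euclidean_space) chart set \<Rightarrow>
    (('m, 'e) tangent \<Rightarrow> real) \<Rightarrow> bool" where
  "one_form A \<beta> \<longleftrightarrow> (\<forall>c\<in>A. \<forall>p\<in>chart_range c. linear (\<lambda>u. \<beta> (chart_vec A c (p, u))))"

text \<open>A closed form of class C^1, i.e. one whose exterior derivative vanishes in every chart.\<close>

definition closed_one_form :: "('m::topological_space, 'e::euclidean_space) chart set \<Rightarrow>
    (('m, 'e) tangent \<Rightarrow> real) \<Rightarrow> bool" where
  "closed_one_form A \<beta> \<longleftrightarrow> one_form A \<beta> \<and>
     (\<forall>c\<in>A. (\<forall>u. Ck_on 1 (\<lambda>p. \<beta> (chart_vec A c (p, u))) (chart_range c)) \<and>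
        (\<forall>p\<in>chart_range c. \<forall>u w.
           frechet_derivative (\<lambda>q. \<beta> (chart_vec A c (q, w))) (at p) u
           - frechet_derivative (\<lambda>q. \<beta> (chart_vec A c (q, u))) (at p) w = 0))"

section \<open>The topology of the tangent bundle\<close>

lemma openin_tangent_topology:
  "openin (tangent_topology A) W \<longleftrightarrow> W \<subseteq> tangent_bundle A \<and>
     (\<forall>c\<in>A. open ((chart_range c \<times> UNIV) \<inter> chart_vec A c -` W))"
proof -
  have "istopology (\<lambda>W. W \<subseteq> tangent_bundle A \<and>
     (\<forall>c\<in>A. open ((chart_range c \<times> UNIV) \<inter> chart_vec A c -` W)))"
    unfolding istopology_def
  proof (intro conjI allI impI ballI)
    fix S T c
    assume S: "S \<subseteq> tangent_bundle A \<and> (\<forall>c\<in>A. open ((chart_range c \<times> UNIV) \<inter> chart_vec A c -` S))"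
      and T: "T \<subseteq> tangent_bundle A \<and> (\<forall>c\<in>A. open ((chart_range c \<times> UNIV) \<inter> chart_vec A c -` T))"
      and c: "c \<in> A"
    have "(chart_range c \<times> UNIV) \<inter> chart_vec A c -` (S \<inter> T) =
      ((chart_range c \<times> UNIV) \<inter> chart_vec A c -` S) \<inter> ((chart_range c \<times> UNIV) \<inter> chart_vec A c -` T)"
      by blast
    then show "open ((chart_range c \<times> UNIV) \<inter> chart_vec A c -` (S \<inter> T))"
      using S T c by (metis open_Int)
  next
    fix \<K> c
    assume K: "\<forall>W\<in>\<K>. W \<subseteq> tangent_bundle A \<and>
        (\<forall>c\<in>A. open ((chart_range c \<times> UNIV) \<inter> chart_vec A c -` W))"
      and c: "c \<in> A"
    have "(chart_range c \<times> UNIV) \<inter> chart_vec A c -` (\<Union>\<K>) =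
      (\<Union>W\<in>\<K>. (chart_range c \<times> UNIV) \<inter> chart_vec A c -` W)" by blast
    then show "open ((chart_range c \<times> UNIV) \<inter> chart_vec A c -` (\<Union>\<K>))"
      using K c by (metis (no_types, lifting) open_UN)
  qed blast+
  then show ?thesis
    unfolding tangent_topology_def by (simp add: topology_inverse')
qed

lemma chart_vec_in_tangent_bundle:
  assumes A: "smooth_atlas A" and c: "c \<in> A" and p: "p \<in> chart_range c"
  shows "chart_vec A c (p, u) \<in> tangent_bundle A"
proof -
  define x where "x = chart_inv c p"
  have ch: "is_chart c" if "c \<in> A" for c using A that by (simp add: smooth_atlas_def)
  have xc: "x \<in> chart_dom c" and px: "chart_map c x = p"
    using p by (auto simp: x_def chart_range_def chart_inv_def inv_into_into f_inv_into_f)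
  have tr: "frechet_derivative (transition c c2) (at p) u =
      frechet_derivative (transition c1 c2) (at (chart_map c1 x))
        (frechet_derivative (transition c c1) (at p) u)"
    if c1: "c1 \<in> A" and c2: "c2 \<in> A" and x1: "x \<in> chart_dom c1" and x2: "x \<in> chart_dom c2" for c1 c2
  proof -
    have inv: "chart_inv d (chart_map d y) = y" if "d \<in> A" "y \<in> chart_dom d" for d y
      using ch[OF that(1)] that(2) by (simp add: is_chart_def homeomorphism_def)
    have dif: "(transition d d') differentiable (at (chart_map d x))"
      if "d \<in> A" "d' \<in> A" "x \<in> chart_dom d" "x \<in> chart_dom d'" for d d'
    proof -
      have "Ck_on (Suc 0) (transition d d') (chart_map d ` (chart_dom d \<inter> chart_dom d'))"
        using A that by (simp add: smooth_atlas_def del: Ck_on.simps)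
      moreover have "chart_map d x \<in> chart_map d ` (chart_dom d \<inter> chart_dom d')"
        using that by blast
      ultimately show ?thesis unfolding Ck_on.simps by blast
    qed
    define S where "S = chart_map c ` (chart_dom c \<inter> chart_dom c1 \<inter> chart_dom c2)"
    have "openin (top_of_set (chart_range c)) S"
      unfolding S_def
    proof (rule homeomorphism_imp_open_map)
      show "homeomorphism (chart_dom c) (chart_range c) (chart_map c) (chart_inv c)"
        using ch[OF c] by (simp add: is_chart_def)
      show "openin (top_of_set (chart_dom c)) (chart_dom c \<inter> chart_dom c1 \<inter> chart_dom c2)"
        using ch[OF c1] ch[OF c2] by (auto simp: is_chart_def openin_open Int_assoc)
    qed
    then have oS: "open S"
      using ch[OF c] openin_open_trans by (auto simp: is_chart_def)
    have pS: "p \<in> S"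
      unfolding S_def using xc x1 x2 by (intro image_eqI[where x = x]) (simp_all add: px)
    have d1: "transition c c1 p = chart_map c1 x" by (simp add: transition_def x_def)
    have "(transition c c1 has_derivative frechet_derivative (transition c c1) (at p)) (at p)"
      using dif[OF c c1 xc x1] px by (simp add: frechet_derivative_works)
    moreover have "(transition c1 c2 has_derivative
        frechet_derivative (transition c1 c2) (at (chart_map c1 x))) (at (transition c c1 p))"
      using dif[OF c1 c2 x1 x2] d1 by (simp add: frechet_derivative_works)
    ultimately have "(transition c1 c2 \<circ> transition c c1 has_derivative
        frechet_derivative (transition c1 c2) (at (chart_map c1 x)) \<circ>
        frechet_derivative (transition c c1) (at p)) (at p)"
      by (rule diff_chain_at)
    then have "(transition c c2 has_derivative
        frechet_derivative (transition c1 c2) (at (chart_map c1 x)) \<circ>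
        frechet_derivative (transition c c1) (at p)) (at p)"
      using oS pS
      by (rule has_derivative_transform_within_open) (auto simp: S_def transition_def inv[OF c] inv[OF c1])
    from fun_cong[OF frechet_derivative_at[OF this], of u] show ?thesis by simp
  qed
  define w where "w = (\<lambda>d. if d \<in> A \<and> x \<in> chart_dom d
    then frechet_derivative (transition c d) (at p) u else 0)"
  have w: "w d = frechet_derivative (transition c d) (at p) u" if "d \<in> A" "x \<in> chart_dom d" for d
    using that by (simp add: w_def)
  have "w d' = frechet_derivative (transition d d') (at (chart_map d x)) (w d)"
    if "d \<in> A" "d' \<in> A" "x \<in> chart_dom d \<inter> chart_dom d'" for d d'
    unfolding w[OF that(1) IntD1[OF that(3)]] w[OF that(2) IntD2[OF that(3)]]
    by (rule tr[OF that(1,2) IntD1[OF that(3)] IntD2[OF that(3)]])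
  moreover have "w d = 0" if "\<not> (d \<in> A \<and> x \<in> chart_dom d)" for d
    unfolding w_def using that by (rule if_not_P)
  ultimately have "(x, w) \<in> tangent_bundle A"
    unfolding tangent_bundle_def by blast
  then show ?thesis
    unfolding chart_vec_def w_def x_def prod.case .
qed

lemma topspace_tangent_topology:
  assumes "smooth_atlas A"
  shows "topspace (tangent_topology A) = tangent_bundle A"
proof -
  have "open ((chart_range c \<times> UNIV) \<inter> chart_vec A c -` tangent_bundle A)" if "c \<in> A" for c
  proof -
    have "(chart_range c \<times> UNIV) \<inter> chart_vec A c -` tangent_bundle A = chart_range c \<times> UNIV"
      using chart_vec_in_tangent_bundle[OF assms that] by auto
    moreover have "open (chart_range c)" using assms that by (simp add: smooth_atlas_def is_chart_def)
    ultimately show ?thesis by (simp add: open_Times)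
  qed
  then have "openin (tangent_topology A) (tangent_bundle A)"
    by (simp add: openin_tangent_topology)
  then show ?thesis
    using openin_subset[of "tangent_topology A" "tangent_bundle A"]
      openin_topspace[of "tangent_topology A"] openin_tangent_topology[of A "topspace (tangent_topology A)"]
    by blast
qed

end

theory Submission
  imports Defs
begin

text \<open>
  Let \<open>f = F2 - F1\<close>. The metrics share their extremals, so along each of them, in a chart, the
  fibre derivative \<open>vder f\<close> of \<open>f\<close> has the base derivative \<open>hder f\<close> as its time derivative. The first
  variation of \<open>\<integral> f\<close> through a family of common extremals therefore consists of boundary terms
  only. Let \<open>(q\<^sub>w, u\<^sub>w)\<close> be the extremal with initial vector \<open>w\<close>, let \<open>T\<close> be a fixed time, and
  suppose that \<open>f\<close> is the differential of a function \<open>S0\<close> of the base point near \<open>(q\<^sub>w T, u\<^sub>w T)\<close>. Then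
  \<open>S w = S0 (q\<^sub>w T) - \<integral>\<^sub>0\<^sup>T f (q\<^sub>w, u\<^sub>w) dt\<close> has the differential \<open>vder f w \<cdot> dq\<close>: the boundary terms
  at \<open>T\<close> cancel (\<open>transport_primitive\<close>). This differential has no component along the fibre, so \<open>S\<close> depends
  on the base point alone, and Euler's identity \<open>vder f (q, u) u = f (q, u)\<close> says that \<open>f\<close> is the
  differential of \<open>S\<close> near \<open>w\<close> (\<open>locally_exactI\<close>). Being locally the differential of a function
  thus propagates along geodesics, in both directions of time (\<open>locally_exact_propagates\<close>). It holds where the
  metrics agree, with \<open>S = 0\<close>, and every geodesic passes there; hence it holds at every nonzero tangent
  vector (\<open>everywhere_locally_exact\<close>). Consequently \<open>vder f\<close> is locally constant on each tangent
  space without its origin, which is connected in dimension at least two, so that \<open>f\<close> is linear on each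
  tangent space (\<open>fibrewise_linear\<close>). As \<open>f\<close> is locally \<open>dS\<close>, it is closed (\<open>difference_closed\<close>).

  For metrics of class \<open>C\<^sup>2\<close> one cannot differentiate the Euler-Lagrange equations with respect to the
  velocity, as the classical argument about the propagation of the fibre Hessian does. The argument above needs much
  less: since the first variation formula has a quadratic remainder, it suffices that extremals
  depend on their initial vectors in a Lipschitz way. Existence, uniqueness and Lipschitz dependence
  for short times are obtained from the momentum form \<open>q' = u\<close>, \<open>P (q, u)' = Q (q, u)\<close> of the equations for
  \<open>F1\<^sup>2\<close>, where \<open>P\<close> is strongly monotone in \<open>u\<close> by convexity (\<open>el_sol_exists\<close>, \<open>el_sol_stability\<close>,
  \<open>local_flow\<close>).

  Two facts link the local analysis to the hypotheses, which speak of critical points of the length and of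
  maximal curves. Extremals are exactly the solutions of the Euler-Lagrange equations in charts
  (\<open>EL_imp_extremal\<close>, \<open>extremal_imp_EL\<close>), and every extremal of constant speed extends to a geodesic
  (\<open>extremal_extends_to_geodesic\<close>). Together they show that each local solution of constant speed of the equations of \<open>F1\<close>
  also solves those of \<open>F2\<close>.
\<close>

section \<open>Maps of class C^k\<close>

lemma Ck_on_subset:
  assumes "Ck_on k f T" "S \<subseteq> T"
  shows "Ck_on k f S"
  using assms
proof (induction k arbitrary: f)
  case 0
  then show ?case by (auto intro: continuous_on_subset)
next
  case (Suc k)
  then show ?case by auto
qed

lemma frechet_derivative_cong_open:
  assumes "open S" "x \<in> S" "\<And>y. y \<in> S \<Longrightarrow> f y = g y"
  shows "frechet_derivative f (at x) = frechet_derivative g (at x)"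
proof -
  have "(f has_derivative D) (at x) \<longleftrightarrow> (g has_derivative D) (at x)" for D
    using has_derivative_transform_within_open[OF _ assms(1,2), of f D UNIV g]
      has_derivative_transform_within_open[OF _ assms(1,2), of g D UNIV f] assms(3) by auto
  then show ?thesis by (simp add: frechet_derivative_def)
qed

lemma Ck_on_cong:
  assumes "open S" "Ck_on k f S" "\<And>x. x \<in> S \<Longrightarrow> f x = g x"
  shows "Ck_on k g S"
  using assms(2,3)
proof (induction k arbitrary: f g)
  case 0
  then show ?case by (auto cong: continuous_on_cong)
next
  case (Suc k)
  have "g differentiable (at x)" if "x \<in> S" for x
  proof -
    have "(f has_derivative frechet_derivative f (at x)) (at x)"
      using Suc.prems(1) that by (simp add: frechet_derivative_works)
    then have "(g has_derivative frechet_derivative f (at x)) (at x)"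
      by (rule has_derivative_transform_within_open[OF _ assms(1) that Suc.prems(2)])
    then show ?thesis by (auto simp: differentiable_def)
  qed
  moreover have "Ck_on k (\<lambda>x. frechet_derivative g (at x) v) S" for v
  proof (rule Suc.IH)
    show "Ck_on k (\<lambda>x. frechet_derivative f (at x) v) S" using Suc.prems(1) by simp
    show "frechet_derivative f (at x) v = frechet_derivative g (at x) v" if "x \<in> S" for x
      using frechet_derivative_cong_open[OF assms(1) that Suc.prems(2)] by simp
  qed
  ultimately show ?case by simp
qed

lemma Ck_on_SucI:
  assumes "open S" "\<And>x. x \<in> S \<Longrightarrow> (f has_derivative f' x) (at x)"
    "\<And>v. Ck_on k (\<lambda>x. f' x v) S"
  shows "Ck_on (Suc k) f S"
proof -
  have "Ck_on k (\<lambda>x. frechet_derivative f (at x) v) S" for v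
    using frechet_derivative_at[OF assms(2)]
    by (intro Ck_on_cong[OF assms(1) assms(3)[of v]]) simp
  then show ?thesis using assms(2) by (auto simp: differentiable_def)
qed

lemma Ck_on_SucD:
  assumes "Ck_on (Suc k) f S"
  shows "\<And>x. x \<in> S \<Longrightarrow> (f has_derivative frechet_derivative f (at x)) (at x)"
    "\<And>v. Ck_on k (\<lambda>x. frechet_derivative f (at x) v) S"
  using assms by (auto simp: frechet_derivative_works)

lemma Ck_on_local:
  assumes "\<And>x. x \<in> S \<Longrightarrow> \<exists>T. open T \<and> x \<in> T \<and> Ck_on k f T"
  shows "Ck_on k f S"
  using assms
proof (induction k arbitrary: f)
  case 0
  have "isCont f x" if "x \<in> S" for x
    using 0[OF that] by (auto simp: continuous_on_eq_continuous_at)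
  then show ?case by (simp add: continuous_at_imp_continuous_on)
next
  case (Suc k)
  have "Ck_on k (\<lambda>x. frechet_derivative f (at x) v) S" for v
    using Suc.prems by (intro Suc.IH) fastforce
  then show ?case using Suc.prems by fastforce
qed

lemma Ck_on_Suc_imp: "Ck_on (Suc k) f S \<Longrightarrow> Ck_on k f S"
proof (induction k arbitrary: f)
  case 0
  then show ?case
    by (auto intro!: continuous_at_imp_continuous_on differentiable_imp_continuous_within)
next
  case (Suc k)
  show ?case unfolding Ck_on.simps(2)[of k]
    using Suc.prems Suc.IH unfolding Ck_on.simps(2)[of "Suc k"] by blast
qed

lemma Ck_on_le:
  assumes "Ck_on m f S" "k \<le> m"
  shows "Ck_on k f S"
  using assms(2,1) by (induction rule: inc_induct) (auto dest: Ck_on_Suc_imp simp del: Ck_on.simps)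

lemma Ck_on_imp_continuous_on: "Ck_on k f S \<Longrightarrow> continuous_on S f"
  using Ck_on_le[of k f S 0] by simp

lemma Ck_on_const [simp]: "open S \<Longrightarrow> Ck_on k (\<lambda>_. c) S"
proof (induction k arbitrary: c)
  case (Suc k)
  then show ?case by (intro Ck_on_SucI[where f' = "\<lambda>_ _. 0"]) auto
qed simp

lemma Ck_on_bounded_linear:
  assumes "bounded_linear L" "open S" "Ck_on k g S"
  shows "Ck_on k (\<lambda>x. L (g x)) S"
  using assms(3)
proof (induction k arbitrary: g)
  case 0
  then show ?case using assms(1) by (auto intro: bounded_linear.continuous_on)
next
  case (Suc k)
  show ?case
    using Suc.IH[OF Ck_on_SucD(2)[OF Suc.prems]] Ck_on_SucD(1)[OF Suc.prems]
    by (intro Ck_on_SucI[OF assms(2), where f' = "\<lambda>x v. L (frechet_derivative g (at x) v)"])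
      (auto intro: bounded_linear.has_derivative[OF assms(1)])
qed

lemma Ck_on_add:
  assumes "open S" "Ck_on k f S" "Ck_on k g S"
  shows "Ck_on k (\<lambda>x. f x + g x) S"
  using assms(2,3)
proof (induction k arbitrary: f g)
  case 0
  then show ?case by (auto intro: continuous_intros)
next
  case (Suc k)
  show ?case
    using Suc.IH[OF Ck_on_SucD(2)[OF Suc.prems(1)] Ck_on_SucD(2)[OF Suc.prems(2)]]
      Ck_on_SucD(1)[OF Suc.prems(1)] Ck_on_SucD(1)[OF Suc.prems(2)]
    by (intro Ck_on_SucI[OF assms(1), where
        f' = "\<lambda>x v. frechet_derivative f (at x) v + frechet_derivative g (at x) v"])
      (auto intro: has_derivative_add)
qed

lemma Ck_on_sum:
  assumes "open S" "finite I" "\<And>i. i \<in> I \<Longrightarrow> Ck_on k (f i) S"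
  shows "Ck_on k (\<lambda>x. \<Sum>i\<in>I. f i x) S"
  using assms(2,3)
proof (induction I rule: finite_induct)
  case empty
  then show ?case using assms(1) by simp
next
  case (insert i I)
  then show ?case using assms(1) by (simp add: Ck_on_add)
qed

lemma Ck_on_bilinear:
  fixes prod :: "'b::real_normed_vector \<Rightarrow> 'c::real_normed_vector \<Rightarrow> 'd::real_normed_vector"
  assumes "bounded_bilinear prod" "open S" "Ck_on k f S" "Ck_on k g S"
  shows "Ck_on k (\<lambda>x. prod (f x) (g x)) S"
  using assms(3,4)
proof (induction k arbitrary: f g)
  case 0
  then show ?case using assms(1) by (auto intro: bounded_bilinear.continuous_on)
next
  case (Suc k)
  note D = Ck_on_SucD[OF Suc.prems(1)] Ck_on_SucD[OF Suc.prems(2)]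
  show ?case
  proof (rule Ck_on_SucI[OF assms(2), where f' = "\<lambda>x v. prod (f x) (frechet_derivative g (at x) v)
        + prod (frechet_derivative f (at x) v) (g x)"])
    show "((\<lambda>x. prod (f x) (g x)) has_derivative (\<lambda>v. prod (f x) (frechet_derivative g (at x) v)
        + prod (frechet_derivative f (at x) v) (g x))) (at x)" if "x \<in> S" for x
      using bounded_bilinear.FDERIV[OF assms(1) D(1)[OF that] D(3)[OF that]] .
    show "Ck_on k (\<lambda>x. prod (f x) (frechet_derivative g (at x) v)
        + prod (frechet_derivative f (at x) v) (g x)) S" for v
      using Ck_on_Suc_imp[OF Suc.prems(1)] Ck_on_Suc_imp[OF Suc.prems(2)] D(2,4)
      by (intro Ck_on_add[OF assms(2)] Suc.IH) auto
  qed
qed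

lemma Ck_on_Pair:
  assumes "open S" "Ck_on k f S" "Ck_on k g S"
  shows "Ck_on k (\<lambda>x. (f x, g x)) S"
proof -
  have a: "bounded_linear (\<lambda>x. (x, 0))" "bounded_linear (\<lambda>x. (0, x))"
    by (auto intro!: bounded_linear_Pair bounded_linear_ident bounded_linear_zero)
  have "Ck_on k (\<lambda>x. (f x, 0) + (0, g x)) S"
    using Ck_on_bounded_linear[OF a(1) assms(1,2)] Ck_on_bounded_linear[OF a(2) assms(1,3)]
    by (rule Ck_on_add[OF assms(1)])
  then show ?thesis by simp
qed

lemma Ck_on_bounded_linear_id:
  assumes "open S" "bounded_linear L"
  shows "Ck_on k L S"
proof -
  have *: "(L has_derivative L) (at x)" for x
    using assms(2) by (rule bounded_linear_imp_has_derivative)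
  show ?thesis
  proof (cases k)
    case 0
    then show ?thesis using assms(2) by (simp add: linear_continuous_on)
  next
    case (Suc j)
    show ?thesis unfolding Suc using assms(1) *
      by (intro Ck_on_SucI[where f' = "\<lambda>_. L"]) auto
  qed
qed

lemma Ck_on_ident: "open S \<Longrightarrow> Ck_on k (\<lambda>x. x) S"
  by (rule Ck_on_bounded_linear_id[OF _ bounded_linear_ident])

lemma Ck_on_diff:
  assumes "open S" "Ck_on k f S" "Ck_on k g S"
  shows "Ck_on k (\<lambda>x. f x - g x) S"
  using Ck_on_add[OF assms(1,2) Ck_on_bounded_linear[OF _ assms(1,3), of uminus]]
  by (simp add: bounded_linear_minus[OF bounded_linear_ident])

text \<open>In the induction step the chain rule is expanded in a basis, which exhibits the derivative of the
  composition as a sum of products of maps of class \<open>C^k\<close>.\<close>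

lemma Ck_on_compose:
  fixes f :: "'b::euclidean_space \<Rightarrow> 'c::real_normed_vector" and g :: "'a::euclidean_space \<Rightarrow> 'b"
  assumes "open S" "Ck_on k f T" "Ck_on k g S" "g ` S \<subseteq> T"
  shows "Ck_on k (\<lambda>x. f (g x)) S"
  using assms(2-4)
proof (induction k arbitrary: f g)
  case 0
  then show ?case by (auto intro: continuous_on_compose2)
next
  case (Suc k)
  note D = Ck_on_SucD[OF Suc.prems(1)] Ck_on_SucD[OF Suc.prems(2)]
  let ?f' = "\<lambda>x v. \<Sum>b\<in>Basis. (frechet_derivative g (at x) v \<bullet> b) *\<^sub>R frechet_derivative f (at (g x)) b"
  show ?case
  proof (rule Ck_on_SucI[OF assms(1), where f' = ?f'])
    fix x assume x: "x \<in> S"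
    have gx: "g x \<in> T" using x Suc.prems(3) by auto
    have "((\<lambda>x. f (g x)) has_derivative (\<lambda>v. frechet_derivative f (at (g x)) (frechet_derivative g (at x) v))) (at x)"
      using diff_chain_at[OF D(3)[OF x] D(1)[OF gx]] by (simp add: o_def)
    moreover have "frechet_derivative f (at (g x)) w = (\<Sum>b\<in>Basis. (w \<bullet> b) *\<^sub>R frechet_derivative f (at (g x)) b)" for w
    proof -
      have l: "linear (frechet_derivative f (at (g x)))"
        using D(1)[OF gx] has_derivative_linear by blast
      have "frechet_derivative f (at (g x)) (\<Sum>b\<in>Basis. (w \<bullet> b) *\<^sub>R b) = (\<Sum>b\<in>Basis. (w \<bullet> b) *\<^sub>R frechet_derivative f (at (g x)) b)"
        by (simp add: linear_sum[OF l] linear_cmul[OF l])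
      then show ?thesis by (simp add: euclidean_representation)
    qed
    ultimately show "((\<lambda>x. f (g x)) has_derivative ?f' x) (at x)"
      by (rule has_derivative_eq_rhs[OF _ ext])
  next
    fix v
    show "Ck_on k (\<lambda>x. ?f' x v) S"
    proof (rule Ck_on_sum[OF assms(1) finite_Basis])
      fix b :: 'b assume "b \<in> Basis"
      show "Ck_on k (\<lambda>x. (frechet_derivative g (at x) v \<bullet> b) *\<^sub>R frechet_derivative f (at (g x)) b) S"
      proof (rule Ck_on_bilinear[OF bounded_bilinear_scaleR assms(1)])
        show "Ck_on k (\<lambda>x. frechet_derivative g (at x) v \<bullet> b) S"
          by (rule Ck_on_bounded_linear[OF bounded_linear_inner_left assms(1) D(4)])
        show "Ck_on k (\<lambda>x. frechet_derivative f (at (g x)) b) S"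
          using Suc.IH[OF D(2) Ck_on_Suc_imp[OF Suc.prems(2)] Suc.prems(3)] .
      qed
    qed
  qed
qed

lemma Ck_on_inverse: "Ck_on k (inverse :: real \<Rightarrow> real) (- {0})"
proof (induction k)
  case 0
  then show ?case by (auto intro: continuous_intros)
next
  case (Suc k)
  have o: "open (- {0::real})" by auto
  show ?case
  proof (rule Ck_on_SucI[OF o, where f' = "\<lambda>x v. - (inverse x * v * inverse x)"])
    show "(inverse has_derivative (\<lambda>v. - (inverse x * v * inverse x))) (at x)" if "x \<in> - {0}" for x :: real
      using that has_derivative_inverse'[of x UNIV] by auto
    fix v
    have "Ck_on k (\<lambda>x::real. (- v) * (inverse x * inverse x)) (- {0})"
      by (rule Ck_on_bounded_linear[OF bounded_linear_mult_right o])
        (rule Ck_on_bilinear[OF bounded_bilinear_mult o Suc Suc])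
    then show "Ck_on k (\<lambda>x::real. - (inverse x * v * inverse x)) (- {0})"
      by (simp add: mult.commute mult.left_commute)
  qed
qed

lemma Ck_on_real_SucI:
  fixes f :: "real \<Rightarrow> 'b::real_normed_vector"
  assumes "open S" "\<And>x. x \<in> S \<Longrightarrow> (f has_vector_derivative f' x) (at x)" "Ck_on k f' S"
  shows "Ck_on (Suc k) f S"
  using assms
  by (intro Ck_on_SucI[where f' = "\<lambda>x v. v *\<^sub>R f' x"] Ck_on_bounded_linear[OF bounded_linear_scaleR_right])
    (auto simp: has_vector_derivative_def)

lemma Ck_on_real_SucD:
  fixes f :: "real \<Rightarrow> 'b::real_normed_vector"
  assumes "Ck_on (Suc k) f S" "open S"
  shows "\<And>x. x \<in> S \<Longrightarrow> (f has_vector_derivative vector_derivative f (at x)) (at x)"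
    "Ck_on k (\<lambda>x. vector_derivative f (at x)) S"
proof -
  show a: "(f has_vector_derivative vector_derivative f (at x)) (at x)" if "x \<in> S" for x
    using assms that by (simp add: vector_derivative_works[symmetric] )
  have "frechet_derivative f (at x) 1 = vector_derivative f (at x)" if "x \<in> S" for x
    using frechet_derivative_at[OF a[OF that, unfolded has_vector_derivative_def]]
    by (metis scaleR_one)
  then show "Ck_on k (\<lambda>x. vector_derivative f (at x)) S"
    by (rule Ck_on_cong[OF assms(2) Ck_on_SucD(2)[OF assms(1), of 1]])
qed

lemma continuous_on_frechet_derivative:
  "Ck_on (Suc k) f S \<Longrightarrow> continuous_on S (\<lambda>x. frechet_derivative f (at x) v)"
  by (metis Ck_on_SucD(2) Ck_on_imp_continuous_on)

lemma has_vector_derivative_line: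
  assumes "(f has_derivative f') (at (x + t *\<^sub>R v))"
  shows "((\<lambda>t. f (x + t *\<^sub>R v)) has_vector_derivative f' v) (at t)"
proof -
  have "((\<lambda>t. x + t *\<^sub>R v) has_vector_derivative v) (at t)"
    by (auto intro!: derivative_eq_intros)
  from vector_derivative_diff_chain_within[OF this has_derivative_at_withinI[OF assms]]
  show ?thesis by (simp add: o_def)
qed

text \<open>Symmetry of second derivatives follows by differentiating
  \<open>f (x + s u + t v) - f (x + s u) = \<integral>\<^sub>0\<^sup>t D f (x + s u + \<tau> v) v d\<tau>\<close> first in \<open>s\<close>
  under the integral and then in \<open>t\<close>.\<close>

lemma second_derivative_symmetric:
  fixes f :: "'a::euclidean_space \<Rightarrow> 'b::banach"
  assumes C2: "Ck_on 2 f S" and S: "open S" and x: "x \<in> S"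
  shows "frechet_derivative (\<lambda>y. frechet_derivative f (at y) u) (at x) v
       = frechet_derivative (\<lambda>y. frechet_derivative f (at y) v) (at x) u"
proof -
  define D where "D = (\<lambda>w y. frechet_derivative f (at y) w)"
  define E where "E = (\<lambda>w w' y. frechet_derivative (D w) (at y) w')"
  have C: "Ck_on (Suc (Suc 0)) f S" using C2 by (simp add: numeral_2_eq_2)
  have df: "(f has_derivative (\<lambda>w. D w y)) (at y)" if "y \<in> S" for y
    using Ck_on_SucD(1)[OF C that] by (simp add: D_def)
  have C1: "Ck_on (Suc 0) (D w) S" for w
    using Ck_on_SucD(2)[OF C, of w] unfolding D_def .
  have dD: "(D w has_derivative (\<lambda>w'. E w w' y)) (at y)" if "y \<in> S" for y w
    using Ck_on_SucD(1)[OF C1 that, of w] by (simp add: E_def)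
  have cE: "continuous_on S (E w w')" for w w'
    using continuous_on_frechet_derivative[OF C1, of w w'] unfolding E_def .
  define g where "g = (\<lambda>(s::real, t::real). x + s *\<^sub>R u + t *\<^sub>R v)"
  have "continuous_on UNIV g" unfolding g_def split_def by (intro continuous_intros)
  then have "open (g -` S)" using S open_vimage by blast
  moreover have "(0, 0) \<in> g -` S" using x by (simp add: g_def)
  ultimately obtain r0 where r0: "r0 > 0" "ball (0,0) r0 \<subseteq> g -` S"
    by (meson openE)
  define r where "r = r0 / 3"
  have r: "r > 0" using r0 by (simp add: r_def)
  have gS: "x + s *\<^sub>R u + t *\<^sub>R v \<in> S" if "s \<in> {-r..r}" "t \<in> {0..r}" for s t
  proof -
    have "dist (0, 0) (s, t) \<le> \<bar>s\<bar> + \<bar>t\<bar>"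
      unfolding dist_Pair_Pair by (simp add: dist_real_def sqrt_sum_squares_le_sum_abs)
    also have "\<dots> < r0" using that r0(1) by (auto simp: r_def)
    finally show ?thesis using r0(2) by (auto simp: g_def)
  qed
  have dt: "((\<lambda>t. f (x + s *\<^sub>R u + t *\<^sub>R v)) has_vector_derivative D v (x + s *\<^sub>R u + t *\<^sub>R v)) (at t)"
    if "s \<in> {-r..r}" "t \<in> {0..r}" for s t
    by (rule has_vector_derivative_line[OF df[OF gS[OF that]]])
  have ds: "((\<lambda>s. f (x + s *\<^sub>R u + t *\<^sub>R v)) has_vector_derivative D u (x + s *\<^sub>R u + t *\<^sub>R v)) (at s)"
    if "s \<in> {-r..r}" "t \<in> {0..r}" for s t
    using has_vector_derivative_line[of _ _ "x + t *\<^sub>R v" s u, OF df] gS[OF that] by (simp add: ac_simps)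
  have dts: "((\<lambda>s. D v (x + s *\<^sub>R u + t *\<^sub>R v)) has_vector_derivative E v u (x + s *\<^sub>R u + t *\<^sub>R v)) (at s)"
    if "s \<in> {-r..r}" "t \<in> {0..r}" for s t
    using has_vector_derivative_line[of _ _ "x + t *\<^sub>R v" s u, OF dD] gS[OF that] by (simp add: ac_simps)
  have dst: "((\<lambda>t. D u (x + s *\<^sub>R u + t *\<^sub>R v)) has_vector_derivative E u v (x + s *\<^sub>R u + t *\<^sub>R v)) (at t)"
    if "s \<in> {-r..r}" "t \<in> {0..r}" for s t
    by (rule has_vector_derivative_line[OF dD[OF gS[OF that]]])
  have int: "D u (x + t *\<^sub>R v) - D u x = integral {0..t} (\<lambda>\<tau>. E v u (x + \<tau> *\<^sub>R v))"
    if t: "t \<in> {0..r}" for t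
  proof -
    have i: "((\<lambda>\<tau>. D v (x + s *\<^sub>R u + \<tau> *\<^sub>R v)) has_integral
        f (x + s *\<^sub>R u + t *\<^sub>R v) - f (x + s *\<^sub>R u + 0 *\<^sub>R v)) {0..t}" if "s \<in> {-r..r}" for s
      using t that
      by (intro fundamental_theorem_of_calculus has_vector_derivative_at_within[OF dt]) auto
    have "((\<lambda>s. integral (cbox 0 t) (\<lambda>\<tau>. D v (x + s *\<^sub>R u + \<tau> *\<^sub>R v))) has_vector_derivative
        integral (cbox 0 t) (\<lambda>\<tau>. E v u (x + 0 *\<^sub>R u + \<tau> *\<^sub>R v))) (at 0 within {-r..r})"
    proof (rule leibniz_rule_vector_derivative)
      fix s \<tau> assume "s \<in> {-r..r}" "\<tau> \<in> cbox 0 t"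
      then show "((\<lambda>s. D v (x + s *\<^sub>R u + \<tau> *\<^sub>R v)) has_vector_derivative E v u (x + s *\<^sub>R u + \<tau> *\<^sub>R v)) (at s within {-r..r})"
        using t by (intro has_vector_derivative_at_within[OF dts]) auto
    next
      fix s assume "s \<in> {-r..r}"
      then show "(\<lambda>\<tau>. D v (x + s *\<^sub>R u + \<tau> *\<^sub>R v)) integrable_on cbox 0 t"
        using i by (auto simp: integrable_on_def)
    next
      show "continuous_on ({-r..r} \<times> cbox 0 t) (\<lambda>(s, \<tau>). E v u (x + s *\<^sub>R u + \<tau> *\<^sub>R v))"
        unfolding split_def using gS t
        by (intro continuous_on_compose2[OF cE] continuous_intros) auto
    qed (use r in auto)
    then have A: "((\<lambda>s. integral {0..t} (\<lambda>\<tau>. D v (x + s *\<^sub>R u + \<tau> *\<^sub>R v))) has_vector_derivative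
        integral {0..t} (\<lambda>\<tau>. E v u (x + \<tau> *\<^sub>R v))) (at 0 within {-r..r})" by simp
    have B: "((\<lambda>s. f (x + s *\<^sub>R u + t *\<^sub>R v) - f (x + s *\<^sub>R u + 0 *\<^sub>R v)) has_vector_derivative
        D u (x + 0 *\<^sub>R u + t *\<^sub>R v) - D u (x + 0 *\<^sub>R u + 0 *\<^sub>R v)) (at 0 within {-r..r})"
      using r t by (intro has_vector_derivative_diff has_vector_derivative_at_within[OF ds]) auto
    have eq: "integral {0..t} (\<lambda>\<tau>. D v (x + s *\<^sub>R u + \<tau> *\<^sub>R v)) = f (x + s *\<^sub>R u + t *\<^sub>R v) - f (x + s *\<^sub>R u + 0 *\<^sub>R v)"
      if "s \<in> {-r..r}" for s using integral_unique[OF i[OF that]] .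
    have "((\<lambda>s. integral {0..t} (\<lambda>\<tau>. D v (x + s *\<^sub>R u + \<tau> *\<^sub>R v))) has_vector_derivative
        D u (x + 0 *\<^sub>R u + t *\<^sub>R v) - D u (x + 0 *\<^sub>R u + 0 *\<^sub>R v)) (at 0 within {-r..r})"
      by (rule has_vector_derivative_transform[OF _ eq B]) (use r in auto)
    with A show ?thesis
      using vector_derivative_unique_within_closed_interval[of "-r" r 0] r by simp
  qed
  have "((\<lambda>t. integral {0..t} (\<lambda>\<tau>. E v u (x + \<tau> *\<^sub>R v))) has_vector_derivative E v u (x + 0 *\<^sub>R v)) (at 0 within {0..r})"
    using gS[of 0] r
    by (intro integral_has_vector_derivative continuous_on_compose2[OF cE] continuous_intros) auto
  then have "((\<lambda>t. D u (x + t *\<^sub>R v) - D u x) has_vector_derivative E v u (x + 0 *\<^sub>R v)) (at 0 within {0..r})"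
    by (rule has_vector_derivative_transform[OF _ int, rotated 2]) (use r in auto)
  moreover have "((\<lambda>t. D u (x + t *\<^sub>R v) - D u x) has_vector_derivative E u v x) (at 0 within {0..r})"
    using has_vector_derivative_diff_const[of "\<lambda>t. D u (x + t *\<^sub>R v)" "D u x"] has_vector_derivative_at_within[OF dst[of 0 0]] r
    by simp
  ultimately have "E u v x = E v u x"
    using vector_derivative_unique_within_closed_interval[of 0 r 0] r by simp
  then show ?thesis by (simp add: E_def D_def)
qed

section \<open>First-order systems with monotone momentum\<close>

lemma has_vector_derivative_bound:
  fixes g :: "real \<Rightarrow> 'a::real_normed_vector"
  assumes "convex J" "\<And>s. s \<in> J \<Longrightarrow> (g has_vector_derivative g' s) (at s within J)"
    "\<And>s. s \<in> J \<Longrightarrow> norm (g' s) \<le> c" "t \<in> J" "s \<in> J"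
  shows "norm (g t - g s) \<le> c * \<bar>t - s\<bar>"
proof -
  have "norm (g t - g s) \<le> c * norm (t - s)"
  proof (rule differentiable_bound[OF assms(1) _ _ assms(4,5)])
    show "(g has_derivative (\<lambda>x. x *\<^sub>R g' s)) (at s within J)" if "s \<in> J" for s
      using assms(2)[OF that] by (simp add: has_vector_derivative_def)
    show "onorm (\<lambda>x. x *\<^sub>R g' s) \<le> c" if "s \<in> J" for s
      using mult_left_mono[OF assms(3)[OF that] abs_ge_zero] by (intro onorm_le) (simp add: mult.commute)
  qed
  then show ?thesis by simp
qed

text \<open>The primitive vanishing at \<open>0\<close>, on the interval from \<open>-\<tau>\<close> to \<open>\<tau>\<close>; written as a difference,
  it needs no distinction between positive and negative times.\<close>

definition signed_integral :: "real \<Rightarrow> (real \<Rightarrow> 'a::banach) \<Rightarrow> real \<Rightarrow> 'a" where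
  "signed_integral \<tau> g t = integral {-\<tau>..t} g - integral {-\<tau>..0} g"

lemma signed_integral_0 [simp]: "signed_integral \<tau> g 0 = 0"
  by (simp add: signed_integral_def)

lemma signed_integral_derivative:
  assumes "continuous_on {-\<tau>..\<tau>} g" "t \<in> {-\<tau>..\<tau>}"
  shows "(signed_integral \<tau> g has_vector_derivative g t) (at t within {-\<tau>..\<tau>})"
  unfolding signed_integral_def
  using has_vector_derivative_diff_const[of "\<lambda>t. integral {-\<tau>..t} g" "integral {-\<tau>..0} g"]
    integral_has_vector_derivative[OF assms] by simp

lemma signed_integral_diff_bound:
  assumes "continuous_on {-\<tau>..\<tau>} g" "continuous_on {-\<tau>..\<tau>} h" "t \<in> {-\<tau>..\<tau>}"
    "\<And>s. s \<in> {-\<tau>..\<tau>} \<Longrightarrow> norm (g s - h s) \<le> c"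
  shows "norm (signed_integral \<tau> g t - signed_integral \<tau> h t) \<le> c * \<tau>"
proof -
  have "0 \<le> c" using assms(4)[OF assms(3)] norm_ge_zero order_trans by blast
  have "norm ((signed_integral \<tau> g t - signed_integral \<tau> h t) - (signed_integral \<tau> g 0 - signed_integral \<tau> h 0))
    \<le> c * \<bar>t - 0\<bar>"
    using assms
    by (intro has_vector_derivative_bound[where J = "{-\<tau>..\<tau>}" and g' = "\<lambda>s. g s - h s"
          and g = "\<lambda>t. signed_integral \<tau> g t - signed_integral \<tau> h t"]
        has_vector_derivative_diff signed_integral_derivative) auto
  also have "\<dots> \<le> c * \<tau>" using assms(3) \<open>0 \<le> c\<close> by (intro mult_left_mono) auto
  finally show ?thesis by simp
qed

text \<open>Here \<open>P\<close> and \<open>Q\<close> play the roles of the derivatives of a Lagrangian in the velocity and in the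
  position, i.e. of momentum and force, and \<open>P'\<close> is the derivative of \<open>P\<close>. Convexity of the
  Lagrangian appears twice: as strong monotonicity of \<open>P\<close> in the velocity, which drives the
  contraction and stability arguments, and as coercivity of \<open>P'\<close>, which is what makes the acceleration exist.\<close>

definition el_region :: "('e::euclidean_space \<times> 'e \<Rightarrow> 'e) \<Rightarrow> ('e \<times> 'e \<Rightarrow> 'e \<times> 'e \<Rightarrow> 'e) \<Rightarrow>
    ('e \<times> 'e \<Rightarrow> 'e) \<Rightarrow> ('e \<times> 'e) set \<Rightarrow> real \<Rightarrow> real \<Rightarrow> bool" where
  "el_region P P' Q B K m \<longleftrightarrow> 0 < m \<and> m \<le> K \<and>
     (\<forall>z\<in>B. \<forall>z'\<in>B. norm (P z - P z') \<le> K * norm (z - z')) \<and>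
     (\<forall>z\<in>B. \<forall>z'\<in>B. norm (Q z - Q z') \<le> K * norm (z - z')) \<and>
     (\<forall>q u u'. (q, u) \<in> B \<longrightarrow> (q, u') \<in> B \<longrightarrow> m * (norm (u - u'))\<^sup>2 \<le> (P (q, u) - P (q, u')) \<bullet> (u - u')) \<and>
     (\<forall>z\<in>B. (P has_derivative P' z) (at z)) \<and>
     (\<forall>\<zeta>. continuous_on B (\<lambda>z. P' z \<zeta>)) \<and>
     (\<forall>z\<in>B. \<forall>e. m * (norm e)\<^sup>2 \<le> P' z (0, e) \<bullet> e)"

lemma el_regionD:
  assumes "el_region P P' Q B K m"
  shows "0 < m" "m \<le> K" "0 < K"
    "\<And>z z'. z \<in> B \<Longrightarrow> z' \<in> B \<Longrightarrow> norm (P z - P z') \<le> K * norm (z - z')"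
    "\<And>z z'. z \<in> B \<Longrightarrow> z' \<in> B \<Longrightarrow> norm (Q z - Q z') \<le> K * norm (z - z')"
    "\<And>q u u'. (q, u) \<in> B \<Longrightarrow> (q, u') \<in> B \<Longrightarrow> m * (norm (u - u'))\<^sup>2 \<le> (P (q, u) - P (q, u')) \<bullet> (u - u')"
    "\<And>z. z \<in> B \<Longrightarrow> (P has_derivative P' z) (at z)"
    "\<And>\<zeta>. continuous_on B (\<lambda>z. P' z \<zeta>)"
    "\<And>z e. z \<in> B \<Longrightarrow> m * (norm e)\<^sup>2 \<le> P' z (0, e) \<bullet> e"
  using assms unfolding el_region_def by auto

lemma el_region_monotone:
  assumes "el_region P P' Q B K m" "(q, u) \<in> B" "(q, u') \<in> B"
  shows "m * norm (u - u') \<le> norm (P (q, u) - P (q, u'))"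
proof (cases "u = u'")
  case False
  have "m * norm (u - u') * norm (u - u') \<le> (P (q, u) - P (q, u')) \<bullet> (u - u')"
    using el_regionD(6)[OF assms] by (simp add: power2_eq_square)
  also have "\<dots> \<le> norm (P (q, u) - P (q, u')) * norm (u - u')" by (rule norm_cauchy_schwarz)
  finally show ?thesis using False by simp
qed simp

lemma continuous_on_lipschitz_bound:
  fixes f :: "'a::real_normed_vector \<Rightarrow> 'b::real_normed_vector"
  assumes "\<And>z z'. z \<in> B \<Longrightarrow> z' \<in> B \<Longrightarrow> norm (f z - f z') \<le> K * norm (z - z')" "0 \<le> K"
  shows "continuous_on B f"
  using assms by (intro lipschitz_on_continuous_on[of K] lipschitz_onI) (auto simp: dist_norm)

text \<open>The Euler-Lagrange equations in momentum form. The momentum is differentiated as a whole, so that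
  the equations make sense before the velocity is known to be differentiable.\<close>

definition el_sol :: "('e::euclidean_space \<times> 'e \<Rightarrow> 'e) \<Rightarrow> ('e \<times> 'e \<Rightarrow> 'e) \<Rightarrow> ('e \<times> 'e) set \<Rightarrow>
    real set \<Rightarrow> (real \<Rightarrow> 'e) \<Rightarrow> (real \<Rightarrow> 'e) \<Rightarrow> bool" where
  "el_sol P Q B J q u \<longleftrightarrow> (\<forall>t\<in>J. (q t, u t) \<in> B) \<and> continuous_on J u \<and>
     (\<forall>t\<in>J. (q has_vector_derivative u t) (at t within J)) \<and>
     (\<forall>t\<in>J. ((\<lambda>t. P (q t, u t)) has_vector_derivative Q (q t, u t)) (at t within J))"

lemma el_sol_subset:
  assumes "el_sol P Q B J q u" "J' \<subseteq> J"
  shows "el_sol P Q B J' q u"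
  using assms unfolding el_sol_def
  by (auto intro: continuous_on_subset has_vector_derivative_within_subset)

lemma norm_Pair_le: "norm (a, b) \<le> norm a + norm b"
  by (simp add: norm_Pair sqrt_sum_squares_le_sum_abs[of "norm a" "norm b", simplified])

text \<open>For short times no Gronwall inequality is needed: let \<open>M\<close> be the largest difference of the
  velocities. Integrating the equations bounds the differences of positions and momenta by the initial
  difference plus a multiple of \<open>\<tau> M\<close>; strong monotonicity turns this into a bound for \<open>M\<close> itself, where
  the multiple of \<open>\<tau> M\<close> is absorbed by the left side. The case of equal initial data is uniqueness.\<close>

lemma el_sol_stability:
  fixes P :: "'e::euclidean_space \<times> 'e \<Rightarrow> 'e"
  assumes reg: "el_region P P' Q B K m"
    and sol: "el_sol P Q B {-\<tau>..\<tau>} q u" "el_sol P Q B {-\<tau>..\<tau>} q' u'"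
    and \<tau>: "0 < \<tau>" "\<tau> \<le> 1" "\<tau> \<le> m / (12 * K)"
    and mixed: "\<And>t. t \<in> {-\<tau>..\<tau>} \<Longrightarrow> (q t, u' t) \<in> B"
    and t: "t \<in> {-\<tau>..\<tau>}"
  shows "norm (q t - q' t) + norm (u t - u' t) \<le> (1 + 12 * K / m) * (norm (q 0 - q' 0) + norm (u 0 - u' 0))"
proof -
  note R = el_regionD[OF reg]
  let ?J = "{-\<tau>..\<tau>}"
  define d where "d = norm (q 0 - q' 0) + norm (u 0 - u' 0)"
  have d0: "0 \<le> d" by (simp add: d_def)
  have c: "continuous_on ?J (\<lambda>t. norm (u t - u' t))"
    using sol by (auto simp: el_sol_def intro!: continuous_intros)
  obtain t1 where t1: "t1 \<in> ?J" "\<And>t. t \<in> ?J \<Longrightarrow> norm (u t - u' t) \<le> norm (u t1 - u' t1)"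
    using continuous_attains_sup[OF _ _ c] \<tau> by auto
  define M where "M = norm (u t1 - u' t1)"
  have M0: "0 \<le> M" by (simp add: M_def)
  have J0: "0 \<in> ?J" using \<tau> by auto
  have Dq: "norm (q t - q' t) \<le> d + \<tau> * M" if "t \<in> ?J" for t
  proof -
    have "norm ((q t - q' t) - (q 0 - q' 0)) \<le> M * \<bar>t - 0\<bar>"
      using sol t1 that J0
      by (intro has_vector_derivative_bound[where J = ?J and g' = "\<lambda>s. u s - u' s" and g = "\<lambda>t. q t - q' t"]
        has_vector_derivative_diff) (auto simp: M_def el_sol_def)
    also have "\<dots> \<le> M * \<tau>" using that M0 by (intro mult_left_mono) auto
    finally have "norm (q t - q' t) \<le> norm (q 0 - q' 0) + M * \<tau>"
      using norm_triangle_sub[of "q t - q' t" "q 0 - q' 0"] by linarith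
    then show ?thesis by (simp add: d_def mult.commute) (smt (verit) norm_ge_zero)
  qed
  have nP: "norm ((a, b) - (a', b')) \<le> norm (a - a') + norm (b - b')" for a b a' b' :: 'e
    using norm_Pair_le by simp
  have DQ: "norm (Q (q t, u t) - Q (q' t, u' t)) \<le> K * (d + 2 * M)" if "t \<in> ?J" for t
  proof -
    have "norm (Q (q t, u t) - Q (q' t, u' t)) \<le> K * norm ((q t, u t) - (q' t, u' t))"
      using sol that by (intro R(5)) (auto simp: el_sol_def)
    also have "\<dots> \<le> K * (norm (q t - q' t) + norm (u t - u' t))"
      using R(3) by (intro mult_left_mono nP) auto
    also have "\<dots> \<le> K * (d + 2 * M)"
    proof (intro mult_left_mono)
      have "\<tau> * M \<le> 1 * M" using \<tau> M0 by (intro mult_right_mono) auto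
      then show "norm (q t - q' t) + norm (u t - u' t) \<le> d + 2 * M"
        using Dq[OF that] t1(2)[OF that] by (simp add: M_def)
    qed (use R(3) in auto)
    finally show ?thesis .
  qed
  define p where "p = (\<lambda>t. P (q t, u t) - P (q' t, u' t))"
  have "norm (p t1 - p 0) \<le> K * (d + 2 * M) * \<bar>t1 - 0\<bar>"
    unfolding p_def using sol t1 J0 DQ
    by (intro has_vector_derivative_bound[where J = ?J and g' = "\<lambda>t. Q (q t, u t) - Q (q' t, u' t)"
        and g = "\<lambda>t. P (q t, u t) - P (q' t, u' t)"] has_vector_derivative_diff)
      (auto simp: el_sol_def)
  also have "\<dots> \<le> K * (d + 2 * M) * \<tau>"
    using t1 d0 M0 R(3) by (intro mult_left_mono) auto
  finally have p1: "norm (p t1) \<le> norm (p 0) + K * (d + 2 * M) * \<tau>"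
    using norm_triangle_sub[of "p t1" "p 0"] by linarith
  have p0: "norm (p 0) \<le> K * d"
  proof -
    have "norm (p 0) \<le> K * norm ((q 0, u 0) - (q' 0, u' 0))"
      unfolding p_def using sol J0 by (intro R(4)) (auto simp: el_sol_def)
    also have "\<dots> \<le> K * d" unfolding d_def using R(3) by (intro mult_left_mono nP) auto
    finally show ?thesis .
  qed
  have "m * M \<le> norm (P (q t1, u t1) - P (q t1, u' t1))"
    unfolding M_def using sol t1 mixed by (intro el_region_monotone[OF reg]) (auto simp: el_sol_def)
  also have "\<dots> = norm (p t1 + (P (q' t1, u' t1) - P (q t1, u' t1)))" by (simp add: p_def)
  also have "\<dots> \<le> norm (p t1) + norm (P (q' t1, u' t1) - P (q t1, u' t1))" by (rule norm_triangle_ineq)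
  also have "\<dots> \<le> norm (p t1) + K * norm ((q' t1, u' t1) - (q t1, u' t1))"
    using sol t1 mixed by (intro add_left_mono R(4)) (auto simp: el_sol_def)
  also have "norm ((q' t1, u' t1) - (q t1, u' t1)) = norm (q t1 - q' t1)"
    by (simp add: norm_Pair norm_minus_commute)
  also have "norm (p t1) + K * norm (q t1 - q' t1) \<le> K * d + K * (d + 2 * M) * \<tau> + K * (d + \<tau> * M)"
    using p1 p0 Dq[OF t1(1)] R(3) by (intro add_mono) auto
  also have "\<dots> = 2 * K * d + K * d * \<tau> + 3 * (K * \<tau>) * M" by (simp add: algebra_simps)
  also have "\<dots> \<le> 2 * K * d + K * d * 1 + 3 * (m / 12) * M"
  proof (intro add_mono mult_left_mono mult_right_mono)
    show "K * \<tau> \<le> m / 12" using \<tau>(3) R(3) by (simp add: field_simps)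
  qed (use \<tau> R(3) d0 M0 in auto)
  finally have "m * M \<le> 3 * K * d + m / 4 * M" by simp
  then have "M \<le> 4 * K / m * d" using R(1) by (simp add: field_simps)
  moreover have "norm (q t - q' t) + norm (u t - u' t) \<le> d + 2 * M"
  proof -
    have "\<tau> * M \<le> 1 * M" using \<tau> M0 by (intro mult_right_mono) auto
    then show ?thesis using Dq[OF t] t1(2)[OF t] by (simp add: M_def)
  qed
  ultimately have "norm (q t - q' t) + norm (u t - u' t) \<le> d + 8 * K / m * d" by simp
  also have "\<dots> \<le> d + 12 * K / m * d"
    using d0 R(1,3) by (intro add_left_mono mult_right_mono divide_right_mono) auto
  finally show ?thesis by (simp add: d_def algebra_simps)
qed

text \<open>The unknown is the velocity \<open>w\<close> alone: the position \<open>qq w\<close> is its integral, and \<open>\<Phi>\<close> moves \<open>w\<close> against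
  its defect in the integrated momentum equation. By strong monotonicity of \<open>P\<close> this is a contraction
  for a suitable step size \<open>\<epsilon>\<close>, up to terms of order \<open>\<tau>\<close> from the integrals. Working with \<open>P\<close> directly
  avoids inverting the Legendre transformation.\<close>

lemma el_sol_exists:
  fixes P :: "'e::euclidean_space \<times> 'e \<Rightarrow> 'e"
  assumes reg: "el_region P P' Q (cball a R \<times> cball b R) K m" and R0: "R > 0"
  shows "\<exists>\<tau>>0. \<tau> \<le> 1 \<and> \<tau> \<le> m / (12 * K) \<and> (\<forall>q0\<in>cball a (R/2). \<forall>u0\<in>cball b (R/2). \<exists>q u.
     q 0 = q0 \<and> u 0 = u0 \<and> el_sol P Q (cball a R \<times> cball b R) {-\<tau>..\<tau>} q u)"
proof -
  note R = el_regionD[OF reg]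
  let ?B = "cball a R \<times> cball b R"
  have contP: "continuous_on ?B P" and contQ: "continuous_on ?B Q"
    using R(3-5) by (auto intro!: continuous_on_lipschitz_bound[of _ _ K])
  define V where "V = norm b + R"
  define M where "M = norm (Q (a, b)) + K * (R + R)"
  have M: "norm (Q z) \<le> M" if "z \<in> ?B" for z
  proof -
    have "norm (Q z - Q (a, b)) \<le> K * norm (z - (a, b))" using R0 that by (intro R(5)) auto
    also have "\<dots> \<le> K * (R + R)"
    proof (intro mult_left_mono)
      show "norm (z - (a, b)) \<le> R + R"
        using that norm_Pair_le[of "fst z - a" "snd z - b"]
        by (cases z) (auto simp: dist_norm norm_minus_commute)
    qed (use R in auto)
    finally show ?thesis unfolding M_def using norm_triangle_sub[of "Q z" "Q (a,b)"] by linarith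
  qed
  have VM: "0 < V" "0 \<le> M" using R0 R(3) by (auto simp: V_def M_def add_nonneg_pos)
  \<comment> \<open>This \<open>\<epsilon>\<close> minimizes \<open>1 - 2 \<epsilon> m + \<epsilon>\<^sup>2 K\<^sup>2\<close>, the squared contraction factor of a step \<open>u - \<epsilon> P (q, u)\<close>.\<close>
  define \<epsilon> where "\<epsilon> = m / K\<^sup>2"
  have e0: "\<epsilon> > 0" using R by (simp add: \<epsilon>_def)
  define \<tau> where "\<tau> = Min {1, m / (12 * K), R / (2 * V), m * R / (8 * (K * V + M))}"
  have KVM: "K * V + M > 0" using R VM by (simp add: add_pos_nonneg)
  have t0: "0 < \<tau>" using R R0 VM KVM by (simp add: \<tau>_def)
  have t1: "\<tau> \<le> 1" "\<tau> \<le> m / (12 * K)" "\<tau> \<le> R / (2 * V)" "\<tau> \<le> m * R / (8 * (K * V + M))"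
    by (simp_all add: \<tau>_def)
  let ?J = "{-\<tau>..\<tau>}"
  define \<kappa> where "\<kappa> = 1 - \<epsilon> * m / 4"
  have em: "\<epsilon> * m \<le> 1"
  proof -
    have "m * m \<le> K * K" using R by (intro mult_mono) auto
    then show ?thesis using R by (simp add: \<epsilon>_def power2_eq_square field_simps)
  qed
  have kap: "0 \<le> \<kappa>" "\<kappa> < 1" using em e0 R by (auto simp: \<kappa>_def)
  have "\<exists>q u. q 0 = q0 \<and> u 0 = u0 \<and> el_sol P Q ?B ?J q u"
    if q0: "q0 \<in> cball a (R/2)" and u0: "u0 \<in> cball b (R/2)" for q0 u0
  proof -
    define X where "X = (PiC UNIV (\<lambda>_. cball u0 (R/2)) :: (real \<Rightarrow>\<^sub>C 'e) set)"
    define qq where "qq = (\<lambda>(w :: real \<Rightarrow>\<^sub>C 'e) t. q0 + signed_integral \<tau> (apply_bcontfun w) t)"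
    define \<Phi> where "\<Phi> = (\<lambda>(w :: real \<Rightarrow>\<^sub>C 'e) t. apply_bcontfun w t -
      \<epsilon> *\<^sub>R (P (qq w t, apply_bcontfun w t) - P (q0, u0) - signed_integral \<tau> (\<lambda>s. Q (qq w s, apply_bcontfun w s)) t))"
    \<comment> \<open>Bounded continuous functions live on the whole line, so time is clamped to the interval.\<close>
    define cl where "cl = (\<lambda>t. max (-\<tau>) (min \<tau> t))"
    have cl: "cl t \<in> ?J" "t \<in> ?J \<Longrightarrow> cl t = t" for t using t0 by (auto simp: cl_def)
    have ccl: "continuous_on UNIV cl" unfolding cl_def by (intro continuous_intros)
    have X: "w \<in> X \<longleftrightarrow> (\<forall>t. apply_bcontfun w t \<in> cball u0 (R/2))" for w
      by (auto simp: X_def mem_PiC_iff)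
    have cbb: "cball u0 (R/2) \<subseteq> cball b R"
      using u0 by (intro subsetI) (auto intro: order_trans[OF dist_triangle[of _ _ u0]] simp: dist_commute)
    have qd: "(qq w has_vector_derivative apply_bcontfun w t) (at t within ?J)" if "t \<in> ?J" for w t
      unfolding qq_def using signed_integral_derivative[OF continuous_on_apply_bcontfun that]
      by (auto intro!: derivative_eq_intros)
    have qc: "continuous_on ?J (qq w)" for w
      unfolding continuous_on_eq_continuous_within by (intro ballI has_vector_derivative_continuous[OF qd])
    have q_0 [simp]: "qq w 0 = q0" for w by (simp add: qq_def)
    have J0: "0 \<in> ?J" using t0 by simp
    have inB: "(qq w t, apply_bcontfun w t) \<in> ?B" if w: "w \<in> X" and t: "t \<in> ?J" for w t
    proof -
      have "norm (qq w t - qq w 0) \<le> V * \<bar>t - 0\<bar>"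
      proof (rule has_vector_derivative_bound[OF _ qd _ t J0])
        fix s
        have "apply_bcontfun w s \<in> cball b R" using w X cbb by blast
        then show "norm (apply_bcontfun w s) \<le> V"
          using norm_triangle_sub[of "apply_bcontfun w s" b]
          by (simp add: V_def dist_norm norm_minus_commute)
      qed auto
      also have "\<dots> \<le> V * \<tau>" using t VM by (intro mult_left_mono) auto
      also have "\<dots> \<le> R / 2" using t1(3) VM by (simp add: field_simps)
      finally have "dist q0 (qq w t) \<le> R / 2" by (simp add: dist_norm norm_minus_commute)
      then have "qq w t \<in> cball a R"
        using q0 dist_triangle[of a "qq w t" q0] by auto
      then show ?thesis using w X cbb by blast
    qed
    have cw: "continuous_on ?J (\<lambda>t. (qq w t, apply_bcontfun w t))" for w
      by (intro continuous_on_Pair qc continuous_on_apply_bcontfun)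
    have cPw: "continuous_on ?J (\<lambda>t. P (qq w t, apply_bcontfun w t))"
      and cQw: "continuous_on ?J (\<lambda>t. Q (qq w t, apply_bcontfun w t))" if "w \<in> X" for w
      using inB[OF that] by (auto intro!: continuous_on_compose2[OF contP cw] continuous_on_compose2[OF contQ cw])
    have cI: "continuous_on ?J (signed_integral \<tau> (\<lambda>s. Q (qq w s, apply_bcontfun w s)))" if "w \<in> X" for w
      using has_vector_derivative_continuous[OF signed_integral_derivative[OF cQw[OF that]]]
      by (simp add: continuous_on_eq_continuous_within)
    have cPhi: "continuous_on ?J (\<Phi> w)" if "w \<in> X" for w
      unfolding \<Phi>_def using that by (intro continuous_intros cPw cI continuous_on_apply_bcontfun)
    have contr: "norm (\<Phi> w t - \<Phi> w' t) \<le> \<kappa> * c"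
      if w: "w \<in> X" "w' \<in> X" and t: "t \<in> ?J" and c: "\<And>t. t \<in> ?J \<Longrightarrow> norm (apply_bcontfun w t - apply_bcontfun w' t) \<le> c"
      for w w' t c
    proof -
      let ?u = "apply_bcontfun w t" and ?u' = "apply_bcontfun w' t"
      have c0: "0 \<le> c" using c[OF t] norm_ge_zero order_trans by blast
      have dq: "norm (qq w s - qq w' s) \<le> c * \<tau>" if "s \<in> ?J" for s
        unfolding qq_def using signed_integral_diff_bound[OF _ _ that c, of id] that c
        by (simp add: signed_integral_diff_bound)
      have dQ: "norm (Q (qq w s, apply_bcontfun w s) - Q (qq w' s, apply_bcontfun w' s)) \<le> K * (2 * c)" if "s \<in> ?J" for s
      proof -
        have "norm (Q (qq w s, apply_bcontfun w s) - Q (qq w' s, apply_bcontfun w' s))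
          \<le> K * norm ((qq w s, apply_bcontfun w s) - (qq w' s, apply_bcontfun w' s))"
          using inB w that by (intro R(5)) auto
        also have "\<dots> \<le> K * (2 * c)"
        proof (intro mult_left_mono)
          have "c * \<tau> \<le> c * 1" using c0 t1 by (intro mult_left_mono) auto
          then show "norm ((qq w s, apply_bcontfun w s) - (qq w' s, apply_bcontfun w' s)) \<le> 2 * c"
            using norm_Pair_le[of "qq w s - qq w' s" "apply_bcontfun w s - apply_bcontfun w' s"] dq[OF that] c[OF that] by simp
        qed (use R in auto)
        finally show ?thesis .
      qed
      have I: "norm (signed_integral \<tau> (\<lambda>s. Q (qq w s, apply_bcontfun w s)) t
          - signed_integral \<tau> (\<lambda>s. Q (qq w' s, apply_bcontfun w' s)) t) \<le> K * (2 * c) * \<tau>"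
        by (rule signed_integral_diff_bound[OF cQw[OF w(1)] cQw[OF w(2)] t dQ])
      define x where "x = ?u - ?u'"
      define y where "y = P (qq w t, ?u) - P (qq w t, ?u')"
      have iB: "(qq w t, ?u) \<in> ?B" "(qq w t, ?u') \<in> ?B" "(qq w' t, ?u') \<in> ?B"
        using inB[OF w(1) t] inB[OF w(2) t] by auto
      have y1: "norm y \<le> K * norm x"
        using R(4)[OF iB(1,2)] by (simp add: y_def x_def norm_Pair)
      have y2: "m * (norm x)\<^sup>2 \<le> y \<bullet> x" unfolding y_def x_def by (rule R(6)[OF iB(1,2)])
      have "(norm (x - \<epsilon> *\<^sub>R y))\<^sup>2 = (norm x)\<^sup>2 - 2 * \<epsilon> * (y \<bullet> x) + \<epsilon>\<^sup>2 * (norm y)\<^sup>2"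
        unfolding power2_norm_eq_inner
        by (simp add: inner_diff_left inner_diff_right inner_commute power2_eq_square[of \<epsilon>] algebra_simps)
      also have "\<dots> \<le> (norm x)\<^sup>2 - 2 * \<epsilon> * (m * (norm x)\<^sup>2) + \<epsilon>\<^sup>2 * (K * norm x)\<^sup>2"
        using e0 y1 y2 by (intro add_mono diff_left_mono mult_left_mono power_mono) auto
      also have "\<dots> = (1 - \<epsilon> * m) * (norm x)\<^sup>2"
        using R(3) by (simp add: \<epsilon>_def power2_eq_square field_simps)
      also have "\<dots> \<le> (1 - \<epsilon> * m / 2)\<^sup>2 * (norm x)\<^sup>2"
        using zero_le_square[of "\<epsilon> * m"] by (intro mult_right_mono) (auto simp: power2_eq_square algebra_simps)
      finally have "(norm (x - \<epsilon> *\<^sub>R y))\<^sup>2 \<le> ((1 - \<epsilon> * m / 2) * norm x)\<^sup>2" by (simp add: power_mult_distrib)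
      then have xy: "norm (x - \<epsilon> *\<^sub>R y) \<le> (1 - \<epsilon> * m / 2) * norm x"
      proof (rule power2_le_imp_le)
        show "0 \<le> (1 - \<epsilon> * m / 2) * norm x" using em by (intro mult_nonneg_nonneg) simp_all
      qed
      define z where "z = P (qq w t, ?u') - P (qq w' t, ?u')"
      have z: "norm z \<le> K * (c * \<tau>)"
      proof -
        have "norm z \<le> K * norm (qq w t - qq w' t)" using R(4)[OF iB(2,3)] by (simp add: z_def norm_Pair)
        also have "\<dots> \<le> K * (c * \<tau>)" using dq[OF t] R by (intro mult_left_mono) auto
        finally show ?thesis .
      qed
      define j where "j = signed_integral \<tau> (\<lambda>s. Q (qq w s, apply_bcontfun w s)) t
          - signed_integral \<tau> (\<lambda>s. Q (qq w' s, apply_bcontfun w' s)) t"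
      have "\<Phi> w t - \<Phi> w' t = (x - \<epsilon> *\<^sub>R y) - \<epsilon> *\<^sub>R (z - j)"
        by (simp add: \<Phi>_def x_def y_def z_def j_def algebra_simps)
      then have "norm (\<Phi> w t - \<Phi> w' t) \<le> norm (x - \<epsilon> *\<^sub>R y) + \<epsilon> * norm (z - j)"
        using norm_triangle_ineq4[of "x - \<epsilon> *\<^sub>R y" "\<epsilon> *\<^sub>R (z - j)"] e0 by simp
      also have "\<dots> \<le> (1 - \<epsilon> * m / 2) * c + \<epsilon> * (K * (c * \<tau>) + K * (2 * c) * \<tau>)"
      proof (intro add_mono mult_left_mono)
        show "norm (x - \<epsilon> *\<^sub>R y) \<le> (1 - \<epsilon> * m / 2) * c"
          using c[OF t] em by (intro order_trans[OF xy] mult_left_mono) (auto simp: x_def)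
        show "norm (z - j) \<le> K * (c * \<tau>) + K * (2 * c) * \<tau>"
          using order_trans[OF norm_triangle_ineq4 add_mono[OF z I[folded j_def]]] .
      qed (use e0 in auto)
      also have "\<dots> = (1 - \<epsilon> * m / 2 + 3 * (\<epsilon> * (K * \<tau>))) * c" by (simp add: algebra_simps)
      also have "\<dots> \<le> \<kappa> * c"
      proof (intro mult_right_mono c0)
        have "K * \<tau> \<le> m / 12" using t1(2) R(3) by (simp add: field_simps)
        then have "\<epsilon> * (K * \<tau>) \<le> \<epsilon> * (m / 12)" using e0 by (intro mult_left_mono) auto
        then show "1 - \<epsilon> * m / 2 + 3 * (\<epsilon> * (K * \<tau>)) \<le> \<kappa>" by (simp add: \<kappa>_def)
      qed
      finally show ?thesis .
    qed
    define w0 :: "real \<Rightarrow>\<^sub>C 'e" where "w0 = const_bcontfun u0"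
    have w0: "apply_bcontfun w0 t = u0" for t by (simp add: w0_def const_bcontfun.rep_eq)
    have w0X: "w0 \<in> X" using R0 by (simp add: X w0)
    have start: "norm (\<Phi> w0 t - u0) \<le> \<epsilon> * m / 4 * (R / 2)" if t: "t \<in> ?J" for t
    proof -
      have "norm (qq w0 t - qq w0 0) \<le> V * \<bar>t - 0\<bar>"
      proof (rule has_vector_derivative_bound[OF _ qd _ t J0])
        show "norm (apply_bcontfun w0 s) \<le> V" for s
          using u0 norm_triangle_sub[of u0 b] R0
          by (simp add: w0 V_def dist_norm norm_minus_commute)
      qed auto
      also have "\<dots> \<le> V * \<tau>" using t VM by (intro mult_left_mono) auto
      finally have q1: "norm (qq w0 t - q0) \<le> V * \<tau>" by simp
      have "norm (P (qq w0 t, u0) - P (q0, u0)) \<le> K * norm (qq w0 t - q0)"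
        using R(4)[OF inB[OF w0X t] inB[OF w0X J0]] by (simp add: w0 norm_Pair)
      also have "\<dots> \<le> K * (V * \<tau>)" using q1 R by (intro mult_left_mono) auto
      finally have p1: "norm (P (qq w0 t, u0) - P (q0, u0)) \<le> K * (V * \<tau>)" .
      have "norm (signed_integral \<tau> (\<lambda>s. Q (qq w0 s, apply_bcontfun w0 s)) t
        - signed_integral \<tau> (\<lambda>s. 0) t) \<le> M * \<tau>"
        using M inB[OF w0X] by (intro signed_integral_diff_bound cQw w0X t) auto
      then have i1: "norm (signed_integral \<tau> (\<lambda>s. Q (qq w0 s, u0)) t) \<le> M * \<tau>"
        by (simp add: w0) (simp add: signed_integral_def)
      have "norm (\<Phi> w0 t - u0) = \<epsilon> * norm (P (qq w0 t, u0) - P (q0, u0) - signed_integral \<tau> (\<lambda>s. Q (qq w0 s, u0)) t)"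
        using e0 by (simp add: \<Phi>_def w0)
      also have "\<dots> \<le> \<epsilon> * (K * (V * \<tau>) + M * \<tau>)"
        using e0 by (intro mult_left_mono order_trans[OF norm_triangle_ineq4] add_mono[OF p1 i1]) auto
      also have "\<dots> = \<epsilon> * ((K * V + M) * \<tau>)" by (simp add: algebra_simps)
      also have "\<dots> \<le> \<epsilon> * (m * R / 8)"
        using t1(4) KVM e0 by (intro mult_left_mono) (auto simp: field_simps)
      finally show ?thesis by (simp add: field_simps)
    qed
    have self: "\<Phi> w t \<in> cball u0 (R/2)" if w: "w \<in> X" and t: "t \<in> ?J" for w t
    proof -
      have "norm (\<Phi> w t - \<Phi> w0 t) \<le> \<kappa> * (R / 2)"
      proof (rule contr[OF w w0X t])
        fix s
        have "apply_bcontfun w s \<in> cball u0 (R/2)" using w X by blast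
        then show "norm (apply_bcontfun w s - apply_bcontfun w0 s) \<le> R / 2"
          by (simp add: w0 dist_norm norm_minus_commute)
      qed
      then have "norm (\<Phi> w t - u0) \<le> \<kappa> * (R / 2) + \<epsilon> * m / 4 * (R / 2)"
        using start[OF t] norm_triangle_ineq[of "\<Phi> w t - \<Phi> w0 t" "\<Phi> w0 t - u0"] by simp
      also have "\<dots> = R / 2" by (simp add: \<kappa>_def algebra_simps)
      finally show ?thesis by (simp add: dist_norm norm_minus_commute)
    qed
    define T where "T = (\<lambda>w. Bcontfun (\<lambda>t. \<Phi> w (cl t)))"
    have T: "apply_bcontfun (T w) t = \<Phi> w (cl t)" if w: "w \<in> X" for w t
    proof -
      have "(\<lambda>t. \<Phi> w (cl t)) \<in> bcontfun"
      proof (rule bcontfun_normI)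
        show "continuous_on UNIV (\<lambda>t. \<Phi> w (cl t))"
          using cl by (intro continuous_on_compose2[OF cPhi[OF w] ccl]) auto
        show "norm (\<Phi> w (cl t)) \<le> norm u0 + R / 2" for t
          using self[OF w cl(1)[of t]] norm_triangle_sub[of "\<Phi> w (cl t)" u0]
          by (simp add: dist_norm norm_minus_commute)
      qed
      then show ?thesis by (simp add: T_def Bcontfun_inverse)
    qed
    have "\<exists>!w\<in>X. T w = w"
    proof (rule Banach_fix[OF _ _ kap])
      show "complete X" unfolding X_def complete_eq_closed by (intro closed_PiC) auto
      show "X \<noteq> {}" using w0X by blast
      show "T ` X \<subseteq> X"
      proof (rule image_subsetI)
        fix w assume w: "w \<in> X"
        show "T w \<in> X" unfolding X T[OF w] using self[OF w cl(1)] by blast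
      qed
      show "dist (T w) (T w') \<le> \<kappa> * dist w w'" if "w \<in> X" "w' \<in> X" for w w'
      proof (rule dist_bound)
        fix t
        have "norm (apply_bcontfun w s - apply_bcontfun w' s) \<le> dist w w'" for s
          using dist_bounded[of w s w'] by (simp add: dist_norm)
        then show "dist (apply_bcontfun (T w) t) (apply_bcontfun (T w') t) \<le> \<kappa> * dist w w'"
          unfolding T[OF that(1)] T[OF that(2)] dist_norm by (intro contr[OF that cl(1)])
      qed
    qed
    then obtain w where w: "w \<in> X" "T w = w" by (elim ex1E conjE)
    let ?u = "apply_bcontfun w"
    have fp: "P (qq w t, ?u t) = P (q0, u0) + signed_integral \<tau> (\<lambda>s. Q (qq w s, ?u s)) t" if "t \<in> ?J" for t
    proof -
      have "?u t = \<Phi> w t" using T[OF w(1), of t] cl(2)[OF that] w(2) by simp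
      then have "\<epsilon> *\<^sub>R (P (qq w t, ?u t) - P (q0, u0) - signed_integral \<tau> (\<lambda>s. Q (qq w s, ?u s)) t) = 0"
        unfolding \<Phi>_def by simp
      then have "P (qq w t, ?u t) - P (q0, u0) - signed_integral \<tau> (\<lambda>s. Q (qq w s, ?u s)) t = 0"
        using e0 by (simp only: scaleR_eq_0_iff) auto
      then show ?thesis by (simp add: algebra_simps)
    qed
    have "m * norm (?u 0 - u0) \<le> norm (P (q0, ?u 0) - P (q0, u0))"
      using inB[OF w(1) J0] inB[OF w0X J0] by (intro el_region_monotone[OF reg]) (auto simp: w0)
    then have u_0: "?u 0 = u0" using fp[OF J0] R(1) by (simp add: mult_le_0_iff)
    have "((\<lambda>t. P (qq w t, ?u t)) has_vector_derivative Q (qq w t, ?u t)) (at t within ?J)" if "t \<in> ?J" for t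
    proof (rule has_vector_derivative_transform[OF that fp])
      show "((\<lambda>t. P (q0, u0) + signed_integral \<tau> (\<lambda>s. Q (qq w s, ?u s)) t) has_vector_derivative Q (qq w t, ?u t)) (at t within ?J)"
        using signed_integral_derivative[OF cQw[OF w(1)] that] by (auto intro!: derivative_eq_intros)
    qed
    then have "el_sol P Q ?B ?J (qq w) ?u"
      using inB[OF w(1)] qd by (simp add: el_sol_def)
    then show ?thesis using u_0 q_0[of w] by (intro exI[of _ "qq w"] exI[of _ ?u] conjI)
  qed
  then show ?thesis using t0 t1(1,2) by (intro exI[of _ \<tau>] conjI ballI)
qed

section \<open>Convex Lagrangians\<close>

definition hder :: "('e::euclidean_space \<times> 'e \<Rightarrow> real) \<Rightarrow> 'e \<times> 'e \<Rightarrow> 'e \<Rightarrow> real" where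
  "hder f z e = frechet_derivative f (at z) (e, 0)"

definition vder :: "('e::euclidean_space \<times> 'e \<Rightarrow> real) \<Rightarrow> 'e \<times> 'e \<Rightarrow> 'e \<Rightarrow> real" where
  "vder f z e = frechet_derivative f (at z) (0, e)"

definition hgrad :: "('e::euclidean_space \<times> 'e \<Rightarrow> real) \<Rightarrow> 'e \<times> 'e \<Rightarrow> 'e" where
  "hgrad f z = (\<Sum>i\<in>Basis. hder f z i *\<^sub>R i)"

definition vgrad :: "('e::euclidean_space \<times> 'e \<Rightarrow> real) \<Rightarrow> 'e \<times> 'e \<Rightarrow> 'e" where
  "vgrad f z = (\<Sum>i\<in>Basis. vder f z i *\<^sub>R i)"

lemma linear_hder: "f differentiable (at z) \<Longrightarrow> linear (hder f z)"
  and linear_vder: "f differentiable (at z) \<Longrightarrow> linear (vder f z)"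
proof -
  assume "f differentiable (at z)"
  then have l: "linear (frechet_derivative f (at z))"
    using frechet_derivative_works has_derivative_linear by blast
  show "linear (hder f z)" "linear (vder f z)"
    unfolding hder_def vder_def
    using linear_add[OF l, of "(_, 0)" "(_, 0)"] linear_cmul[OF l, of _ "(_, 0)"]
      linear_add[OF l, of "(0, _)" "(0, _)"] linear_cmul[OF l, of _ "(0, _)"]
    by (auto intro!: linearI)
qed

lemma linear_eq_inner_sum:
  assumes "linear (g :: 'e::euclidean_space \<Rightarrow> real)"
  shows "g e = (\<Sum>i\<in>Basis. g i *\<^sub>R i) \<bullet> e"
proof -
  have "g e = g (\<Sum>i\<in>Basis. (e \<bullet> i) *\<^sub>R i)" by (simp add: euclidean_representation)
  also have "\<dots> = (\<Sum>i\<in>Basis. (e \<bullet> i) * g i)"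
    by (simp add: linear_sum[OF assms] linear_cmul[OF assms])
  finally show ?thesis unfolding inner_sum_left inner_scaleR_left by (simp add: inner_commute mult.commute)
qed

lemma hgrad_inner: "f differentiable (at z) \<Longrightarrow> hgrad f z \<bullet> e = hder f z e"
  and vgrad_inner: "f differentiable (at z) \<Longrightarrow> vgrad f z \<bullet> e = vder f z e"
  unfolding hgrad_def vgrad_def using linear_eq_inner_sum[OF linear_hder] linear_eq_inner_sum[OF linear_vder]
  by metis+

lemma hder_vder_derivative:
  assumes "f differentiable (at z)"
  shows "(f has_derivative (\<lambda>\<zeta>. hder f z (fst \<zeta>) + vder f z (snd \<zeta>))) (at z)"
proof -
  have d: "(f has_derivative frechet_derivative f (at z)) (at z)"
    using assms frechet_derivative_works by blast
  then have "linear (frechet_derivative f (at z))" by (rule has_derivative_linear)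
  from linear_add[OF this] have "frechet_derivative f (at z) \<zeta> = hder f z (fst \<zeta>) + vder f z (snd \<zeta>)" for \<zeta>
    unfolding hder_def vder_def by (metis add.left_neutral add.right_neutral add_Pair prod.collapse)
  then show ?thesis using d by (metis (no_types, lifting) ext)
qed

lemma hder_eqI: "(f has_derivative D) (at z) \<Longrightarrow> hder f z e = D (e, 0)"
  and vder_eqI: "(f has_derivative D) (at z) \<Longrightarrow> vder f z e = D (0, e)"
  by (simp_all add: hder_def vder_def frechet_derivative_at[symmetric])

lemma Ck_on_2_differentiable: "Ck_on 2 f S \<Longrightarrow> z \<in> S \<Longrightarrow> f differentiable (at z)"
  by (simp add: numeral_2_eq_2)

lemma Ck_on_hder: "Ck_on 2 f S \<Longrightarrow> Ck_on 1 (\<lambda>z. hder f z e) S"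
  and Ck_on_vder: "Ck_on 2 f S \<Longrightarrow> Ck_on 1 (\<lambda>z. vder f z e) S"
  unfolding hder_def vder_def numeral_2_eq_2 One_nat_def by (auto dest: Ck_on_SucD(2) simp del: Ck_on.simps)

lemma Ck_on_hgrad: "Ck_on 2 f S \<Longrightarrow> open S \<Longrightarrow> Ck_on 1 (hgrad f) S"
  and Ck_on_vgrad: "Ck_on 2 f S \<Longrightarrow> open S \<Longrightarrow> Ck_on 1 (vgrad f) S"
  unfolding hgrad_def vgrad_def
  by (intro Ck_on_sum Ck_on_bounded_linear[OF bounded_linear_scaleR_left] Ck_on_hder Ck_on_vder finite_Basis; assumption)+

lemma lipschitz_on_compact_convex:
  fixes g :: "'a::euclidean_space \<Rightarrow> 'b::real_normed_vector"
  assumes C1: "Ck_on 1 g \<Omega>" and B: "B \<subseteq> \<Omega>" "compact B" "convex B"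
  shows "\<exists>K>0. \<forall>z\<in>B. \<forall>z'\<in>B. norm (g z - g z') \<le> K * norm (z - z')"
proof -
  have C: "Ck_on (Suc 0) g \<Omega>" using C1 by simp
  have c: "continuous_on B (\<lambda>z. \<Sum>b\<in>Basis. norm (frechet_derivative g (at z) b))"
    by (intro continuous_intros continuous_on_subset[OF continuous_on_frechet_derivative[OF C] B(1)])
  have "bounded ((\<lambda>z. \<Sum>b\<in>Basis. norm (frechet_derivative g (at z) b)) ` B)"
    by (intro compact_imp_bounded compact_continuous_image c B)
  then obtain K where K: "K > 0" "\<And>z. z \<in> B \<Longrightarrow> norm (\<Sum>b\<in>Basis. norm (frechet_derivative g (at z) b)) \<le> K"
    by (auto simp: bounded_pos)
  have "norm (g z - g z') \<le> K * norm (z - z')" if "z \<in> B" "z' \<in> B" for z z'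
  proof (rule differentiable_bound[OF B(3) _ _ that])
    fix x assume x: "x \<in> B"
    have d: "(g has_derivative frechet_derivative g (at x)) (at x)"
      using Ck_on_SucD(1)[OF C] x B by blast
    then show "(g has_derivative frechet_derivative g (at x)) (at x within B)"
      by (rule has_derivative_at_withinI)
    have "onorm (frechet_derivative g (at x)) \<le> (\<Sum>b\<in>Basis. norm (frechet_derivative g (at x) b))"
      using d has_derivative_bounded_linear by (intro onorm_componentwise) blast
    then show "onorm (frechet_derivative g (at x)) \<le> K" using K(2)[OF x] by simp
  qed
  then show ?thesis using K by blast
qed

lemma continuous_on_linear_family:
  fixes D :: "'z::topological_space \<Rightarrow> 'a::euclidean_space \<Rightarrow> 'b::real_normed_vector"
  assumes "\<And>\<zeta>. continuous_on B (\<lambda>z. D z \<zeta>)" "\<And>z. z \<in> B \<Longrightarrow> linear (D z)"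
    "continuous_on T g" "g ` T \<subseteq> B" "continuous_on T h"
  shows "continuous_on T (\<lambda>t. D (g t) (h t))"
proof -
  have "D (g t) (h t) = (\<Sum>b\<in>Basis. (h t \<bullet> b) *\<^sub>R D (g t) b)" if "t \<in> T" for t
  proof -
    have l: "linear (D (g t))" using assms(2,4) that by blast
    have "D (g t) (h t) = D (g t) (\<Sum>b\<in>Basis. (h t \<bullet> b) *\<^sub>R b)" by (simp add: euclidean_representation)
    then show ?thesis by (simp add: linear_sum[OF l] linear_cmul[OF l])
  qed
  moreover have "continuous_on T (\<lambda>t. \<Sum>b\<in>Basis. (h t \<bullet> b) *\<^sub>R D (g t) b)"
    by (intro continuous_intros assms(5) continuous_on_compose2[OF assms(1) assms(3,4)])
  ultimately show ?thesis by (simp cong: continuous_on_cong)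
qed

text \<open>Compactness makes the bounds uniform; in particular the positive continuous function
  \<open>P' z (0, e) \<bullet> e\<close> has a positive minimum over a box times the unit sphere, and integration along segments
  in the fibre turns this into monotonicity.\<close>

lemma el_region_exists:
  fixes L :: "'e::euclidean_space \<times> 'e \<Rightarrow> real"
  assumes \<Omega>: "open \<Omega>" "(a, b) \<in> \<Omega>" and L: "Ck_on 2 L \<Omega>"
    and pos: "\<And>z e. z \<in> \<Omega> \<Longrightarrow> e \<noteq> 0 \<Longrightarrow> frechet_derivative (\<lambda>z. vder L z e) (at z) (0, e) > 0"
  shows "\<exists>R>0. \<exists>K m. cball a R \<times> cball b R \<subseteq> \<Omega> \<and>
    el_region (vgrad L) (\<lambda>z. frechet_derivative (vgrad L) (at z)) (hgrad L) (cball a R \<times> cball b R) K m"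
proof -
  obtain r where r: "r > 0" "ball (a, b) r \<subseteq> \<Omega>" using \<Omega> by (meson openE)
  define R where "R = r / 3"
  have R: "R > 0" using r by (simp add: R_def)
  define B where "B = cball a R \<times> cball b R"
  have B: "B \<subseteq> \<Omega>"
  proof
    fix z assume z: "z \<in> B"
    have "dist (a, b) z \<le> dist a (fst z) + dist b (snd z)"
      by (simp add: dist_norm norm_Pair_le[of "a - fst z" "b - snd z"] minus_prod_def)
    also have "\<dots> < r" using z r(1) by (auto simp: B_def R_def)
    finally show "z \<in> \<Omega>" using r(2) by auto
  qed
  have cB: "compact B" "convex B" unfolding B_def by (auto intro: compact_Times convex_Times)
  define P' where "P' = (\<lambda>z. frechet_derivative (vgrad L) (at z))"
  have C1: "Ck_on (Suc 0) (vgrad L) \<Omega>" using Ck_on_vgrad[OF L \<Omega>(1)] by simp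
  have dP: "(vgrad L has_derivative P' z) (at z)" if "z \<in> \<Omega>" for z
    using Ck_on_SucD(1)[OF C1 that] by (simp add: P'_def)
  have lP: "linear (P' z)" if "z \<in> \<Omega>" for z using dP[OF that] has_derivative_linear by blast
  have cP: "continuous_on B (\<lambda>z. P' z \<zeta>)" for \<zeta>
    unfolding P'_def by (rule continuous_on_subset[OF continuous_on_frechet_derivative[OF C1] B])
  have P'pos: "P' z (0, e) \<bullet> e > 0" if "z \<in> \<Omega>" "e \<noteq> 0" for z e
  proof -
    have "((\<lambda>z. vgrad L z \<bullet> e) has_derivative (\<lambda>\<zeta>. P' z \<zeta> \<bullet> e)) (at z)"
      using dP[OF that(1)] by (auto intro!: derivative_eq_intros)
    then have "((\<lambda>z. vder L z e) has_derivative (\<lambda>\<zeta>. P' z \<zeta> \<bullet> e)) (at z)"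
      by (rule has_derivative_transform_within_open[OF _ \<Omega>(1) that(1)])
        (simp add: vgrad_inner Ck_on_2_differentiable[OF L])
    from frechet_derivative_at[OF this] pos[OF that] show ?thesis by metis
  qed
  obtain K1 where K1: "K1 > 0" "\<forall>z\<in>B. \<forall>z'\<in>B. norm (vgrad L z - vgrad L z') \<le> K1 * norm (z - z')"
    using lipschitz_on_compact_convex[OF Ck_on_vgrad[OF L \<Omega>(1)] B cB] by blast
  obtain K2 where K2: "K2 > 0" "\<forall>z\<in>B. \<forall>z'\<in>B. norm (hgrad L z - hgrad L z') \<le> K2 * norm (z - z')"
    using lipschitz_on_compact_convex[OF Ck_on_hgrad[OF L \<Omega>(1)] B cB] by blast
  have cH: "continuous_on (B \<times> sphere 0 1) (\<lambda>y. P' (fst y) (0, snd y) \<bullet> snd y)"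
  proof (rule continuous_on_inner[OF continuous_on_linear_family[where D = P' and B = B and g = fst and h = "\<lambda>y. (0, snd y)"]])
    show "linear (P' z)" if "z \<in> B" for z using lP B that by blast
  qed (auto intro!: continuous_intros cP)
  have "sphere (0::'e) 1 \<noteq> {}" using vector_choose_size[of 1] by (auto simp: dist_norm)
  moreover have "(a, b) \<in> B" using R by (simp add: B_def)
  ultimately have "B \<times> sphere (0::'e) 1 \<noteq> {}" by blast
  from continuous_attains_inf[OF compact_Times[OF cB(1) compact_sphere] this cH]
  obtain y where y: "y \<in> B \<times> sphere 0 1"
    "\<And>x. x \<in> B \<times> sphere 0 1 \<Longrightarrow> P' (fst y) (0, snd y) \<bullet> snd y \<le> P' (fst x) (0, snd x) \<bullet> snd x" by blast
  define m0 where "m0 = P' (fst y) (0, snd y) \<bullet> snd y"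
  have "norm (snd y) = 1" using y(1) by (simp add: mem_Times_iff)
  then have "snd y \<noteq> 0" by auto
  then have m0: "m0 > 0" unfolding m0_def using y(1) B by (intro P'pos) (auto simp: mem_Times_iff)
  define K where "K = max K1 K2"
  define m where "m = min m0 K"
  have K: "K > 0" "K1 \<le> K" "K2 \<le> K" and m: "m > 0" "m \<le> K" "m \<le> m0" using K1 m0 by (auto simp: K_def m_def)
  have coer: "m * (norm e)\<^sup>2 \<le> P' z (0, e) \<bullet> e" if z: "z \<in> B" for z e
  proof (cases "e = 0")
    case True
    then show ?thesis by simp
  next
    case False
    define d where "d = e /\<^sub>R norm e"
    have md: "m0 \<le> P' z (0, d) \<bullet> d"
      using y(2)[of "(z, d)"] z False by (simp add: m0_def d_def)
    have e1: "P' z (0, e) = norm e *\<^sub>R P' z (0, d)"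
      using linear_cmul[OF lP, of z "norm e" "(0, d)"] z B False by (auto simp: d_def)
    have e2: "e = norm e *\<^sub>R d" using False by (simp add: d_def)
    have "P' z (0, e) \<bullet> e = (norm e *\<^sub>R P' z (0, d)) \<bullet> (norm e *\<^sub>R d)"
      using arg_cong2[where f = inner, OF e1 e2] .
    also have "\<dots> = (P' z (0, d) \<bullet> d) * (norm e)\<^sup>2" by (simp add: power2_eq_square)
    finally have "m0 * (norm e)\<^sup>2 \<le> P' z (0, e) \<bullet> e"
      using mult_right_mono[OF md, of "(norm e)\<^sup>2"] by simp
    then show ?thesis using m(3) mult_right_mono[of m m0 "(norm e)\<^sup>2"] by simp
  qed
  have mono: "m * (norm (u - u'))\<^sup>2 \<le> (vgrad L (q, u) - vgrad L (q, u')) \<bullet> (u - u')"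
    if qu: "(q, u) \<in> B" "(q, u') \<in> B" for q u u'
  proof -
    define g where "g = (\<lambda>t. vgrad L (q, u' + t *\<^sub>R (u - u')) \<bullet> (u - u'))"
    have inB: "(q, u' + t *\<^sub>R (u - u')) \<in> B" if "t \<in> {0..1}" for t
      using convexD_alt[OF cB(2) qu(2,1), of t] that by (simp add: algebra_simps)
    have dg: "(g has_real_derivative P' (q, u' + t *\<^sub>R (u - u')) (0, u - u') \<bullet> (u - u')) (at t)" if "t \<in> {0..1}" for t
    proof -
      have "(vgrad L has_derivative P' (q, u' + t *\<^sub>R (u - u'))) (at ((q, u') + t *\<^sub>R (0, u - u')))"
        using dP[of "(q, u' + t *\<^sub>R (u - u'))"] inB[OF that] B by (auto simp del: scaleR_right_diff_distrib)
      from bounded_linear.has_vector_derivative[OF bounded_linear_inner_left has_vector_derivative_line[OF this], of "u - u'"]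
      show ?thesis by (simp add: g_def has_real_derivative_iff_has_vector_derivative)
    qed
    obtain t where t: "0 < t" "t < 1" "g 1 - g 0 = (1 - 0) * (P' (q, u' + t *\<^sub>R (u - u')) (0, u - u') \<bullet> (u - u'))"
      using MVT2[of 0 1 g "\<lambda>t. P' (q, u' + t *\<^sub>R (u - u')) (0, u - u') \<bullet> (u - u')"] dg by auto
    have "m * (norm (u - u'))\<^sup>2 \<le> g 1 - g 0"
      using t coer[OF inB[of t]] by simp
    then show ?thesis by (simp add: g_def inner_diff_left)
  qed
  have "norm (vgrad L z - vgrad L z') \<le> K * norm (z - z')" "norm (hgrad L z - hgrad L z') \<le> K * norm (z - z')"
    if "z \<in> B" "z' \<in> B" for z z'
    using K1(2) K2(2) that mult_right_mono[OF K(2) norm_ge_zero[of "z - z'"]]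
      mult_right_mono[OF K(3) norm_ge_zero[of "z - z'"]] by (meson order_trans)+
  then have "el_region (vgrad L) P' (hgrad L) B K m"
    unfolding el_region_def using m coer mono cP dP B by blast
  then show ?thesis using R B unfolding B_def P'_def by blast
qed

section \<open>Extremals of homogeneous Lagrangians\<close>

lemma has_derivative_norm_bound:
  assumes "(f has_derivative f') (at x within S)" "e > 0"
  shows "\<exists>d>0. \<forall>y\<in>S. norm (y - x) < d \<longrightarrow> norm (f y - f x - f' (y - x)) \<le> e * norm (y - x)"
  using assms unfolding has_derivative_within_alt by blast

text \<open>The momentum is differentiable along the solution, and the derivative of \<open>P\<close> in the velocity is
  coercive, so the velocity is differentiable as well. Its derivative \<open>w\<close> is the solution of the
  linear equation obtained by differentiating the momentum.\<close>

lemma el_sol_velocity_derivative: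
  fixes P :: "'e::euclidean_space \<times> 'e \<Rightarrow> 'e"
  assumes reg: "el_region P P' Q (X \<times> Y) K m"
    and sol: "el_sol P Q (X \<times> Y) {-\<tau>..\<tau>} q u"
    and t: "t \<in> {-\<tau><..<\<tau>}" and w: "P' (q t, u t) (u t, w) = Q (q t, u t)"
  shows "(u has_vector_derivative w) (at t)"
proof -
  note R = el_regionD[OF reg]
  let ?J = "{-\<tau>..\<tau>}" and ?B = "X \<times> Y"
  have tJ: "t \<in> ?J" using t by auto
  have inB: "(q s, u s) \<in> ?B" if "s \<in> ?J" for s using sol that by (auto simp: el_sol_def)
  have cu: "continuous_on ?J u" using sol by (auto simp: el_sol_def)
  have dq: "(q has_vector_derivative u s) (at s within ?J)" if "s \<in> ?J" for s
    using sol that by (auto simp: el_sol_def)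
  have dP: "((\<lambda>t. P (q t, u t)) has_vector_derivative Q (q s, u s)) (at s within ?J)" if "s \<in> ?J" for s
    using sol that by (auto simp: el_sol_def)
  have cq: "continuous_on ?J q"
    unfolding continuous_on_eq_continuous_within by (intro ballI has_vector_derivative_continuous[OF dq])
  have cQ: "continuous_on ?B Q" using R(3,5) by (intro continuous_on_lipschitz_bound[of _ _ K]) auto
  have cQz: "continuous_on ?J (\<lambda>t. Q (q t, u t))"
    using inB by (intro continuous_on_compose2[OF cQ continuous_on_Pair[OF cq cu]]) auto
  obtain V where V: "\<And>s. s \<in> ?J \<Longrightarrow> norm (u s) \<le> V"
    using compact_imp_bounded[OF compact_continuous_image[OF cu compact_Icc]] unfolding bounded_iff by blast
  obtain M where M: "\<And>s. s \<in> ?J \<Longrightarrow> norm (Q (q s, u s)) \<le> M"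
    using compact_imp_bounded[OF compact_continuous_image[OF cQz compact_Icc]] unfolding bounded_iff by blast
  have VM: "0 \<le> V" "0 \<le> M" using V[OF tJ] M[OF tJ] norm_ge_zero order_trans by blast+
  have lq: "norm (q s - q t) \<le> V * \<bar>s - t\<bar>" if "s \<in> ?J" for s
    by (rule has_vector_derivative_bound[OF _ dq V that tJ]) auto
  define C where "C = (M + K * V) / m"
  have lu: "norm (u s - u t) \<le> C * \<bar>s - t\<bar>" if s: "s \<in> ?J" for s
  proof -
    have iB: "(q s, u t) \<in> ?B" using inB[OF s] inB[OF tJ] by auto
    have "m * norm (u s - u t) \<le> norm (P (q s, u s) - P (q s, u t))"
      by (rule el_region_monotone[OF reg inB[OF s] iB])
    also have "\<dots> = norm ((P (q s, u s) - P (q t, u t)) - (P (q s, u t) - P (q t, u t)))" by simp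
    also have "\<dots> \<le> norm (P (q s, u s) - P (q t, u t)) + norm (P (q s, u t) - P (q t, u t))"
      by (rule norm_triangle_ineq4)
    also have "\<dots> \<le> M * \<bar>s - t\<bar> + K * (V * \<bar>s - t\<bar>)"
    proof (rule add_mono)
      show "norm (P (q s, u s) - P (q t, u t)) \<le> M * \<bar>s - t\<bar>"
        by (rule has_vector_derivative_bound[OF _ dP M s tJ]) auto
      have "norm (P (q s, u t) - P (q t, u t)) \<le> K * norm (q s - q t)"
        using R(4)[OF iB inB[OF tJ]] by (simp add: norm_Pair)
      also have "\<dots> \<le> K * (V * \<bar>s - t\<bar>)" using lq[OF s] R(3) by (intro mult_left_mono) auto
      finally show "norm (P (q s, u t) - P (q t, u t)) \<le> K * (V * \<bar>s - t\<bar>)" .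
    qed
    finally show ?thesis using R(1) by (simp add: C_def field_simps)
  qed
  have C0: "0 \<le> C" using VM R(1,3) by (simp add: C_def)
  let ?z = "(q t, u t)"
  note dPz = R(7)[OF inB[OF tJ]]
  have tri: "norm (- a + b - c) \<le> norm a + norm b + norm c" for a b c :: 'e
    using norm_triangle_ineq4[of "- a + b" c] norm_triangle_ineq[of "- a" b] by simp
  have lP: "linear (P' ?z)" using dPz has_derivative_linear by blast
  obtain N where N: "N > 0" "\<And>\<zeta>. norm (P' ?z \<zeta>) \<le> norm \<zeta> * N"
    using bounded_linear.pos_bounded[OF has_derivative_bounded_linear[OF dPz]] by blast
  have "(u has_derivative (\<lambda>h. h *\<^sub>R w)) (at t within ?J)"
    unfolding has_derivative_within_alt
  proof (intro conjI allI impI bounded_linear_scaleR_left)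
    fix e :: real assume e: "e > 0"
    define D where "D = V + C + 1 + N"
    have D: "D > 0" using VM C0 N by (simp add: D_def)
    define e' where "e' = e * m / D"
    have e': "e' > 0" using e D R(1) by (simp add: e'_def)
    obtain d1 where d1: "d1 > 0" "\<And>z. norm (z - ?z) < d1 \<Longrightarrow> norm (P z - P ?z - P' ?z (z - ?z)) \<le> e' * norm (z - ?z)"
      using has_derivative_norm_bound[OF dPz e'] by auto
    obtain d2 where d2: "d2 > 0" "\<And>s. s \<in> ?J \<Longrightarrow> norm (s - t) < d2 \<Longrightarrow>
        norm (P (q s, u s) - P ?z - (s - t) *\<^sub>R Q ?z) \<le> e' * norm (s - t)"
      using has_derivative_norm_bound[OF dP[OF tJ, unfolded has_vector_derivative_def] e'] by blast
    obtain d3 where d3: "d3 > 0" "\<And>s. s \<in> ?J \<Longrightarrow> norm (s - t) < d3 \<Longrightarrow>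
        norm (q s - q t - (s - t) *\<^sub>R u t) \<le> e' * norm (s - t)"
      using has_derivative_norm_bound[OF dq[OF tJ, unfolded has_vector_derivative_def] e'] by blast
    define d where "d = min (d1 / (V + C + 1)) (min d2 d3)"
    have d: "d > 0" using d1 d2 d3 VM C0 by (simp add: d_def)
    have "norm (u s - u t - (s - t) *\<^sub>R w) \<le> e * norm (s - t)" if s: "s \<in> ?J" "norm (s - t) < d" for s
    proof -
      let ?h = "s - t" and ?D = "(q s - q t, u s - u t)"
      have zz: "norm ?D \<le> (V + C) * \<bar>?h\<bar>"
        using norm_Pair_le[of "q s - q t" "u s - u t"] lq[OF s(1)] lu[OF s(1)] by (simp add: algebra_simps)
      also have "\<dots> \<le> (V + C + 1) * \<bar>?h\<bar>" by (intro mult_right_mono) auto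
      also have "\<dots> < d1"
        using s(2) VM C0 by (simp add: d_def field_simps)
      finally have "norm ?D < d1" .
      then have b1: "norm (P (q s, u s) - P ?z - P' ?z ?D) \<le> e' * norm ?D"
        using d1(2)[of "(q s, u s)"] by simp
      also have "\<dots> \<le> e' * ((V + C) * \<bar>?h\<bar>)" using zz e' by (intro mult_left_mono) auto
      finally have b1: "norm (P (q s, u s) - P ?z - P' ?z ?D) \<le> e' * ((V + C) * \<bar>?h\<bar>)" .
      have b2: "norm (P (q s, u s) - P ?z - ?h *\<^sub>R Q ?z) \<le> e' * \<bar>?h\<bar>" using d2(2)[OF s(1)] s(2) by (simp add: d_def)
      have "norm (q s - q t - ?h *\<^sub>R u t) \<le> e' * \<bar>?h\<bar>" using d3(2)[OF s(1)] s(2) by (simp add: d_def)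
      then have b3: "norm (P' ?z (q s - q t - ?h *\<^sub>R u t, 0)) \<le> e' * \<bar>?h\<bar> * N"
        using N by (intro order_trans[OF N(2)] mult_right_mono) (auto simp: norm_Pair)
      define x where "x = u s - u t - ?h *\<^sub>R w"
      have dec: "(0, x) = ?D - (q s - q t - ?h *\<^sub>R u t, 0) - ?h *\<^sub>R (u t, w)" by (simp add: x_def)
      have "P' ?z (0, x) = P' ?z ?D - P' ?z (q s - q t - ?h *\<^sub>R u t, 0) - ?h *\<^sub>R Q ?z"
        unfolding dec linear_diff[OF lP] linear_cmul[OF lP] w ..
      then have "P' ?z (0, x) = - (P (q s, u s) - P ?z - P' ?z ?D) + (P (q s, u s) - P ?z - ?h *\<^sub>R Q ?z)
          - P' ?z (q s - q t - ?h *\<^sub>R u t, 0)" by simp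
      also have "norm \<dots> \<le> e' * ((V + C) * \<bar>?h\<bar>) + e' * \<bar>?h\<bar> + e' * \<bar>?h\<bar> * N"
        using order_trans[OF tri add_mono[OF add_mono[OF b1 b2] b3]] .
      also have "\<dots> = e' * D * \<bar>?h\<bar>" by (simp add: D_def algebra_simps)
      also have "\<dots> = e * m * \<bar>?h\<bar>" using D by (simp add: e'_def)
      finally have n1: "norm (P' ?z (0, x)) \<le> e * m * \<bar>?h\<bar>" .
      have "m * norm x * norm x \<le> P' ?z (0, x) \<bullet> x"
        using R(9)[OF inB[OF tJ], of x] by (simp add: power2_eq_square)
      also have "\<dots> \<le> norm (P' ?z (0, x)) * norm x" by (rule norm_cauchy_schwarz)
      also have "\<dots> \<le> e * m * \<bar>?h\<bar> * norm x" using n1 by (intro mult_right_mono) auto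
      finally have "m * norm x * norm x \<le> m * (e * \<bar>?h\<bar>) * norm x" by (simp add: ac_simps)
      then have "norm x \<le> e * \<bar>?h\<bar>"
        using R(1) e by (cases "x = 0") auto
      then show ?thesis by (simp add: x_def)
    qed
    then show "\<exists>d>0. \<forall>s\<in>?J. norm (s - t) < d \<longrightarrow> norm (u s - u t - (s - t) *\<^sub>R w) \<le> e * norm (s - t)"
      using d by blast
  qed
  then have "(u has_vector_derivative w) (at t within ?J)" by (simp add: has_vector_derivative_def)
  moreover have "at t within ?J = at t" using t by (intro at_within_interior) auto
  ultimately show ?thesis by simp
qed

lemma el_region_acceleration:
  fixes P :: "'e::euclidean_space \<times> 'e \<Rightarrow> 'e"
  assumes reg: "el_region P P' Q B K m" and z: "z \<in> B"
  shows "\<exists>w. P' z (v, w) = c"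
proof -
  note R = el_regionD[OF reg]
  have lP: "linear (P' z)" using R(7)[OF z] has_derivative_linear by blast
  have l0: "linear (\<lambda>w. P' z (0, w))"
    using linear_add[OF lP, of "(0, _)" "(0, _)"] linear_cmul[OF lP, of _ "(0, _)"] by (auto intro!: linearI)
  have "e = 0" if "P' z (0, e) = 0" for e
    using R(9)[OF z, of e] R(1) that by (simp add: mult_le_0_iff)
  then have "inj (\<lambda>w. P' z (0, w))" using linear_injective_0[OF l0] by blast
  then have "surj (\<lambda>w. P' z (0, w))" by (rule linear_inj_imp_surj[OF l0])
  then obtain w where "c - P' z (v, 0) = P' z (0, w)" unfolding surj_def by blast
  moreover have "P' z (v, w) = P' z (v, 0) + P' z (0, w)" using linear_add[OF lP, of "(v, 0)" "(0, w)"] by simp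
  ultimately show ?thesis by (intro exI[of _ w]) (simp add: algebra_simps)
qed

text \<open>Continuity of the acceleration: by coercivity, \<open>w s - w t\<close> is controlled by the defect \<open>G s\<close> of the
  vector \<open>w t\<close> in the linear equation at time \<open>s\<close>, which is continuous in \<open>s\<close> and vanishes at \<open>t\<close>.\<close>

lemma el_sol_C2:
  fixes P :: "'e::euclidean_space \<times> 'e \<Rightarrow> 'e"
  assumes reg: "el_region P P' Q (X \<times> Y) K m"
    and sol: "el_sol P Q (X \<times> Y) {-\<tau>..\<tau>} q u"
  shows "\<exists>w. continuous_on {-\<tau><..<\<tau>} w \<and> (\<forall>t\<in>{-\<tau><..<\<tau>}. (u has_vector_derivative w t) (at t))"
proof -
  note R = el_regionD[OF reg]
  let ?J = "{-\<tau>..\<tau>}" and ?B = "X \<times> Y" and ?I = "{-\<tau><..<\<tau>}"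
  have IJ: "t \<in> ?J" if "t \<in> ?I" for t using that by auto
  have inB: "(q s, u s) \<in> ?B" if "s \<in> ?J" for s using sol that by (auto simp: el_sol_def)
  have "\<forall>t\<in>?I. \<exists>w. P' (q t, u t) (u t, w) = Q (q t, u t)"
    using el_region_acceleration[OF reg inB[OF IJ]] by blast
  then obtain w where w: "\<And>t. t \<in> ?I \<Longrightarrow> P' (q t, u t) (u t, w t) = Q (q t, u t)" by metis
  have dw: "(u has_vector_derivative w t) (at t)" if "t \<in> ?I" for t
    by (rule el_sol_velocity_derivative[OF reg sol that w[OF that]])
  have dq: "(q has_vector_derivative u s) (at s within ?J)" if "s \<in> ?J" for s
    using sol that by (auto simp: el_sol_def)
  have "continuous_on ?J q"
    unfolding continuous_on_eq_continuous_within by (intro ballI has_vector_derivative_continuous[OF dq])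
  then have cz: "continuous_on ?I (\<lambda>t. (q t, u t))"
    using sol by (intro continuous_on_Pair) (auto simp: el_sol_def intro: continuous_on_subset)
  have cu: "continuous_on ?I u" using sol by (auto simp: el_sol_def intro: continuous_on_subset)
  have cQ: "continuous_on ?B Q" using R(3,5) by (intro continuous_on_lipschitz_bound[of _ _ K]) auto
  have zB: "(\<lambda>t. (q t, u t)) ` ?I \<subseteq> ?B" using inB IJ by blast
  have lP: "linear (P' z)" if "z \<in> ?B" for z using R(7)[OF that] has_derivative_linear by blast
  have "continuous (at t within ?I) w" if t: "t \<in> ?I" for t
  proof -
    define G where "G = (\<lambda>s. Q (q s, u s) - P' (q s, u s) (u s, w t))"
    have cG: "continuous_on ?I G"
      unfolding G_def
      by (intro continuous_on_diff continuous_on_compose2[OF cQ cz zB]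
        continuous_on_linear_family[OF R(8) lP cz zB] continuous_on_Pair cu continuous_on_const)
    have bound: "m * norm (w s - w t) \<le> norm (G s)" if s: "s \<in> ?I" for s
    proof -
      let ?x = "w s - w t"
      have sB: "(q s, u s) \<in> ?B" using inB IJ s by blast
      have "P' (q s, u s) (0, ?x) = G s"
        using linear_diff[OF lP[OF sB], of "(u s, w s)" "(u s, w t)"] w[OF s] by (simp add: G_def)
      then have "m * norm ?x * norm ?x \<le> G s \<bullet> ?x"
        using R(9)[OF sB, of ?x] by (simp add: power2_eq_square)
      also have "\<dots> \<le> norm (G s) * norm ?x" by (rule norm_cauchy_schwarz)
      finally show ?thesis by (cases "?x = 0") auto
    qed
    have "(G \<longlongrightarrow> G t) (at t within ?I)" using cG t by (simp add: continuous_on_def)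
    moreover have "G t = 0" using w[OF t] by (simp add: G_def)
    ultimately have "((\<lambda>s. norm (G s) / m) \<longlongrightarrow> 0) (at t within ?I)"
      by (intro tendsto_eq_intros) (use R(1) in auto)
    moreover have "\<forall>\<^sub>F s in at t within ?I. norm (w s - w t) \<le> norm (G s) / m"
      using bound R(1) by (auto simp: eventually_at_filter field_simps)
    ultimately have "((\<lambda>s. w s - w t) \<longlongrightarrow> 0) (at t within ?I)"
      by (rule Lim_null_comparison[rotated])
    then show ?thesis by (simp add: continuous_within LIM_zero_iff)
  qed
  then have "continuous_on ?I w" unfolding continuous_on_eq_continuous_within by blast
  then show ?thesis using dw by blast
qed

definition EL :: "('e::euclidean_space \<times> 'e \<Rightarrow> real) \<Rightarrow> (real \<Rightarrow> 'e) \<Rightarrow> real \<Rightarrow> bool" where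
  "EL f x t \<longleftrightarrow> (\<forall>e. ((\<lambda>r. vder f (x r, vector_derivative x (at r)) e)
     has_real_derivative hder f (x t, vector_derivative x (at t)) e) (at t))"

definition fibre_homogeneous :: "('e::euclidean_space \<times> 'e \<Rightarrow> real) \<Rightarrow> ('e \<times> 'e) set \<Rightarrow> bool" where
  "fibre_homogeneous f \<Omega> \<longleftrightarrow> open \<Omega> \<and> Ck_on 2 f \<Omega> \<and>
     (\<forall>q u s. (q, u) \<in> \<Omega> \<longrightarrow> s > 0 \<longrightarrow> (q, s *\<^sub>R u) \<in> \<Omega> \<and> f (q, s *\<^sub>R u) = s * f (q, u))"

text \<open>Differentiate \<open>f (q, s u) = s f (q, u)\<close>: fibre derivatives are homogeneous of degree zero and base
  derivatives of degree one.\<close>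

lemma fibre_homogeneous_scale:
  assumes h: "fibre_homogeneous f \<Omega>" and z: "(q, u) \<in> \<Omega>" and s: "s > 0"
  shows "vder f (q, s *\<^sub>R u) e = vder f (q, u) e" "hder f (q, s *\<^sub>R u) e = s * hder f (q, u) e"
proof -
  have o: "open \<Omega>" and C: "Ck_on 2 f \<Omega>" and z': "(q, s *\<^sub>R u) \<in> \<Omega>" using h z s by (auto simp: fibre_homogeneous_def)
  have d1: "(f has_derivative (\<lambda>\<zeta>. hder f (q, u) (fst \<zeta>) + vder f (q, u) (snd \<zeta>))) (at (q, u))"
    by (rule hder_vder_derivative[OF Ck_on_2_differentiable[OF C z]])
  note l = linear_vder[OF Ck_on_2_differentiable[OF C z']]
    linear_hder[OF Ck_on_2_differentiable[OF C z']]
    linear_vder[OF Ck_on_2_differentiable[OF C z]] linear_hder[OF Ck_on_2_differentiable[OF C z]]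
  define \<sigma> :: "'a \<times> 'a \<Rightarrow> 'a \<times> 'a" where "\<sigma> = (\<lambda>y. (fst y, s *\<^sub>R snd y))"
  have "(\<sigma> has_derivative \<sigma>) (at (q, u))" unfolding \<sigma>_def by (auto intro!: derivative_eq_intros)
  moreover have "(f has_derivative (\<lambda>\<zeta>. hder f (q, s *\<^sub>R u) (fst \<zeta>) + vder f (q, s *\<^sub>R u) (snd \<zeta>))) (at (\<sigma> (q, u)))"
    using hder_vder_derivative[OF Ck_on_2_differentiable[OF C z']] by (simp add: \<sigma>_def)
  ultimately have "(f \<circ> \<sigma> has_derivative (\<lambda>\<zeta>. hder f (q, s *\<^sub>R u) (fst \<zeta>) + vder f (q, s *\<^sub>R u) (snd \<zeta>)) \<circ> \<sigma>) (at (q, u))"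
    by (rule diff_chain_at)
  then have "((\<lambda>y. s * f y) has_derivative (\<lambda>\<zeta>. hder f (q, s *\<^sub>R u) (fst \<zeta>) + vder f (q, s *\<^sub>R u) (snd \<zeta>)) \<circ> \<sigma>) (at (q, u))"
    by (rule has_derivative_transform_within_open[OF _ o z])
      (use h s in \<open>auto simp: fibre_homogeneous_def \<sigma>_def\<close>)
  moreover have "((\<lambda>y. s * f y) has_derivative (\<lambda>\<zeta>. s * (hder f (q, u) (fst \<zeta>) + vder f (q, u) (snd \<zeta>)))) (at (q, u))"
    by (rule has_derivative_mult_right[OF d1])
  ultimately have eq: "(\<lambda>\<zeta>. hder f (q, s *\<^sub>R u) (fst \<zeta>) + vder f (q, s *\<^sub>R u) (snd \<zeta>)) \<circ> \<sigma>
      = (\<lambda>\<zeta>. s * (hder f (q, u) (fst \<zeta>) + vder f (q, u) (snd \<zeta>)))"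
    by (rule has_derivative_unique)
  show "vder f (q, s *\<^sub>R u) e = vder f (q, u) e"
    using fun_cong[OF eq, of "(0, e)"] s l by (simp add: \<sigma>_def linear_0 linear_cmul)
  show "hder f (q, s *\<^sub>R u) e = s * hder f (q, u) e"
    using fun_cong[OF eq, of "(e, 0)"] s l by (simp add: \<sigma>_def linear_0 linear_cmul)
qed

lemma vder_line:
  assumes "f differentiable (at (q, u))"
  shows "((\<lambda>t. f (q, u + t *\<^sub>R e)) has_real_derivative vder f (q, u) e) (at 0)"
proof -
  have "(f has_derivative (\<lambda>\<zeta>. hder f (q, u) (fst \<zeta>) + vder f (q, u) (snd \<zeta>))) (at ((q, u) + 0 *\<^sub>R (0, e)))"
    using hder_vder_derivative[OF assms] by simp
  from has_vector_derivative_line[OF this] show ?thesis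
    using linear_hder[OF assms] by (simp add: has_real_derivative_iff_has_vector_derivative linear_0)
qed

lemma fibre_homogeneous_Euler:
  assumes h: "fibre_homogeneous f \<Omega>" and z: "(q, u) \<in> \<Omega>"
  shows "vder f (q, u) u = f (q, u)"
proof -
  have "((\<lambda>t. f (q, u + t *\<^sub>R u)) has_real_derivative vder f (q, u) u) (at 0)"
    using h z by (intro vder_line Ck_on_2_differentiable[of f \<Omega>]) (auto simp: fibre_homogeneous_def)
  moreover have "((\<lambda>t. f (q, u + t *\<^sub>R u)) has_real_derivative f (q, u)) (at 0)"
  proof (rule has_field_derivative_transform_within_open)
    show "((\<lambda>t. (1 + t) * f (q, u)) has_real_derivative f (q, u)) (at 0)" by (auto intro!: derivative_eq_intros)
    show "(1 + t) * f (q, u) = f (q, u + t *\<^sub>R u)" if "t \<in> {-1<..<1}" for t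
    proof -
      have "f (q, (1 + t) *\<^sub>R u) = (1 + t) * f (q, u)" using h z that by (simp add: fibre_homogeneous_def)
      then show ?thesis by (simp add: scaleR_left_distrib)
    qed
  qed auto
  ultimately show ?thesis by (rule DERIV_unique)
qed

lemma square_derivatives:
  assumes "f differentiable (at z)"
  shows "vder (\<lambda>z. (f z)\<^sup>2) z e = 2 * f z * vder f z e" "hder (\<lambda>z. (f z)\<^sup>2) z e = 2 * f z * hder f z e"
proof -
  have d: "((\<lambda>z. (f z)\<^sup>2) has_derivative (\<lambda>\<zeta>. 2 * f z * (hder f z (fst \<zeta>) + vder f z (snd \<zeta>)))) (at z)"
    by (rule has_derivative_eq_rhs[OF has_derivative_power[OF hder_vder_derivative[OF assms], of 2]])
      (simp add: fun_eq_iff algebra_simps)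
  show "vder (\<lambda>z. (f z)\<^sup>2) z e = 2 * f z * vder f z e" "hder (\<lambda>z. (f z)\<^sup>2) z e = 2 * f z * hder f z e"
    using vder_eqI[OF d] hder_eqI[OF d] linear_hder[OF assms] linear_vder[OF assms] by (simp_all add: linear_0)
qed

lemma Ck_on_square: "open \<Omega> \<Longrightarrow> Ck_on k (f :: 'a::euclidean_space \<Rightarrow> real) \<Omega> \<Longrightarrow> Ck_on k (\<lambda>z. (f z)\<^sup>2) \<Omega>"
  unfolding power2_eq_square by (intro Ck_on_bilinear[OF bounded_bilinear_mult])

lemma derivative_along_curve:
  fixes x :: "real \<Rightarrow> 'e::euclidean_space"
  assumes "(x has_vector_derivative x') (at t)" "(y has_vector_derivative y') (at t)" "f differentiable (at (x t, y t))"
  shows "((\<lambda>t. f (x t, y t)) has_real_derivative hder f (x t, y t) x' + vder f (x t, y t) y') (at t)"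
proof -
  have "((\<lambda>t. (x t, y t)) has_vector_derivative (x', y')) (at t)"
    using assms(1,2) by (rule has_vector_derivative_Pair)
  from vector_derivative_diff_chain_within[OF this has_derivative_at_withinI[OF hder_vder_derivative[OF assms(3)]]]
  show ?thesis by (simp add: o_def has_real_derivative_iff_has_vector_derivative)
qed

lemma has_vector_derivative_inner_iff:
  fixes p :: "real \<Rightarrow> 'e::euclidean_space"
  shows "(p has_vector_derivative p') (at t) \<longleftrightarrow> (\<forall>e. ((\<lambda>r. p r \<bullet> e) has_vector_derivative p' \<bullet> e) (at t))"
proof
  assume "\<forall>e. ((\<lambda>r. p r \<bullet> e) has_vector_derivative p' \<bullet> e) (at t)"
  then show "(p has_vector_derivative p') (at t)"
    unfolding has_vector_derivative_def has_derivative_componentwise_within[of p] by simp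
qed (auto intro: bounded_linear.has_vector_derivative[OF bounded_linear_inner_left])

text \<open>Conservation of energy: by Euler's identity \<open>2 f\<^sup>2\<close> is the momentum applied to the velocity, whose derivative
  along a solution equals that of \<open>f\<^sup>2\<close>. Once \<open>f\<close> is constant along the solution, the equations of \<open>f\<^sup>2\<close>
  and of \<open>f\<close> differ by a constant factor.\<close>

lemma el_sol_constant_speed:
  fixes f :: "'e::euclidean_space \<times> 'e \<Rightarrow> real"
  assumes h: "fibre_homogeneous f \<Omega>" and B: "X \<times> Y \<subseteq> \<Omega>" and pos: "\<And>z. z \<in> \<Omega> \<Longrightarrow> f z > 0"
    and reg: "el_region (vgrad (\<lambda>z. (f z)\<^sup>2)) P' (hgrad (\<lambda>z. (f z)\<^sup>2)) (X \<times> Y) K m"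
    and sol: "el_sol (vgrad (\<lambda>z. (f z)\<^sup>2)) (hgrad (\<lambda>z. (f z)\<^sup>2)) (X \<times> Y) {-\<tau>..\<tau>} q u" and "\<tau> > 0"
  shows "Ck_on 2 q {-\<tau><..<\<tau>}"
    "\<And>t. t \<in> {-\<tau><..<\<tau>} \<Longrightarrow> (q has_vector_derivative u t) (at t)"
    "\<And>t. t \<in> {-\<tau><..<\<tau>} \<Longrightarrow> f (q t, u t) = f (q 0, u 0)"
    "\<And>t. t \<in> {-\<tau><..<\<tau>} \<Longrightarrow> EL f q t"
proof -
  let ?L = "\<lambda>z. (f z)\<^sup>2" and ?I = "{-\<tau><..<\<tau>}"
  have oI: "open ?I" by simp
  have o: "open \<Omega>" and C: "Ck_on 2 f \<Omega>" using h by (auto simp: fibre_homogeneous_def)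
  have CL: "Ck_on 2 ?L \<Omega>" by (rule Ck_on_square[OF o C])
  have at: "at t within {-\<tau>..\<tau>} = at t" if "t \<in> ?I" for t
    using that by (intro at_within_interior) auto
  have z: "(q t, u t) \<in> \<Omega>" if "t \<in> ?I" for t using sol B that by (auto simp: el_sol_def)
  show dq: "(q has_vector_derivative u t) (at t)" if "t \<in> ?I" for t
    using sol that at[OF that] by (auto simp: el_sol_def dest!: bspec[of _ _ t])
  have dP: "((\<lambda>t. vgrad ?L (q t, u t)) has_vector_derivative hgrad ?L (q t, u t)) (at t)" if "t \<in> ?I" for t
    using sol that at[OF that] by (auto simp: el_sol_def dest!: bspec[of _ _ t])
  obtain w where w: "continuous_on ?I w" "\<And>t. t \<in> ?I \<Longrightarrow> (u has_vector_derivative w t) (at t)"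
    using el_sol_C2[OF reg sol] by blast
  have "Ck_on (Suc (Suc 0)) q ?I"
    by (rule Ck_on_real_SucI[OF oI dq Ck_on_real_SucI[OF oI w(2)]]) (use w(1) in auto)
  then show "Ck_on 2 q ?I" by (simp add: numeral_2_eq_2)
  have dif: "f differentiable (at (q t, u t))" "?L differentiable (at (q t, u t))" if "t \<in> ?I" for t
    using Ck_on_2_differentiable[OF C z[OF that]] Ck_on_2_differentiable[OF CL z[OF that]] .
  have "(?L \<circ> (\<lambda>t. (q t, u t)) has_real_derivative 0) (at t)" if t: "t \<in> ?I" for t
  proof -
    have L': "((\<lambda>t. ?L (q t, u t)) has_real_derivative hder ?L (q t, u t) (u t) + vder ?L (q t, u t) (w t)) (at t)"
      by (rule derivative_along_curve[OF dq[OF t] w(2)[OF t] dif(2)[OF t]])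
    have "((\<lambda>t. vgrad ?L (q t, u t) \<bullet> u t) has_vector_derivative
        vgrad ?L (q t, u t) \<bullet> w t + hgrad ?L (q t, u t) \<bullet> u t) (at t)"
      using bounded_bilinear.has_vector_derivative[OF bounded_bilinear_inner dP[OF t] w(2)[OF t]] .
    then have "((\<lambda>t. 2 * ?L (q t, u t)) has_vector_derivative
        vgrad ?L (q t, u t) \<bullet> w t + hgrad ?L (q t, u t) \<bullet> u t) (at t)"
    proof (rule has_vector_derivative_transform_within_open[OF _ oI t])
      show "vgrad ?L (q s, u s) \<bullet> u s = 2 * ?L (q s, u s)" if "s \<in> ?I" for s
        unfolding vgrad_inner[OF dif(2)[OF that]] square_derivatives[OF dif(1)[OF that]]
        using fibre_homogeneous_Euler[OF h z[OF that]] by (simp add: power2_eq_square)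
    qed
    then have "((\<lambda>t. 2 * ?L (q t, u t)) has_real_derivative
        vder ?L (q t, u t) (w t) + hder ?L (q t, u t) (u t)) (at t)"
      unfolding has_real_derivative_iff_has_vector_derivative vgrad_inner[OF dif(2)[OF t]] hgrad_inner[OF dif(2)[OF t]] .
    from DERIV_diff[OF this L'] show ?thesis by (simp add: o_def)
  qed
  then have L0: "((\<lambda>t. ?L (q t, u t)) has_field_derivative 0) (at t within ?I)" if "t \<in> ?I" for t
    using that by (simp add: o_def has_field_derivative_at_within)
  obtain c where c: "\<And>t. t \<in> ?I \<Longrightarrow> ?L (q t, u t) = c"
    using has_field_derivative_zero_constant[of ?I, OF _ L0] by auto
  have I0: "0 \<in> ?I" using \<open>\<tau> > 0\<close> by simp
  show fc: "f (q t, u t) = f (q 0, u 0)" if "t \<in> ?I" for t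
    using c[OF that] c[OF I0] pos[OF z[OF that]] pos[OF z[OF I0]]
    by (metis less_imp_le power2_eq_iff_nonneg)
  have k: "f (q 0, u 0) > 0" using pos z \<open>\<tau> > 0\<close> by auto
  show "EL f q t" if t: "t \<in> ?I" for t
    unfolding EL_def
  proof
    fix e
    have "((\<lambda>t. vgrad ?L (q t, u t) \<bullet> e / (2 * f (q 0, u 0))) has_vector_derivative
        hgrad ?L (q t, u t) \<bullet> e / (2 * f (q 0, u 0))) (at t)"
      by (intro has_vector_derivative_divide bounded_linear.has_vector_derivative[OF bounded_linear_inner_left dP[OF t]])
    then have "((\<lambda>r. vder f (q r, vector_derivative q (at r)) e) has_vector_derivative
        hgrad ?L (q t, u t) \<bullet> e / (2 * f (q 0, u 0))) (at t)"
    proof (rule has_vector_derivative_transform_within_open[OF _ oI t])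
      show "vgrad ?L (q s, u s) \<bullet> e / (2 * f (q 0, u 0)) = vder f (q s, vector_derivative q (at s)) e" if "s \<in> ?I" for s
        unfolding vgrad_inner[OF dif(2)[OF that]] square_derivatives[OF dif(1)[OF that]]
        using fc[OF that] k by (simp add: vector_derivative_at[OF dq[OF that]])
    qed
    moreover have "hgrad ?L (q t, u t) \<bullet> e / (2 * f (q 0, u 0)) = hder f (q t, vector_derivative q (at t)) e"
      unfolding hgrad_inner[OF dif(2)[OF t]] square_derivatives[OF dif(1)[OF t]]
      using fc[OF t] k by (simp add: vector_derivative_at[OF dq[OF t]])
    ultimately show "((\<lambda>r. vder f (q r, vector_derivative q (at r)) e) has_real_derivative
        hder f (q t, vector_derivative q (at t)) e) (at t)"
      by (simp add: has_real_derivative_iff_has_vector_derivative)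
  qed
qed

lemma EL_imp_el_sol:
  fixes f :: "'e::euclidean_space \<times> 'e \<Rightarrow> real"
  assumes C: "Ck_on 2 f \<Omega>" and B: "B \<subseteq> \<Omega>" and I: "open I" "J \<subseteq> I" and x: "Ck_on 2 x I"
    and EL: "\<And>t. t \<in> I \<Longrightarrow> EL f x t" and k: "\<And>t. t \<in> I \<Longrightarrow> f (x t, vector_derivative x (at t)) = k"
    and z: "\<And>t. t \<in> I \<Longrightarrow> (x t, vector_derivative x (at t)) \<in> B"
  shows "el_sol (vgrad (\<lambda>z. (f z)\<^sup>2)) (hgrad (\<lambda>z. (f z)\<^sup>2)) B J x (\<lambda>t. vector_derivative x (at t))"
proof -
  let ?L = "\<lambda>z. (f z)\<^sup>2" and ?z = "\<lambda>t. (x t, vector_derivative x (at t))"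
  have x2: "Ck_on (Suc 1) x I" using x by (simp add: numeral_2_eq_2)
  have dif: "f differentiable (at (?z t))" if "t \<in> I" for t
    using z[OF that] B by (intro Ck_on_2_differentiable[OF C]) auto
  have dif2: "?L differentiable (at (?z t))" if "t \<in> I" for t
    using dif[OF that] by simp
  have "((\<lambda>t. vgrad ?L (?z t)) has_vector_derivative hgrad ?L (?z t)) (at t)" if t: "t \<in> I" for t
  proof (rule has_vector_derivative_inner_iff[THEN iffD2], rule)
    fix e
    have "((\<lambda>r. 2 * k * vder f (?z r) e) has_real_derivative 2 * k * hder f (?z t) e) (at t)"
      using EL[OF t] unfolding EL_def by (intro DERIV_cmult) auto
    then have "((\<lambda>r. vgrad ?L (?z r) \<bullet> e) has_real_derivative 2 * k * hder f (?z t) e) (at t)"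
      by (rule has_field_derivative_transform_within_open[OF _ I(1) t])
        (simp add: vgrad_inner[OF dif2] square_derivatives[OF dif] k)
    moreover have "2 * k * hder f (?z t) e = hgrad ?L (?z t) \<bullet> e"
      by (simp add: hgrad_inner[OF dif2[OF t]] square_derivatives[OF dif[OF t]] k[OF t])
    ultimately show "((\<lambda>r. vgrad ?L (?z r) \<bullet> e) has_vector_derivative hgrad ?L (?z t) \<bullet> e) (at t)"
      by (simp add: has_real_derivative_iff_has_vector_derivative)
  qed
  moreover have "continuous_on J (\<lambda>t. vector_derivative x (at t))"
    using Ck_on_real_SucD(2)[OF x2 I(1)] I(2) Ck_on_imp_continuous_on continuous_on_subset by blast
  ultimately show ?thesis
    using Ck_on_real_SucD(1)[OF x2 I(1)] I(2) z unfolding el_sol_def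
    by (auto intro: has_vector_derivative_at_within)
qed

text \<open>Under a change of parameter both sides of the equation are multiplied by the derivative of \<open>\<phi>\<close>.\<close>

lemma EL_reparametrize:
  fixes x :: "real \<Rightarrow> 'e::euclidean_space"
  assumes h: "fibre_homogeneous f \<Omega>" and I: "open I" and J: "open J" "t \<in> J"
    and x: "Ck_on 1 x I" and \<phi>: "Ck_on 1 \<phi> J" "\<phi> ` J \<subseteq> I" "\<And>s. s \<in> J \<Longrightarrow> vector_derivative \<phi> (at s) > 0"
    and z: "\<And>r. r \<in> I \<Longrightarrow> (x r, vector_derivative x (at r)) \<in> \<Omega>" and EL: "EL f x (\<phi> t)"
  shows "EL f (x \<circ> \<phi>) t"
  unfolding EL_def
proof
  fix e
  have vd: "vector_derivative (x \<circ> \<phi>) (at s) = vector_derivative \<phi> (at s) *\<^sub>R vector_derivative x (at (\<phi> s))" if "s \<in> J" for s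
    using Ck_on_real_SucD(1)[of 0 \<phi> J s] Ck_on_real_SucD(1)[of 0 x I "\<phi> s"] \<phi>(1,2) x I J that
    by (intro vector_derivative_at vector_diff_chain_at) auto
  have d\<phi>: "(\<phi> has_vector_derivative vector_derivative \<phi> (at t)) (at t)"
    using Ck_on_real_SucD(1)[of 0 \<phi> J t] \<phi>(1) J by auto
  have "((\<lambda>r. vder f (x r, vector_derivative x (at r)) e) has_vector_derivative
      hder f (x (\<phi> t), vector_derivative x (at (\<phi> t))) e) (at (\<phi> t))"
    using EL by (simp add: EL_def has_real_derivative_iff_has_vector_derivative)
  from vector_diff_chain_at[OF d\<phi> this]
  have "((\<lambda>s. vder f (x (\<phi> s), vector_derivative x (at (\<phi> s))) e) has_vector_derivative
      vector_derivative \<phi> (at t) * hder f (x (\<phi> t), vector_derivative x (at (\<phi> t))) e) (at t)"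
    by (simp add: o_def)
  then have "((\<lambda>s. vder f ((x \<circ> \<phi>) s, vector_derivative (x \<circ> \<phi>) (at s)) e) has_vector_derivative
      vector_derivative \<phi> (at t) * hder f (x (\<phi> t), vector_derivative x (at (\<phi> t))) e) (at t)"
  proof (rule has_vector_derivative_transform_within_open[OF _ J])
    fix s assume s: "s \<in> J"
    then have "(x (\<phi> s), vector_derivative x (at (\<phi> s))) \<in> \<Omega>" using z \<phi>(2) by blast
    from fibre_homogeneous_scale(1)[OF h this \<phi>(3)[OF s]]
    show "vder f (x (\<phi> s), vector_derivative x (at (\<phi> s))) e = vder f ((x \<circ> \<phi>) s, vector_derivative (x \<circ> \<phi>) (at s)) e"
      by (simp add: vd[OF s])
  qed
  moreover have "(x (\<phi> t), vector_derivative x (at (\<phi> t))) \<in> \<Omega>" using z \<phi>(2) J by blast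
  from fibre_homogeneous_scale(2)[OF h this \<phi>(3)[OF J(2)]]
  have "vector_derivative \<phi> (at t) * hder f (x (\<phi> t), vector_derivative x (at (\<phi> t))) e
      = hder f ((x \<circ> \<phi>) t, vector_derivative (x \<circ> \<phi>) (at t)) e"
    by (simp add: vd[OF J(2)])
  ultimately show "((\<lambda>r. vder f ((x \<circ> \<phi>) r, vector_derivative (x \<circ> \<phi>) (at r)) e) has_real_derivative
      hder f ((x \<circ> \<phi>) t, vector_derivative (x \<circ> \<phi>) (at t)) e) (at t)"
    by (simp add: has_real_derivative_iff_has_vector_derivative)
qed

lemma vder_hder_diff:
  assumes "f differentiable (at z)" "g differentiable (at z)"
  shows "vder (\<lambda>z. f z - g z) z e = vder f z e - vder g z e" "hder (\<lambda>z. f z - g z) z e = hder f z e - hder g z e"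
proof -
  note d = has_derivative_diff[OF hder_vder_derivative[OF assms(1)] hder_vder_derivative[OF assms(2)]]
  show "vder (\<lambda>z. f z - g z) z e = vder f z e - vder g z e" "hder (\<lambda>z. f z - g z) z e = hder f z e - hder g z e"
    using vder_eqI[OF d] hder_eqI[OF d] linear_hder[OF assms(1)] linear_hder[OF assms(2)]
      linear_vder[OF assms(1)] linear_vder[OF assms(2)] by (simp_all add: linear_0)
qed

lemma EL_diff:
  assumes "EL f x t" "EL g x t" and I: "open I" "t \<in> I"
    and d: "\<And>s. s \<in> I \<Longrightarrow> f differentiable (at (x s, vector_derivative x (at s)))"
      "\<And>s. s \<in> I \<Longrightarrow> g differentiable (at (x s, vector_derivative x (at s)))"
  shows "EL (\<lambda>z. f z - g z) x t"
  unfolding EL_def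
proof
  fix e
  have "((\<lambda>r. vder f (x r, vector_derivative x (at r)) e - vder g (x r, vector_derivative x (at r)) e) has_real_derivative
      hder f (x t, vector_derivative x (at t)) e - hder g (x t, vector_derivative x (at t)) e) (at t)"
    using assms(1,2) unfolding EL_def by (intro DERIV_diff) auto
  then show "((\<lambda>r. vder (\<lambda>z. f z - g z) (x r, vector_derivative x (at r)) e) has_real_derivative
      hder (\<lambda>z. f z - g z) (x t, vector_derivative x (at t)) e) (at t)"
    unfolding vder_hder_diff(2)[OF d[OF I(2)]]
    by (rule has_field_derivative_transform_within_open[OF _ I]) (simp add: vder_hder_diff(1)[OF d])
qed

lemma fibre_homogeneous_diff:
  assumes "fibre_homogeneous f \<Omega>" "fibre_homogeneous g \<Omega>"
  shows "fibre_homogeneous (\<lambda>z. f z - g z) \<Omega>"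
  using assms unfolding fibre_homogeneous_def by (auto intro: Ck_on_diff simp: right_diff_distrib)

lemma quadratic_remainder:
  assumes C: "Ck_on 2 f \<Omega>" and o: "open \<Omega>" and B: "B \<subseteq> \<Omega>" "compact B" "convex B"
  shows "\<exists>K>0. \<forall>z\<in>B. \<forall>z'\<in>B. \<bar>f z' - f z - (hgrad f z \<bullet> (fst z' - fst z) + vgrad f z \<bullet> (snd z' - snd z))\<bar>
    \<le> K * (norm (z' - z))\<^sup>2"
proof -
  obtain K1 where K1: "K1 > 0" "\<forall>z\<in>B. \<forall>z'\<in>B. norm (vgrad f z - vgrad f z') \<le> K1 * norm (z - z')"
    using lipschitz_on_compact_convex[OF Ck_on_vgrad[OF C o] B] by blast
  obtain K2 where K2: "K2 > 0" "\<forall>z\<in>B. \<forall>z'\<in>B. norm (hgrad f z - hgrad f z') \<le> K2 * norm (z - z')"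
    using lipschitz_on_compact_convex[OF Ck_on_hgrad[OF C o] B] by blast
  define f' where "f' = (\<lambda>z \<zeta>. hgrad f z \<bullet> fst \<zeta> + vgrad f z \<bullet> snd \<zeta>)"
  have d: "(f has_derivative f' z) (at z)" if "z \<in> \<Omega>" for z
    using hder_vder_derivative[OF Ck_on_2_differentiable[OF C that]]
    by (simp add: f'_def hgrad_inner vgrad_inner Ck_on_2_differentiable[OF C that])
  have "\<bar>f z' - f z - f' z (z' - z)\<bar> \<le> (K1 + K2) * (norm (z' - z))\<^sup>2" if z: "z \<in> B" "z' \<in> B" for z z'
  proof -
    let ?S = "closed_segment z z'"
    have S: "?S \<subseteq> B" using z B(3) by (rule closed_segment_subset)
    have "norm (f z' - f z - f' z (z' - z)) \<le> norm (z' - z) * ((K1 + K2) * norm (z' - z))"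
    proof (rule differentiable_bound_linearization[where S = ?S])
      show "z + t *\<^sub>R (z' - z) \<in> ?S" if "t \<in> {0..1}" for t
        using that by (auto simp: closed_segment_def algebra_simps intro!: exI[of _ t])
      show "(f has_derivative f' x) (at x within ?S)" if "x \<in> ?S" for x
        using d[of x] that S B(1) by (auto intro: has_derivative_at_withinI)
      show "onorm (f' x - f' z) \<le> (K1 + K2) * norm (z' - z)" if x: "x \<in> ?S" for x
      proof (rule onorm_le)
        fix \<zeta> :: "'a \<times> 'a"
        have xz: "norm (x - z) \<le> norm (z' - z)"
          using segment_bound1[OF x] by (simp add: norm_minus_commute)
        have b: "norm (hgrad f x - hgrad f z) \<le> K2 * norm (z' - z)" "norm (vgrad f x - vgrad f z) \<le> K1 * norm (z' - z)"
          using K1 K2 x S z(1) mult_left_mono[OF xz, of K1] mult_left_mono[OF xz, of K2]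
          by (meson less_imp_le order_trans subsetD)+
        have n: "norm (fst \<zeta>) \<le> norm \<zeta>" "norm (snd \<zeta>) \<le> norm \<zeta>"
          by (cases \<zeta>, simp add: norm_Pair real_le_rsqrt)+
        have "(f' x - f' z) \<zeta> = (hgrad f x - hgrad f z) \<bullet> fst \<zeta> + (vgrad f x - vgrad f z) \<bullet> snd \<zeta>"
          by (simp add: f'_def inner_diff_left)
        also have "norm \<dots> \<le> norm (hgrad f x - hgrad f z) * norm (fst \<zeta>) + norm (vgrad f x - vgrad f z) * norm (snd \<zeta>)"
          unfolding real_norm_def by (intro order_trans[OF abs_triangle_ineq] add_mono Cauchy_Schwarz_ineq2)
        also have "\<dots> \<le> (K2 * norm (z' - z)) * norm \<zeta> + (K1 * norm (z' - z)) * norm \<zeta>"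
          using K1 K2 by (intro add_mono mult_mono b n) auto
        finally show "norm ((f' x - f' z) \<zeta>) \<le> (K1 + K2) * norm (z' - z) * norm \<zeta>" by (simp add: algebra_simps)
      qed
      show "z \<in> ?S" by simp
    qed
    then show ?thesis by (simp add: power2_eq_square ac_simps)
  qed
  then show ?thesis using K1 K2 by (intro exI[of _ "K1 + K2"]) (auto simp: f'_def)
qed

text \<open>The neighbourhood \<open>N\<close> restricts the velocities as well as the base points; no linearity
  in the fibre is assumed beyond \<open>N\<close>.\<close>

definition locally_exact :: "('e::euclidean_space \<times> 'e \<Rightarrow> real) \<Rightarrow> 'e \<times> 'e \<Rightarrow> bool" where
  "locally_exact f z \<longleftrightarrow> (\<exists>N S. open N \<and> z \<in> N \<and>
     (\<forall>(q, u)\<in>N. S differentiable (at q) \<and> f (q, u) = frechet_derivative S (at q) u))"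

text \<open>A function that is linear in \<open>u\<close> near a point is determined there by its fibre derivative.\<close>

lemma exact_gradient:
  assumes N: "open N" "z \<in> N" and f: "f differentiable (at z)"
    and S: "\<And>q u. (q, u) \<in> N \<Longrightarrow> S differentiable (at q) \<and> f (q, u) = frechet_derivative S (at q) u"
  shows "(S has_derivative (\<lambda>e. vgrad f z \<bullet> e)) (at (fst z))"
proof -
  obtain q u where z: "z = (q, u)" by (cases z)
  have Sd: "(S has_derivative frechet_derivative S (at q)) (at q)"
    using S[of q u] N(2) by (simp add: z frechet_derivative_works)
  then have l: "linear (frechet_derivative S (at q))" by (rule has_derivative_linear)
  have "vder f z e = frechet_derivative S (at q) e" for e
  proof -
    have "((\<lambda>t. f (q, u + t *\<^sub>R e)) has_real_derivative vder f z e) (at 0)"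
      using vder_line f by (simp add: z)
    moreover have "((\<lambda>t. f (q, u + t *\<^sub>R e)) has_real_derivative frechet_derivative S (at q) e) (at 0)"
    proof (rule has_field_derivative_transform_within_open)
      let ?T = "(\<lambda>t. (q, u + t *\<^sub>R e)) -` N"
      show "((\<lambda>t. frechet_derivative S (at q) u + t * frechet_derivative S (at q) e) has_real_derivative frechet_derivative S (at q) e) (at 0)"
        by (auto intro!: derivative_eq_intros)
      show "open ?T" using N(1) by (intro open_vimage continuous_intros)
      show "0 \<in> ?T" using N(2) by (simp add: z)
      show "frechet_derivative S (at q) u + t * frechet_derivative S (at q) e = f (q, u + t *\<^sub>R e)" if "t \<in> ?T" for t
        using S[of q "u + t *\<^sub>R e"] that by (simp add: linear_add[OF l] linear_cmul[OF l])
    qed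
    ultimately show ?thesis by (rule DERIV_unique)
  qed
  then have "frechet_derivative S (at q) = (\<lambda>e. vgrad f z \<bullet> e)" by (simp add: vgrad_inner f fun_eq_iff)
  then show ?thesis using Sd by (simp add: z)
qed

text \<open>The differential of \<open>S\<close> has no component along the fibre, so \<open>S\<close> depends on the position
  alone. Euler's identity then identifies \<open>f\<close> with the differential of that function.\<close>

lemma locally_exactI:
  fixes f :: "'e::euclidean_space \<times> 'e \<Rightarrow> real"
  assumes h: "fibre_homogeneous f \<Omega>" and z: "z \<in> \<Omega>" and \<rho>: "\<rho> > 0"
    and S: "\<And>y. y \<in> ball z \<rho> \<Longrightarrow> (S has_derivative (\<lambda>\<zeta>. vgrad f y \<bullet> fst \<zeta>)) (at y)"
  shows "locally_exact f z"
proof -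
  have o: "open \<Omega>" and C: "Ck_on 2 f \<Omega>" using h by (auto simp: fibre_homogeneous_def)
  obtain a b where ab: "z = (a, b)" by (cases z)
  have "open (\<Omega> \<inter> ball z \<rho>)" "z \<in> \<Omega> \<inter> ball z \<rho>" using o z \<rho> by auto
  then obtain U V where UV: "open U" "open V" "a \<in> U" "b \<in> V" "U \<times> V \<subseteq> \<Omega> \<inter> ball z \<rho>"
    unfolding open_prod_def ab by (metis SigmaE2 mem_Sigma_iff)
  obtain r where r: "r > 0" "ball b r \<subseteq> V" using UV(2,4) by (meson openE)
  define N where "N = U \<times> ball b r"
  have N: "N \<subseteq> \<Omega>" "N \<subseteq> ball z \<rho>" using UV(5) r(2) by (auto simp: N_def)
  have const: "S (q, u) = S (q, b)" if qu: "q \<in> U" "u \<in> ball b r" for q u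
  proof -
    have "((\<lambda>u. S (q, u)) has_derivative (\<lambda>_. 0)) (at u within ball b r)" if "u \<in> ball b r" for u
    proof -
      have "((\<lambda>u. (q, u)) has_derivative (\<lambda>e. (0, e))) (at u)" by (auto intro!: derivative_eq_intros)
      moreover have "(S has_derivative (\<lambda>\<zeta>. vgrad f (q, u) \<bullet> fst \<zeta>)) (at (q, u))"
      proof (rule S)
        show "(q, u) \<in> ball z \<rho>" using N(2) qu(1) that unfolding N_def by blast
      qed
      ultimately have "((\<lambda>u. S (q, u)) has_derivative (\<lambda>e. vgrad f (q, u) \<bullet> fst (0::'e, e))) (at u)"
        by (rule has_derivative_compose)
      then show ?thesis by (simp add: has_derivative_at_withinI)
    qed
    then obtain c where "\<And>u. u \<in> ball b r \<Longrightarrow> S (q, u) = c"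
      using has_derivative_zero_constant[OF convex_ball] by metis
    then show ?thesis using qu r(1) by simp
  qed
  have "(\<lambda>q. S (q, b)) differentiable (at q) \<and> f (q, u) = frechet_derivative (\<lambda>q. S (q, b)) (at q) u"
    if qu: "(q, u) \<in> N" for q u
  proof -
    have "((\<lambda>q. (q, u)) has_derivative (\<lambda>e. (e, 0))) (at q)" by (auto intro!: derivative_eq_intros)
    moreover have "(S has_derivative (\<lambda>\<zeta>. vgrad f (q, u) \<bullet> fst \<zeta>)) (at (q, u))" using S N(2) qu by blast
    ultimately have "((\<lambda>q. S (q, u)) has_derivative (\<lambda>e. vgrad f (q, u) \<bullet> fst (e, 0::'e))) (at q)"
      by (rule has_derivative_compose)
    then have d0: "((\<lambda>q. S (q, u)) has_derivative (\<lambda>e. vgrad f (q, u) \<bullet> e)) (at q)" by simp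
    have qU: "q \<in> U" and uV: "u \<in> ball b r" using qu unfolding N_def by auto
    have d: "((\<lambda>q. S (q, b)) has_derivative (\<lambda>e. vgrad f (q, u) \<bullet> e)) (at q)"
      by (rule has_derivative_transform_within_open[OF d0 UV(1) qU const[OF _ uV]])
    have z\<Omega>: "(q, u) \<in> \<Omega>" using N(1) qu by blast
    have "vgrad f (q, u) \<bullet> u = f (q, u)"
      using fibre_homogeneous_Euler[OF h z\<Omega>] vgrad_inner[OF Ck_on_2_differentiable[OF C z\<Omega>]] by simp
    moreover have "frechet_derivative (\<lambda>q. S (q, b)) (at q) u = vgrad f (q, u) \<bullet> u"
      using fun_cong[OF frechet_derivative_at[OF d]] by metis
    ultimately show ?thesis using differentiableI[OF d] by simp
  qed
  moreover have "open N" "z \<in> N" using UV r by (auto simp: N_def ab open_Times)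
  ultimately show ?thesis unfolding locally_exact_def by blast
qed

section \<open>Transport of primitives by the flow of extremals\<close>

lemma Ck_on_shift:
  fixes x :: "real \<Rightarrow> 'e::euclidean_space"
  assumes "Ck_on k x I" "open I" "open J" "\<And>s. s \<in> J \<Longrightarrow> a + s \<in> I"
  shows "Ck_on k (\<lambda>s. x (a + s)) J"
  using assms
  by (intro Ck_on_compose[OF assms(3,1)] Ck_on_add Ck_on_const Ck_on_ident) auto

text \<open>The extremals of constant speed near a tangent vector, indexed by their initial vectors \<open>w\<close>,
  together with what replaces differentiability of the flow: Lipschitz dependence on \<open>w\<close> and uniqueness.\<close>

definition flow_box :: "('e::euclidean_space \<times> 'e \<Rightarrow> real) \<Rightarrow> ('e \<times> 'e) set \<Rightarrow> ('e \<times> 'e) set \<Rightarrow> real \<Rightarrow> real \<Rightarrow>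
    ('e \<times> 'e \<Rightarrow> real \<Rightarrow> 'e) \<Rightarrow> ('e \<times> 'e \<Rightarrow> real \<Rightarrow> 'e) \<Rightarrow> bool" where
  "flow_box f B W C \<tau> q u \<longleftrightarrow> 0 < \<tau> \<and> \<tau> \<le> 1 \<and> 0 < C \<and> open W \<and>
    (\<forall>w\<in>W. (q w 0, u w 0) = w \<and> Ck_on 2 (q w) {-\<tau><..<\<tau>}) \<and>
    (\<forall>w\<in>W. \<forall>t\<in>{-\<tau><..<\<tau>}. (q w t, u w t) \<in> B \<and> (q w has_vector_derivative u w t) (at t) \<and>
       f (q w t, u w t) = f w \<and> EL f (q w) t) \<and>
    (\<forall>w\<in>W. \<forall>w'\<in>W. \<forall>t\<in>{-\<tau><..<\<tau>}. norm ((q w' t, u w' t) - (q w t, u w t)) \<le> C * norm (w' - w)) \<and>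
    (\<forall>w\<in>W. \<forall>x \<sigma>. 0 < \<sigma> \<longrightarrow> \<sigma> \<le> \<tau> \<longrightarrow> Ck_on 2 x {-\<sigma><..<\<sigma>} \<longrightarrow> (x 0, vector_derivative x (at 0)) = w \<longrightarrow>
       (\<forall>t\<in>{-\<sigma><..<\<sigma>}. (x t, vector_derivative x (at t)) \<in> B \<and> EL f x t \<and>
          f (x t, vector_derivative x (at t)) = f w) \<longrightarrow>
       (\<forall>t\<in>{-\<sigma><..<\<sigma>}. (x t, vector_derivative x (at t)) = (q w t, u w t)))"

lemma flow_boxD:
  assumes "flow_box f B W C \<tau> q u"
  shows "0 < \<tau>" "\<tau> \<le> 1" "0 < C" "open W"
    "\<And>w. w \<in> W \<Longrightarrow> (q w 0, u w 0) = w"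
    "\<And>w. w \<in> W \<Longrightarrow> Ck_on 2 (q w) {-\<tau><..<\<tau>}"
    "\<And>w t. w \<in> W \<Longrightarrow> t \<in> {-\<tau><..<\<tau>} \<Longrightarrow> (q w t, u w t) \<in> B"
    "\<And>w t. w \<in> W \<Longrightarrow> t \<in> {-\<tau><..<\<tau>} \<Longrightarrow> (q w has_vector_derivative u w t) (at t)"
    "\<And>w t. w \<in> W \<Longrightarrow> t \<in> {-\<tau><..<\<tau>} \<Longrightarrow> f (q w t, u w t) = f w"
    "\<And>w t. w \<in> W \<Longrightarrow> t \<in> {-\<tau><..<\<tau>} \<Longrightarrow> EL f (q w) t"
    "\<And>w w' t. w \<in> W \<Longrightarrow> w' \<in> W \<Longrightarrow> t \<in> {-\<tau><..<\<tau>} \<Longrightarrow>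
       norm ((q w' t, u w' t) - (q w t, u w t)) \<le> C * norm (w' - w)"
    "\<And>w x \<sigma> t. w \<in> W \<Longrightarrow> 0 < \<sigma> \<Longrightarrow> \<sigma> \<le> \<tau> \<Longrightarrow> Ck_on 2 x {-\<sigma><..<\<sigma>} \<Longrightarrow>
       (x 0, vector_derivative x (at 0)) = w \<Longrightarrow>
       (\<And>t. t \<in> {-\<sigma><..<\<sigma>} \<Longrightarrow> (x t, vector_derivative x (at t)) \<in> B \<and> EL f x t \<and>
          f (x t, vector_derivative x (at t)) = f w) \<Longrightarrow>
       t \<in> {-\<sigma><..<\<sigma>} \<Longrightarrow> (x t, vector_derivative x (at t)) = (q w t, u w t)"
proof -
  from assms show "0 < \<tau>" "\<tau> \<le> 1" "0 < C" "open W"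
    "\<And>w. w \<in> W \<Longrightarrow> (q w 0, u w 0) = w"
    "\<And>w. w \<in> W \<Longrightarrow> Ck_on 2 (q w) {-\<tau><..<\<tau>}"
    "\<And>w t. w \<in> W \<Longrightarrow> t \<in> {-\<tau><..<\<tau>} \<Longrightarrow> (q w t, u w t) \<in> B"
    "\<And>w t. w \<in> W \<Longrightarrow> t \<in> {-\<tau><..<\<tau>} \<Longrightarrow> (q w has_vector_derivative u w t) (at t)"
    "\<And>w t. w \<in> W \<Longrightarrow> t \<in> {-\<tau><..<\<tau>} \<Longrightarrow> f (q w t, u w t) = f w"
    "\<And>w t. w \<in> W \<Longrightarrow> t \<in> {-\<tau><..<\<tau>} \<Longrightarrow> EL f (q w) t"
    "\<And>w w' t. w \<in> W \<Longrightarrow> w' \<in> W \<Longrightarrow> t \<in> {-\<tau><..<\<tau>} \<Longrightarrow>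
       norm ((q w' t, u w' t) - (q w t, u w t)) \<le> C * norm (w' - w)"
    unfolding flow_box_def by blast+
next
  fix w x \<sigma> t
  assume "w \<in> W" "0 < \<sigma>" "\<sigma> \<le> \<tau>" "Ck_on 2 x {-\<sigma><..<\<sigma>}" "(x 0, vector_derivative x (at 0)) = w"
    "\<And>t. t \<in> {-\<sigma><..<\<sigma>} \<Longrightarrow> (x t, vector_derivative x (at t)) \<in> B \<and> EL f x t \<and>
          f (x t, vector_derivative x (at t)) = f w" "t \<in> {-\<sigma><..<\<sigma>}"
  moreover have "\<forall>w\<in>W. \<forall>x \<sigma>. 0 < \<sigma> \<longrightarrow> \<sigma> \<le> \<tau> \<longrightarrow> Ck_on 2 x {-\<sigma><..<\<sigma>} \<longrightarrow> (x 0, vector_derivative x (at 0)) = w \<longrightarrow>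
       (\<forall>t\<in>{-\<sigma><..<\<sigma>}. (x t, vector_derivative x (at t)) \<in> B \<and> EL f x t \<and>
          f (x t, vector_derivative x (at t)) = f w) \<longrightarrow>
       (\<forall>t\<in>{-\<sigma><..<\<sigma>}. (x t, vector_derivative x (at t)) = (q w t, u w t))"
    using assms unfolding flow_box_def by (elim conjE)
  ultimately show "(x t, vector_derivative x (at t)) = (q w t, u w t)" by blast
qed

lemma local_flow:
  fixes f :: "'e::euclidean_space \<times> 'e \<Rightarrow> real"
  assumes h: "fibre_homogeneous f \<Omega>" and pos: "\<And>z. z \<in> \<Omega> \<Longrightarrow> f z > 0"
    and conv: "\<And>z e. z \<in> \<Omega> \<Longrightarrow> e \<noteq> 0 \<Longrightarrow> frechet_derivative (\<lambda>z. vder (\<lambda>z. (f z)\<^sup>2) z e) (at z) (0, e) > 0"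
    and z0: "(a, b) \<in> \<Omega>"
  shows "\<exists>B W C \<tau> q u. B \<subseteq> \<Omega> \<and> compact B \<and> convex B \<and> (a, b) \<in> W \<and> W \<subseteq> B \<and> flow_box f B W C \<tau> q u"
proof -
  have o: "open \<Omega>" and C2: "Ck_on 2 f \<Omega>" using h by (auto simp: fibre_homogeneous_def)
  define L where "L = (\<lambda>z. (f z)\<^sup>2)"
  have L: "Ck_on 2 L \<Omega>" unfolding L_def by (rule Ck_on_square[OF o C2])
  obtain R K m where R: "R > 0" "cball a R \<times> cball b R \<subseteq> \<Omega>"
    and reg: "el_region (vgrad L) (\<lambda>z. frechet_derivative (vgrad L) (at z)) (hgrad L) (cball a R \<times> cball b R) K m"
    using el_region_exists[OF o z0 L] conv unfolding L_def by blast
  let ?B = "cball a R \<times> cball b R" and ?W = "cball a (R/2) \<times> cball b (R/2)"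
  note Km = el_regionD(1-3)[OF reg]
  obtain \<tau> where \<tau>: "\<tau> > 0" "\<tau> \<le> 1" "\<tau> \<le> m / (12 * K)"
    and ex: "\<forall>q0\<in>cball a (R/2). \<forall>u0\<in>cball b (R/2). \<exists>q u. q 0 = q0 \<and> u 0 = u0 \<and>
      el_sol (vgrad L) (hgrad L) ?B {-\<tau>..\<tau>} q u"
    using el_sol_exists[OF reg R(1)] by blast
  have "\<forall>w\<in>?W. \<exists>y. fst y 0 = fst w \<and> snd y 0 = snd w \<and> el_sol (vgrad L) (hgrad L) ?B {-\<tau>..\<tau>} (fst y) (snd y)"
    using ex by fastforce
  then obtain y where y: "\<And>w. w \<in> ?W \<Longrightarrow> fst (y w) 0 = fst w \<and> snd (y w) 0 = snd w \<and>
      el_sol (vgrad L) (hgrad L) ?B {-\<tau>..\<tau>} (fst (y w)) (snd (y w))" by metis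
  define q where "q = (\<lambda>w. fst (y w))"
  define u where "u = (\<lambda>w. snd (y w))"
  have init: "(q w 0, u w 0) = w" and sol: "el_sol (vgrad L) (hgrad L) ?B {-\<tau>..\<tau>} (q w) (u w)" if "w \<in> ?W" for w
    using y[OF that] by (auto simp: q_def u_def prod_eq_iff)
  have inB: "(q w t, u w t) \<in> ?B" if "w \<in> ?W" "t \<in> {-\<tau>..\<tau>}" for w t
    using sol[OF that(1)] that(2) by (auto simp: el_sol_def)
  have cs: "Ck_on 2 (q w) {-\<tau><..<\<tau>}"
    "\<And>t. t \<in> {-\<tau><..<\<tau>} \<Longrightarrow> (q w has_vector_derivative u w t) (at t)"
    "\<And>t. t \<in> {-\<tau><..<\<tau>} \<Longrightarrow> f (q w t, u w t) = f (q w 0, u w 0)"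
    "\<And>t. t \<in> {-\<tau><..<\<tau>} \<Longrightarrow> EL f (q w) t" if w: "w \<in> ?W" for w
    by (rule el_sol_constant_speed[OF h R(2) _ reg[unfolded L_def] sol[OF w, unfolded L_def] \<tau>(1)], erule pos, assumption?)+
  have stab: "norm ((x t, v t) - (x' t, v' t)) \<le> (1 + 12 * K / m) * (norm (x 0 - x' 0) + norm (v 0 - v' 0))"
    if "0 < \<sigma>" "\<sigma> \<le> \<tau>" "el_sol (vgrad L) (hgrad L) ?B {-\<sigma>..\<sigma>} x v" "el_sol (vgrad L) (hgrad L) ?B {-\<sigma>..\<sigma>} x' v'"
      "t \<in> {-\<sigma>..\<sigma>}" for x v x' v' \<sigma> t
  proof -
    have "(x t, v' t) \<in> ?B" if "t \<in> {-\<sigma>..\<sigma>}" for t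
    proof -
      have "(x t, v t) \<in> ?B" "(x' t, v' t) \<in> ?B"
        using that \<open>el_sol (vgrad L) (hgrad L) ?B {-\<sigma>..\<sigma>} x v\<close> \<open>el_sol (vgrad L) (hgrad L) ?B {-\<sigma>..\<sigma>} x' v'\<close>
        unfolding el_sol_def by blast+
      then show ?thesis by blast
    qed
    from el_sol_stability[OF reg that(3,4) that(1) _ _ this that(5)] that(2) \<tau>
    have "norm (x t - x' t) + norm (v t - v' t) \<le> (1 + 12 * K / m) * (norm (x 0 - x' 0) + norm (v 0 - v' 0))"
      by simp
    then show ?thesis using norm_Pair_le[of "x t - x' t" "v t - v' t"] by simp
  qed
  define C where "C = 2 * (1 + 12 * K / m)"
  have C: "C > 0" using Km by (simp add: C_def add_pos_nonneg)
  have lip: "norm ((q w' t, u w' t) - (q w t, u w t)) \<le> C * norm (w' - w)"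
    if "w \<in> ?W" "w' \<in> ?W" "t \<in> {-\<tau><..<\<tau>}" for w w' t
  proof -
    have "norm ((q w' t, u w' t) - (q w t, u w t)) \<le> (1 + 12 * K / m) * (norm (q w' 0 - q w 0) + norm (u w' 0 - u w 0))"
      using that(3) by (intro stab[OF \<tau>(1) order_refl sol[OF that(2)] sol[OF that(1)]]) auto
    also have "\<dots> \<le> (1 + 12 * K / m) * (norm (w' - w) + norm (w' - w))"
    proof (intro mult_left_mono add_mono)
      have e: "q w 0 = fst w" "u w 0 = snd w" "q w' 0 = fst w'" "u w' 0 = snd w'"
        using init[OF that(1)] init[OF that(2)] by (metis fst_conv snd_conv)+
      show "norm (q w' 0 - q w 0) \<le> norm (w' - w)"
        using norm_fst_le[of "fst w' - fst w" "snd w' - snd w"] by (simp add: e minus_prod_def)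
      show "norm (u w' 0 - u w 0) \<le> norm (w' - w)"
        using norm_snd_le[of "snd w' - snd w" "fst w' - fst w"] by (simp add: e minus_prod_def)
    qed (use Km in simp)
    also have "\<dots> = C * norm (w' - w)" by (simp add: C_def algebra_simps)
    finally show ?thesis .
  qed
  have uniq: "(x t, vector_derivative x (at t)) = (q w t, u w t)"
    if w: "w \<in> ?W" and \<sigma>: "0 < \<sigma>" "\<sigma> \<le> \<tau>" and x: "Ck_on 2 x {-\<sigma><..<\<sigma>}" "(x 0, vector_derivative x (at 0)) = w"
      and xt: "\<And>t. t \<in> {-\<sigma><..<\<sigma>} \<Longrightarrow> (x t, vector_derivative x (at t)) \<in> ?B \<and> EL f x t \<and> f (x t, vector_derivative x (at t)) = f w"
      and t: "t \<in> {-\<sigma><..<\<sigma>}" for w \<sigma> x t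
  proof -
    have "\<bar>t\<bar> < \<sigma>" using t by auto
    then obtain s where s: "\<bar>t\<bar> < s" "s < \<sigma>" using dense by blast
    have "el_sol (vgrad L) (hgrad L) ?B {-s..s} x (\<lambda>t. vector_derivative x (at t))"
      unfolding L_def
      by (rule EL_imp_el_sol[OF C2 R(2) _ _ x(1), where k = "f w"]) (use xt s in auto)
    moreover have "el_sol (vgrad L) (hgrad L) ?B {-s..s} (q w) (u w)"
      using s \<sigma> by (intro el_sol_subset[OF sol[OF w]]) auto
    ultimately have "norm ((x t, vector_derivative x (at t)) - (q w t, u w t)) \<le>
        (1 + 12 * K / m) * (norm (x 0 - q w 0) + norm (vector_derivative x (at 0) - u w 0))"
      by (intro stab[of s x "\<lambda>t. vector_derivative x (at t)"]) (use s \<sigma> in auto)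
    also have "\<dots> = 0" using x(2) init[OF w] by (metis add.right_neutral diff_self mult_zero_right norm_zero prod.inject)
    finally show ?thesis by (simp add: zero_prod_def)
  qed
  have pt: "(q w 0, u w 0) = w \<and> Ck_on 2 (q w) {-\<tau><..<\<tau>} \<and>
      (\<forall>t\<in>{-\<tau><..<\<tau>}. (q w t, u w t) \<in> ?B \<and> (q w has_vector_derivative u w t) (at t) \<and>
         f (q w t, u w t) = f w \<and> EL f (q w) t)" if w: "w \<in> ?W" for w
  proof (intro conjI ballI)
    fix t assume t: "t \<in> {-\<tau><..<\<tau>}"
    show "(q w t, u w t) \<in> ?B" using t by (intro inB[OF w]) auto
    show "(q w has_vector_derivative u w t) (at t)" "EL f (q w) t" using cs(2,4)[OF w t] by auto
    show "f (q w t, u w t) = f w" using cs(3)[OF w t] init[OF w] by simp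
  qed (use init[OF w] cs(1)[OF w] in auto)
  define W where "W = ball a (R/2) \<times> ball b (R/2)"
  have W: "open W" "W \<subseteq> ?W" "(a, b) \<in> W" unfolding W_def using R(1) by (auto intro: open_Times)
  have "W \<subseteq> ?B" using W(2) R(1) by auto
  moreover have "flow_box f ?B W C \<tau> q u"
    unfolding flow_box_def
  proof (intro conjI \<tau>(1,2) C W(1))
    show "\<forall>w\<in>W. \<forall>x \<sigma>. 0 < \<sigma> \<longrightarrow> \<sigma> \<le> \<tau> \<longrightarrow> Ck_on 2 x {-\<sigma><..<\<sigma>} \<longrightarrow> (x 0, vector_derivative x (at 0)) = w \<longrightarrow>
       (\<forall>t\<in>{-\<sigma><..<\<sigma>}. (x t, vector_derivative x (at t)) \<in> ?B \<and> EL f x t \<and>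
          f (x t, vector_derivative x (at t)) = f w) \<longrightarrow>
       (\<forall>t\<in>{-\<sigma><..<\<sigma>}. (x t, vector_derivative x (at t)) = (q w t, u w t))"
      using uniq W(2) by blast
  qed (use pt lip W(2) in blast)+
  moreover have "compact ?B" "convex ?B" by (auto intro: compact_Times convex_Times)
  ultimately show ?thesis using R(2) W(3) by blast
qed

text \<open>The quantity \<open>D w' t\<close> is the error of the first variation formula between the extremals of \<open>w\<close> and
  \<open>w'\<close>. By the Euler-Lagrange equation its time derivative is the error of a first-order Taylor
  expansion of \<open>f\<close>, hence quadratic in the distance of the two extremals, and by \<open>lip\<close> quadratic in
  \<open>w' - w\<close>. Only the boundary terms contribute to the derivative, and the one at time \<open>T\<close> cancels against
  the derivative of \<open>S0\<close>.\<close>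

lemma transport_primitive:
  fixes f :: "'e::euclidean_space \<times> 'e \<Rightarrow> real" and q u :: "'e \<times> 'e \<Rightarrow> real \<Rightarrow> 'e"
  assumes C2: "Ck_on 2 f \<Omega>" and o: "open \<Omega>" and B: "B \<subseteq> \<Omega>" "compact B" "convex B"
    and W: "open W" and \<tau>: "0 < \<tau>" "\<tau> \<le> 1" and C: "C > 0"
    and q0: "\<And>w. w \<in> W \<Longrightarrow> (q w 0, u w 0) = w"
    and inB: "\<And>w t. w \<in> W \<Longrightarrow> t \<in> {-\<tau><..<\<tau>} \<Longrightarrow> (q w t, u w t) \<in> B"
    and dq: "\<And>w t. w \<in> W \<Longrightarrow> t \<in> {-\<tau><..<\<tau>} \<Longrightarrow> (q w has_vector_derivative u w t) (at t)"
    and EL: "\<And>w t. w \<in> W \<Longrightarrow> t \<in> {-\<tau><..<\<tau>} \<Longrightarrow>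
      ((\<lambda>t. vgrad f (q w t, u w t)) has_vector_derivative hgrad f (q w t, u w t)) (at t)"
    and lip: "\<And>w w' t. w \<in> W \<Longrightarrow> w' \<in> W \<Longrightarrow> t \<in> {-\<tau><..<\<tau>} \<Longrightarrow>
      norm ((q w' t, u w' t) - (q w t, u w t)) \<le> C * norm (w' - w)"
    and G: "\<And>w t. w \<in> W \<Longrightarrow> t \<in> {-\<tau><..<\<tau>} \<Longrightarrow> (G w has_vector_derivative f (q w t, u w t)) (at t)"
    and G0: "\<And>w. w \<in> W \<Longrightarrow> G w 0 = 0"
    and T: "T \<in> {-\<tau><..<\<tau>}" and w: "w \<in> W"
    and S0: "(S0 has_derivative (\<lambda>e. vgrad f (q w T, u w T) \<bullet> e)) (at (q w T))"
  shows "((\<lambda>w. S0 (q w T) - G w T) has_derivative (\<lambda>\<zeta>. vgrad f w \<bullet> fst \<zeta>)) (at w)"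
proof -
  obtain K where K: "K > 0" "\<forall>z\<in>B. \<forall>z'\<in>B. \<bar>f z' - f z - (hgrad f z \<bullet> (fst z' - fst z) + vgrad f z \<bullet> (snd z' - snd z))\<bar>
    \<le> K * (norm (z' - z))\<^sup>2"
    using quadratic_remainder[OF C2 o B] by blast
  let ?I = "{-\<tau><..<\<tau>}"
  have I0: "0 \<in> ?I" using \<tau> by simp
  let ?X = "\<lambda>w t. (q w t, u w t)"
  define D where "D = (\<lambda>w' t. G w' t - G w t - vgrad f (?X w t) \<bullet> (q w' t - q w t))"
  have Dbound: "\<bar>D w' T - D w' 0\<bar> \<le> K * C\<^sup>2 * (norm (w' - w))\<^sup>2" if w': "w' \<in> W" for w'
  proof -
    have "norm (D w' T - D w' 0) \<le> K * C\<^sup>2 * (norm (w' - w))\<^sup>2 * \<bar>T - 0\<bar>"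
    proof (rule has_vector_derivative_bound[where J = ?I])
      fix t assume t: "t \<in> ?I"
      have "(D w' has_vector_derivative
          f (?X w' t) - f (?X w t) - (vgrad f (?X w t) \<bullet> (u w' t - u w t) + hgrad f (?X w t) \<bullet> (q w' t - q w t))) (at t)"
        unfolding D_def
        by (intro has_vector_derivative_diff G[OF w' t] G[OF w t]
          bounded_bilinear.has_vector_derivative[OF bounded_bilinear_inner] EL[OF w t] dq[OF w' t] dq[OF w t])
      then show "(D w' has_vector_derivative
          f (?X w' t) - f (?X w t) - (vgrad f (?X w t) \<bullet> (u w' t - u w t) + hgrad f (?X w t) \<bullet> (q w' t - q w t))) (at t within ?I)"
        by (rule has_vector_derivative_at_within)
      have "\<bar>f (?X w' t) - f (?X w t) - (hgrad f (?X w t) \<bullet> (q w' t - q w t) + vgrad f (?X w t) \<bullet> (u w' t - u w t))\<bar>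
        \<le> K * (norm (?X w' t - ?X w t))\<^sup>2"
        using K(2) inB[OF w t] inB[OF w' t] by (metis fst_conv snd_conv)
      also have "\<dots> \<le> K * (C * norm (w' - w))\<^sup>2"
        using K(1) by (intro mult_left_mono power_mono lip[OF w w' t]) auto
      finally show "norm (f (?X w' t) - f (?X w t) - (vgrad f (?X w t) \<bullet> (u w' t - u w t) + hgrad f (?X w t) \<bullet> (q w' t - q w t)))
        \<le> K * C\<^sup>2 * (norm (w' - w))\<^sup>2"
        by (simp add: power_mult_distrib add.commute mult.assoc)
    qed (use T I0 in auto)
    also have "\<dots> \<le> K * C\<^sup>2 * (norm (w' - w))\<^sup>2 * 1"
      using T \<tau> K(1) by (intro mult_left_mono) auto
    finally show ?thesis by simp
  qed
  have w00: "?X w 0 = w" by (rule q0[OF w])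
  have D0: "D w' 0 = - (vgrad f w \<bullet> (fst w' - fst w))" if w': "w' \<in> W" for w'
  proof -
    have "q w' 0 = fst w'" "q w 0 = fst w" "u w 0 = snd w" using q0[OF w'] q0[OF w] by (metis fst_conv snd_conv)+
    then show ?thesis using G0[OF w] G0[OF w'] by (simp add: D_def w00)
  qed
  show ?thesis
    unfolding has_derivative_within_alt
  proof (intro conjI allI impI)
    show "bounded_linear (\<lambda>\<zeta>. vgrad f w \<bullet> fst \<zeta>)"
      by (rule bounded_linear_compose[OF bounded_linear_inner_right bounded_linear_fst])
    fix e :: real assume e: "e > 0"
    define e1 where "e1 = e / (2 * C)"
    have e1: "e1 > 0" using e C by (simp add: e1_def)
    obtain d1 where d1: "d1 > 0" "\<And>y. norm (y - q w T) < d1 \<Longrightarrow>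
        norm (S0 y - S0 (q w T) - vgrad f (?X w T) \<bullet> (y - q w T)) \<le> e1 * norm (y - q w T)"
      using has_derivative_norm_bound[OF S0 e1] by auto
    obtain r where r: "r > 0" "ball w r \<subseteq> W" using W w by (meson openE)
    define d where "d = min r (min (d1 / C) (e / (2 * (K * C\<^sup>2))))"
    have d: "d > 0" using r d1 e K C by (simp add: d_def)
    have "norm ((S0 (q w' T) - G w' T) - (S0 (q w T) - G w T) - vgrad f w \<bullet> fst (w' - w)) \<le> e * norm (w' - w)"
      if w'd: "norm (w' - w) < d" for w'
    proof -
      have w': "w' \<in> W" using r(2) w'd by (auto simp: d_def dist_norm norm_minus_commute subset_eq)
      have qC: "norm (q w' T - q w T) \<le> C * norm (w' - w)"
        using lip[OF w w' T] norm_fst_le[of "q w' T - q w T" "u w' T - u w T"] by simp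
      also have "\<dots> < d1" using w'd C by (simp add: d_def field_simps)
      finally have "norm (S0 (q w' T) - S0 (q w T) - vgrad f (?X w T) \<bullet> (q w' T - q w T)) \<le> e1 * norm (q w' T - q w T)"
        by (rule d1(2))
      also have "\<dots> \<le> e1 * (C * norm (w' - w))" using qC e1 by (intro mult_left_mono) auto
      also have "\<dots> = e / 2 * norm (w' - w)" using C by (simp add: e1_def)
      finally have s1: "\<bar>S0 (q w' T) - S0 (q w T) - vgrad f (?X w T) \<bullet> (q w' T - q w T)\<bar> \<le> e / 2 * norm (w' - w)" by simp
      have "K * C\<^sup>2 * (norm (w' - w))\<^sup>2 = (K * C\<^sup>2 * norm (w' - w)) * norm (w' - w)" by (simp add: power2_eq_square)
      also have "\<dots> \<le> e / 2 * norm (w' - w)"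
      proof (rule mult_right_mono)
        have KC: "K * C\<^sup>2 > 0" using K C by simp
        have "norm (w' - w) \<le> e / (2 * (K * C\<^sup>2))" using w'd by (simp add: d_def)
        then show "K * C\<^sup>2 * norm (w' - w) \<le> e / 2" using KC by (simp add: field_simps)
      qed simp
      finally have s2: "\<bar>D w' T - D w' 0\<bar> \<le> e / 2 * norm (w' - w)" using Dbound[OF w'] by linarith
      have eq: "(S0 (q w' T) - G w' T) - (S0 (q w T) - G w T) - vgrad f w \<bullet> fst (w' - w)
        = (S0 (q w' T) - S0 (q w T) - vgrad f (?X w T) \<bullet> (q w' T - q w T)) - (D w' T - D w' 0)"
        by (simp add: D0[OF w']) (simp add: D_def)
      show ?thesis
        unfolding eq real_norm_def
        using order_trans[OF abs_triangle_ineq4 add_mono[OF s1 s2]] by simp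
    qed
    then show "\<exists>d>0. \<forall>w'\<in>UNIV. norm (w' - w) < d \<longrightarrow>
        norm ((S0 (q w' T) - G w' T) - (S0 (q w T) - G w T) - vgrad f w \<bullet> fst (w' - w)) \<le> e * norm (w' - w)"
      using d by blast
  qed
qed

lemma EL_vgrad:
  assumes EL: "EL f x t" and I: "open I" "t \<in> I" and dx: "\<And>s. s \<in> I \<Longrightarrow> (x has_vector_derivative v s) (at s)"
    and d: "\<And>s. s \<in> I \<Longrightarrow> f differentiable (at (x s, v s))"
  shows "((\<lambda>t. vgrad f (x t, v t)) has_vector_derivative hgrad f (x t, v t)) (at t)"
proof (rule has_vector_derivative_inner_iff[THEN iffD2], rule)
  fix e
  have "((\<lambda>r. vder f (x r, vector_derivative x (at r)) e) has_vector_derivative hder f (x t, v t) e) (at t)"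
    using EL vector_derivative_at[OF dx[OF I(2)]] by (simp add: EL_def has_real_derivative_iff_has_vector_derivative)
  then have "((\<lambda>t. vgrad f (x t, v t) \<bullet> e) has_vector_derivative hder f (x t, v t) e) (at t)"
    by (rule has_vector_derivative_transform_within_open[OF _ I])
      (simp add: vgrad_inner[OF d] vector_derivative_at[OF dx])
  then show "((\<lambda>t. vgrad f (x t, v t) \<bullet> e) has_vector_derivative hgrad f (x t, v t) \<bullet> e) (at t)"
    by (simp add: hgrad_inner[OF d[OF I(2)]])
qed

text \<open>Near \<open>t0\<close> the curve \<open>\<gamma>\<close> runs inside one flow box of \<open>f1\<close>, by uniqueness. The extremals
  starting near \<open>(\<gamma> t, \<gamma>' t)\<close> reach, after the time \<open>s - t\<close> of either sign, the set where a primitive is given, and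
  \<open>compat\<close> makes them extremals of the difference of the two functions, so that the primitive can be transported
  to time \<open>t\<close>.\<close>

lemma locally_exact_propagates:
  fixes f1 f2 :: "'e::euclidean_space \<times> 'e \<Rightarrow> real"
  assumes h1: "fibre_homogeneous f1 \<Omega>" and h2: "fibre_homogeneous f2 \<Omega>" and pos: "\<And>z. z \<in> \<Omega> \<Longrightarrow> f1 z > 0"
    and conv: "\<And>z e. z \<in> \<Omega> \<Longrightarrow> e \<noteq> 0 \<Longrightarrow> frechet_derivative (\<lambda>z. vder (\<lambda>z. (f1 z)\<^sup>2) z e) (at z) (0, e) > 0"
    and compat: "\<And>x \<tau> t. 0 < \<tau> \<Longrightarrow> Ck_on 2 x {-\<tau><..<\<tau>} \<Longrightarrow>
       (\<And>t. t \<in> {-\<tau><..<\<tau>} \<Longrightarrow> (x t, vector_derivative x (at t)) \<in> \<Omega> \<and> EL f1 x t \<and>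
          f1 (x t, vector_derivative x (at t)) = f1 (x 0, vector_derivative x (at 0))) \<Longrightarrow>
       t \<in> {-\<tau><..<\<tau>} \<Longrightarrow> EL f2 x t"
    and \<gamma>: "Ck_on 2 \<gamma> I" "open I" "t0 \<in> I"
    and \<gamma>t: "\<And>t. t \<in> I \<Longrightarrow> (\<gamma> t, vector_derivative \<gamma> (at t)) \<in> \<Omega>" "\<And>t. t \<in> I \<Longrightarrow> EL f1 \<gamma> t"
      "\<And>t. t \<in> I \<Longrightarrow> f1 (\<gamma> t, vector_derivative \<gamma> (at t)) = k"
  shows "\<exists>\<delta>>0. \<forall>s\<in>ball t0 \<delta>. \<forall>t\<in>ball t0 \<delta>.
    locally_exact (\<lambda>z. f2 z - f1 z) (\<gamma> s, vector_derivative \<gamma> (at s)) \<longrightarrow>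
    locally_exact (\<lambda>z. f2 z - f1 z) (\<gamma> t, vector_derivative \<gamma> (at t))"
proof -
  define a where "a = \<gamma> t0"
  define v where "v = (\<lambda>t. vector_derivative \<gamma> (at t))"
  define b where "b = v t0"
  define f where "f = (\<lambda>z. f2 z - f1 z)"
  have hf: "fibre_homogeneous f \<Omega>" unfolding f_def by (rule fibre_homogeneous_diff[OF h2 h1])
  have o: "open \<Omega>" and C2: "Ck_on 2 f \<Omega>" using hf by (auto simp: fibre_homogeneous_def)
  have C21: "Ck_on 2 f1 \<Omega>" and C22: "Ck_on 2 f2 \<Omega>" using h1 h2 by (auto simp: fibre_homogeneous_def)
  have "(a, b) \<in> \<Omega>" using \<gamma>t(1)[OF \<gamma>(3)] by (simp add: a_def b_def v_def)
  from local_flow[OF h1 pos conv this]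
  obtain B W C \<tau> q u where B: "B \<subseteq> \<Omega>" "compact B" "convex B" and W: "(a, b) \<in> W" "W \<subseteq> B"
    and fl: "flow_box f1 B W C \<tau> q u" by blast
  note fD = flow_boxD[OF fl]
  let ?I = "{-\<tau><..<\<tau>}"
  have I0: "0 \<in> ?I" using fD(1) by simp
  have oI: "open ?I" by simp
  have vdq: "vector_derivative (q w) (at t) = u w t" if "w \<in> W" "t \<in> ?I" for w t
    using fD(8)[OF that] by (rule vector_derivative_at)
  have in\<Omega>: "(q w t, u w t) \<in> \<Omega>" if "w \<in> W" "t \<in> ?I" for w t
    using fD(7)[OF that] B(1) by blast
  have dif: "f differentiable (at z)" "f1 differentiable (at z)" "f2 differentiable (at z)" if "z \<in> \<Omega>" for z
    using that Ck_on_2_differentiable[OF C2] Ck_on_2_differentiable[OF C21] Ck_on_2_differentiable[OF C22] by auto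
  have ELf: "EL f (q w) t" if w: "w \<in> W" and t: "t \<in> ?I" for w t
    unfolding f_def
  proof (rule EL_diff[OF _ fD(10)[OF w t] oI t])
    show "EL f2 (q w) t"
    proof (rule compat[OF fD(1) fD(6)[OF w] _ t])
      fix s assume s: "s \<in> ?I"
      show "(q w s, vector_derivative (q w) (at s)) \<in> \<Omega> \<and> EL f1 (q w) s \<and>
          f1 (q w s, vector_derivative (q w) (at s)) = f1 (q w 0, vector_derivative (q w) (at 0))"
        unfolding vdq[OF w s] vdq[OF w I0]
        using in\<Omega>[OF w s] fD(9)[OF w s] fD(9)[OF w I0] fD(10)[OF w s] by simp
    qed
    show "f2 differentiable (at (q w s, vector_derivative (q w) (at s)))" "f1 differentiable (at (q w s, vector_derivative (q w) (at s)))"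
      if "s \<in> ?I" for s unfolding vdq[OF w that] using dif in\<Omega>[OF w that] by auto
  qed
  have ELv: "((\<lambda>t. vgrad f (q w t, u w t)) has_vector_derivative hgrad f (q w t, u w t)) (at t)" if w: "w \<in> W" and t: "t \<in> ?I" for w t
    by (rule EL_vgrad[OF ELf[OF w t] oI t fD(8)[OF w] dif(1)[OF in\<Omega>[OF w]]])
  \<comment> \<open>Halving the time makes \<open>f\<close> along each extremal continuous on a compact interval, so that it has a primitive.\<close>
  define \<tau>' where "\<tau>' = \<tau> / 2"
  let ?I' = "{-\<tau>'<..<\<tau>'}"
  have \<tau>': "0 < \<tau>'" "\<tau>' \<le> 1" "\<tau>' \<le> \<tau>" using fD(1,2) by (auto simp: \<tau>'_def)
  have II: "t \<in> ?I" if "t \<in> ?I'" for t using that \<tau>'(3) by auto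
  define G where "G = (\<lambda>w. signed_integral \<tau>' (\<lambda>t. f (q w t, u w t)))"
  have cX: "continuous_on ?I (\<lambda>t. f (q w t, u w t))" if w: "w \<in> W" for w
  proof -
    have q2: "Ck_on (Suc 1) (q w) ?I" using fD(6)[OF w] by (simp add: numeral_2_eq_2)
    have "continuous_on ?I (\<lambda>t. vector_derivative (q w) (at t))"
      by (rule Ck_on_imp_continuous_on[OF Ck_on_real_SucD(2)[OF q2 oI]])
    then have "continuous_on ?I (u w)" by (rule continuous_on_eq) (rule vdq[OF w])
    moreover have "continuous_on ?I (q w)" by (rule Ck_on_imp_continuous_on[OF fD(6)[OF w]])
    ultimately have "continuous_on ?I (\<lambda>t. (q w t, u w t))" by (intro continuous_on_Pair)
    then show ?thesis
      by (rule continuous_on_compose2[OF Ck_on_imp_continuous_on[OF C2]]) (use in\<Omega>[OF w] in auto)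
  qed
  have G: "(G w has_vector_derivative f (q w t, u w t)) (at t)" if w: "w \<in> W" and t: "t \<in> ?I'" for w t
  proof -
    have "continuous_on {-\<tau>'..\<tau>'} (\<lambda>t. f (q w t, u w t))"
      by (rule continuous_on_subset[OF cX[OF w]]) (use fD(1) in \<open>auto simp: \<tau>'_def\<close>)
    then have "(G w has_vector_derivative f (q w t, u w t)) (at t within {-\<tau>'..\<tau>'})"
      unfolding G_def by (rule signed_integral_derivative) (use t in auto)
    moreover have "at t within {-\<tau>'..\<tau>'} = at t" using t by (intro at_within_interior) auto
    ultimately show ?thesis by simp
  qed
  have \<gamma>2: "Ck_on (Suc 1) \<gamma> I" using \<gamma>(1) by (simp add: numeral_2_eq_2)
  have c\<gamma>: "continuous_on I (\<lambda>t. (\<gamma> t, v t))" unfolding v_def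
    by (intro continuous_on_Pair Ck_on_imp_continuous_on[OF \<gamma>(1)] Ck_on_imp_continuous_on[OF Ck_on_real_SucD(2)[OF \<gamma>2 \<gamma>(2)]])
  have "open (I \<inter> (\<lambda>t. (\<gamma> t, v t)) -` W)"
    using continuous_open_preimage[OF c\<gamma> \<gamma>(2) fD(4)] .
  moreover have "t0 \<in> I \<inter> (\<lambda>t. (\<gamma> t, v t)) -` W" using W(1) \<gamma>(3) by (simp add: a_def b_def)
  ultimately obtain \<delta>1 where \<delta>1: "\<delta>1 > 0" "ball t0 \<delta>1 \<subseteq> I \<inter> (\<lambda>t. (\<gamma> t, v t)) -` W" by (meson openE)
  define \<delta>0 where "\<delta>0 = min \<delta>1 \<tau>'"
  have \<delta>0: "\<delta>0 > 0" "\<delta>0 \<le> \<tau>'" using \<delta>1 \<tau>' by (auto simp: \<delta>0_def)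
  have inW: "t \<in> I" "(\<gamma> t, v t) \<in> W" if "\<bar>t - t0\<bar> < \<delta>0" for t
    using \<delta>1(2) that by (auto simp: \<delta>0_def dist_real_def abs_minus_commute subset_eq)
  have "locally_exact f (\<gamma> t, v t)" if st: "s \<in> ball t0 (\<delta>0/4)" "t \<in> ball t0 (\<delta>0/4)" and le: "locally_exact f (\<gamma> s, v s)" for s t
  proof -
    define z where "z = (\<gamma> t, v t)"
    define \<sigma> where "\<sigma> = \<delta>0 / 2"
    define T where "T = s - t"
    let ?J = "{-\<sigma><..<\<sigma>}"
    have \<sigma>: "0 < \<sigma>" "\<sigma> \<le> \<tau>'" "\<sigma> \<le> \<tau>" using \<delta>0 \<tau>' by (auto simp: \<sigma>_def)
    have st': "s < t0 + \<delta>0 / 4" "t0 - \<delta>0 / 4 < s" "t < t0 + \<delta>0 / 4" "t0 - \<delta>0 / 4 < t"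
      using st unfolding mem_ball dist_real_def abs_less_iff by linarith+
    have T: "T \<in> ?J" using st' by (simp add: T_def \<sigma>_def)
    with \<sigma> have T: "T \<in> ?J" "T \<in> ?I'" by auto
    have TI: "T \<in> ?I" by (rule II[OF T(2)])
    have near: "\<bar>t + r - t0\<bar> < \<delta>0" if "r \<in> ?J" for r
      using that st' unfolding abs_less_iff \<sigma>_def by simp
    have tI: "t + r \<in> I" if "r \<in> ?J" for r by (rule inW(1)[OF near[OF that]])
    have zW: "z \<in> W" unfolding z_def using near[of 0] \<sigma>(1) by (intro inW(2)) auto
    define x where "x = (\<lambda>r. \<gamma> (t + r))"
    have x2: "Ck_on 2 x ?J" unfolding x_def by (rule Ck_on_shift[OF \<gamma>(1,2) _ tI]) simp
    have dx: "vector_derivative x (at r) = v (t + r)" if "r \<in> ?J" for r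
    proof (rule vector_derivative_at)
      have "((\<lambda>r. t + r) has_vector_derivative 1) (at r)" by (auto intro!: derivative_eq_intros)
      from vector_diff_chain_at[OF this Ck_on_real_SucD(1)[OF \<gamma>2 \<gamma>(2) tI[OF that]]]
      show "(x has_vector_derivative v (t + r)) (at r)" by (simp add: x_def v_def o_def)
    qed
    have ELx: "EL f1 x r" if r: "r \<in> ?J" for r
    proof -
      have vd: "((\<lambda>r. t + r) has_vector_derivative 1) (at r)" for r by (auto intro!: derivative_eq_intros)
      have "EL f1 (\<gamma> \<circ> (\<lambda>r. t + r)) r"
      proof (rule EL_reparametrize[OF h1 \<gamma>(2) _ r])
        show "Ck_on 1 \<gamma> I" by (rule Ck_on_le[OF \<gamma>2]) simp
        show "Ck_on 1 (\<lambda>r. t + r) ?J" by (intro Ck_on_add Ck_on_const Ck_on_ident) auto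
      qed (use tI \<gamma>t r in \<open>auto simp: vector_derivative_at[OF vd]\<close>)
      then show ?thesis by (simp add: x_def o_def)
    qed
    have x0: "(x 0, vector_derivative x (at 0)) = z" using dx[of 0] \<sigma>(1) by (simp add: x_def z_def)
    have kz: "f1 z = k" using \<gamma>t(3)[OF tI[of 0]] \<sigma>(1) by (simp add: z_def v_def)
    have "(x T, vector_derivative x (at T)) = (q z T, u z T)"
    proof (rule fD(12)[OF zW \<sigma>(1,3) x2 x0 _ T(1)])
      fix r assume r: "r \<in> ?J"
      show "(x r, vector_derivative x (at r)) \<in> B \<and> EL f1 x r \<and> f1 (x r, vector_derivative x (at r)) = f1 z"
        using inW(2)[OF near[OF r]] W(2) ELx[OF r] \<gamma>t(3)[OF tI[OF r]] unfolding dx[OF r] kz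
        by (auto simp: x_def v_def)
    qed
    then have Xs: "(q z T, u z T) = (\<gamma> s, v s)" using dx[OF T(1)] by (simp add: x_def T_def)
    obtain N S0 where N: "open N" "(q z T, u z T) \<in> N"
      and S0: "\<And>q u. (q, u) \<in> N \<Longrightarrow> S0 differentiable (at q) \<and> f (q, u) = frechet_derivative S0 (at q) u"
      using le unfolding locally_exact_def Xs by blast
    obtain r where r: "r > 0" "ball (q z T, u z T) r \<subseteq> N" using N by (meson openE)
    obtain \<rho>1 where \<rho>1: "\<rho>1 > 0" "ball z \<rho>1 \<subseteq> W" using zW fD(4) by (meson openE)
    define \<rho> where "\<rho> = min \<rho>1 (r / C)"
    have \<rho>: "\<rho> > 0" using \<rho>1 r fD(3) by (simp add: \<rho>_def)
    show ?thesis
    proof (fold z_def, rule locally_exactI[OF hf _ \<rho>])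
      show "z \<in> \<Omega>" using zW W(2) B(1) by blast
      fix y assume y: "y \<in> ball z \<rho>"
      have yW: "y \<in> W" using y \<rho>1(2) by (auto simp: \<rho>_def)
      have "norm ((q y T, u y T) - (q z T, u z T)) \<le> C * norm (y - z)" by (rule fD(11)[OF zW yW TI])
      also have "\<dots> < r" using y fD(3) by (simp add: \<rho>_def dist_norm norm_minus_commute field_simps)
      finally have "(q y T, u y T) \<in> ball (q z T, u z T) r"
        unfolding mem_ball dist_norm norm_minus_commute[of "(q z T, u z T)"] .
      then have yN: "(q y T, u y T) \<in> N" using r(2) by blast
      have "(S0 has_derivative (\<lambda>e. vgrad f (q y T, u y T) \<bullet> e)) (at (fst (q y T, u y T)))"
        by (rule exact_gradient[OF N(1) yN dif(1)[OF in\<Omega>[OF yW TI]] S0])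
      then have dS0: "(S0 has_derivative (\<lambda>e. vgrad f (q y T, u y T) \<bullet> e)) (at (q y T))" by simp
      show "((\<lambda>w. S0 (q w T) - G w T) has_derivative (\<lambda>\<zeta>. vgrad f y \<bullet> fst \<zeta>)) (at y)"
      proof (rule transport_primitive[OF C2 o B fD(4) \<tau>'(1,2) fD(3), where u = u])
        show "G w 0 = 0" for w by (simp add: G_def)
      qed (use II fD(5,7,8,11) ELv G T(2) yW dS0 in blast)+
    qed
  qed
  note main = this[unfolded f_def v_def]
  have "\<delta>0 / 4 > 0" using \<delta>0(1) by simp
  then show ?thesis by (intro exI[of _ "\<delta>0 / 4"] conjI ballI impI) (assumption, erule (2) main)
qed

section \<open>Charts and tangent vectors\<close>

locale smooth_manifold =
  fixes A :: "('m::{t2_space,second_countable_topology}, 'e::euclidean_space) chart set"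
  assumes atlas: "smooth_atlas A"
begin

lemma chart_facts:
  assumes "c \<in> A"
  shows "open (chart_dom c)" "open (chart_range c)" "continuous_on (chart_dom c) (chart_map c)"
    "continuous_on (chart_range c) (chart_inv c)"
    "\<And>x. x \<in> chart_dom c \<Longrightarrow> chart_inv c (chart_map c x) = x"
    "\<And>x. x \<in> chart_dom c \<Longrightarrow> chart_map c x \<in> chart_range c"
    "\<And>p. p \<in> chart_range c \<Longrightarrow> chart_map c (chart_inv c p) = p"
    "\<And>p. p \<in> chart_range c \<Longrightarrow> chart_inv c p \<in> chart_dom c"
proof -
  have "is_chart c" using atlas assms by (simp add: smooth_atlas_def)
  then have h: "homeomorphism (chart_dom c) (chart_range c) (chart_map c) (chart_inv c)"
    and o: "open (chart_dom c)" "open (chart_range c)" by (auto simp: is_chart_def)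
  show "open (chart_dom c)" "open (chart_range c)" by fact+
  show "continuous_on (chart_dom c) (chart_map c)" "continuous_on (chart_range c) (chart_inv c)"
    using h by (auto simp: homeomorphism_def)
  show "chart_inv c (chart_map c x) = x" "chart_map c x \<in> chart_range c" if "x \<in> chart_dom c" for x
    using h that by (auto simp: homeomorphism_def)
  show "chart_map c (chart_inv c p) = p" "chart_inv c p \<in> chart_dom c" if "p \<in> chart_range c" for p
    using h that by (auto simp: homeomorphism_def)
qed

lemma ex_chart: "\<exists>c\<in>A. x \<in> chart_dom c"
  using atlas by (auto simp: smooth_atlas_def)

definition overlap :: "('m, 'e) chart \<Rightarrow> ('m, 'e) chart \<Rightarrow> 'e set" where
  "overlap c c' = chart_map c ` (chart_dom c \<inter> chart_dom c')"

lemma overlap_iff: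
  assumes "c \<in> A"
  shows "p \<in> overlap c c' \<longleftrightarrow> p \<in> chart_range c \<and> chart_inv c p \<in> chart_dom c'"
proof
  assume "p \<in> overlap c c'"
  then obtain x where x: "p = chart_map c x" "x \<in> chart_dom c" "x \<in> chart_dom c'" by (auto simp: overlap_def)
  then show "p \<in> chart_range c \<and> chart_inv c p \<in> chart_dom c'"
    using chart_facts(5)[OF assms x(2)] chart_facts(6)[OF assms x(2)] by simp
next
  assume p: "p \<in> chart_range c \<and> chart_inv c p \<in> chart_dom c'"
  then show "p \<in> overlap c c'"
    unfolding overlap_def using chart_facts(7,8)[OF assms, of p] by (intro image_eqI[of _ _ "chart_inv c p"]) auto
qed

lemma open_overlap:
  assumes "c \<in> A" "c' \<in> A"
  shows "open (overlap c c')"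
proof -
  have "overlap c c' = chart_range c \<inter> chart_inv c -` chart_dom c'"
    using overlap_iff[OF assms(1), of _ c'] by auto
  then show ?thesis
    using continuous_open_preimage[OF chart_facts(4,2)[OF assms(1)] chart_facts(1)[OF assms(2)]] by simp
qed

lemma Ck_on_transition: "c \<in> A \<Longrightarrow> c' \<in> A \<Longrightarrow> Ck_on k (transition c c') (overlap c c')"
  using atlas by (auto simp: smooth_atlas_def overlap_def)

lemma transition_derivative:
  assumes "c \<in> A" "c' \<in> A" "p \<in> overlap c c'"
  shows "(transition c c' has_derivative frechet_derivative (transition c c') (at p)) (at p)"
  using Ck_on_SucD(1)[OF Ck_on_transition[OF assms(1,2)] assms(3)] .

lemma transition_in_range:
  assumes "c \<in> A" "c' \<in> A" "p \<in> overlap c c'"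
  shows "transition c c' p \<in> chart_range c'"
  using overlap_iff[OF assms(1), of _ c'] assms chart_facts(6)[OF assms(2)] by (auto simp: transition_def)

text \<open>The cocycle property of the transition maps, on which this rests, is contained in
  \<open>chart_vec_in_tangent_bundle\<close>.\<close>

lemma chart_vec_transition:
  assumes c: "c \<in> A" "c' \<in> A" and p: "p \<in> overlap c c'"
  shows "chart_vec A c (p, u) = chart_vec A c' (transition c c' p, frechet_derivative (transition c c') (at p) u)"
proof -
  obtain x w where xw: "chart_vec A c (p, u) = (x, w)" by (cases "chart_vec A c (p, u)")
  have pr: "p \<in> chart_range c" and xd: "chart_inv c p \<in> chart_dom c'" using overlap_iff[OF c(1), of _ c'] p by auto
  have x: "x = chart_inv c p" using xw by (simp add: chart_vec_def)
  have tp: "transition c c' p = chart_map c' x" by (simp add: transition_def x)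
  have inv: "chart_inv c' (chart_map c' x) = x" using chart_facts(5)[OF c(2)] xd x by simp
  have wc': "w c' = frechet_derivative (transition c c') (at p) u"
    using xw xd c by (auto simp: chart_vec_def)
  have tb: "(x, w) \<in> tangent_bundle A"
    using chart_vec_in_tangent_bundle[OF atlas c(1) pr, of u] xw by simp
  have "w d = (if d \<in> A \<and> x \<in> chart_dom d then frechet_derivative (transition c' d) (at (chart_map c' x)) (w c') else 0)" for d
  proof (cases "d \<in> A \<and> x \<in> chart_dom d")
    case True
    have "\<forall>d\<in>A. \<forall>d'\<in>A. x \<in> chart_dom d \<inter> chart_dom d' \<longrightarrow> w d' = frechet_derivative (transition d d') (at (chart_map d x)) (w d)"
      using tb unfolding tangent_bundle_def by blast
    then have "w d = frechet_derivative (transition c' d) (at (chart_map c' x)) (w c')"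
      using c(2) True xd x by blast
    then show ?thesis by (simp only: True if_True simp_thms)
  next
    case False
    then have "w d = 0" using tb unfolding tangent_bundle_def by blast
    then show ?thesis by (simp only: False if_False)
  qed
  then have "w = (\<lambda>d. if d \<in> A \<and> x \<in> chart_dom d then frechet_derivative (transition c' d) (at (chart_map c' x)) (w c') else 0)"
    by (rule ext)
  then show ?thesis
    unfolding xw unfolding chart_vec_def prod.case tp inv wc' by (rule arg_cong)
qed

lemma open_chart_preimage:
  assumes "open S" "Ck_map A k S f" "c \<in> A"
  shows "open (S \<inter> f -` chart_dom c)"
  using continuous_open_preimage[OF _ assms(1) chart_facts(1)[OF assms(3)]] assms(2) by (auto simp: Ck_map_def)

lemma Ck_on_chart_curve:
  assumes "Ck_map A k S f" "c \<in> A"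
  shows "Ck_on k (chart_map c \<circ> f) (S \<inter> f -` chart_dom c)"
  using assms by (auto simp: Ck_map_def)

lemma Ck_map_local:
  assumes "\<And>t. t \<in> S \<Longrightarrow> \<exists>T. open T \<and> t \<in> T \<and> Ck_map A k T f"
  shows "Ck_map A k S f"
  unfolding Ck_map_def
proof (intro conjI ballI)
  have "isCont f t" if "t \<in> S" for t
    using assms[OF that] by (auto simp: Ck_map_def continuous_on_eq_continuous_at)
  then show "continuous_on S f" by (simp add: continuous_at_imp_continuous_on)
  fix c assume c: "c \<in> A"
  show "Ck_on k (chart_map c \<circ> f) (S \<inter> f -` chart_dom c)"
  proof (rule Ck_on_local)
    fix t assume t: "t \<in> S \<inter> f -` chart_dom c"
    then obtain T where T: "open T" "t \<in> T" "Ck_map A k T f" using assms by blast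
    show "\<exists>T. open T \<and> t \<in> T \<and> Ck_on k (chart_map c \<circ> f) T"
      using open_chart_preimage[OF T(1,3) c] Ck_on_chart_curve[OF T(3) c] t T(2) by blast
  qed
qed

lemma Ck_map_cong:
  assumes "open S" "Ck_map A k S f" "\<And>t. t \<in> S \<Longrightarrow> f t = g t"
  shows "Ck_map A k S g"
  unfolding Ck_map_def
proof (intro conjI ballI)
  show "continuous_on S g" using assms by (metis Ck_map_def continuous_on_cong)
  fix c assume c: "c \<in> A"
  have eq: "S \<inter> g -` chart_dom c = S \<inter> f -` chart_dom c" using assms(3) by auto
  show "Ck_on k (chart_map c \<circ> g) (S \<inter> g -` chart_dom c)"
    unfolding eq
    by (rule Ck_on_cong[OF open_chart_preimage[OF assms(1,2) c] Ck_on_chart_curve[OF assms(2) c]]) (simp add: assms(3))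
qed

lemma Ck_map_chart_inv:
  assumes c: "c \<in> A" and x: "open S" "Ck_on k x S" "x ` S \<subseteq> chart_range c"
  shows "Ck_map A k S (\<lambda>t. chart_inv c (x t))"
  unfolding Ck_map_def
proof (intro conjI ballI)
  have cx: "continuous_on S x" by (rule Ck_on_imp_continuous_on[OF x(2)])
  show cont: "continuous_on S (\<lambda>t. chart_inv c (x t))"
    by (rule continuous_on_compose2[OF chart_facts(4)[OF c] cx x(3)])
  fix c' assume c': "c' \<in> A"
  let ?T = "S \<inter> (\<lambda>t. chart_inv c (x t)) -` chart_dom c'"
  have T: "open ?T" by (rule continuous_open_preimage[OF cont x(1) chart_facts(1)[OF c']])
  have "Ck_on k (\<lambda>t. transition c c' (x t)) ?T"
  proof (rule Ck_on_compose[OF T Ck_on_transition[OF c c'] Ck_on_subset[OF x(2)]])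
    show "x ` ?T \<subseteq> overlap c c'" using x(3) overlap_iff[OF c, of _ c'] by auto
  qed auto
  then show "Ck_on k (chart_map c' \<circ> (\<lambda>t. chart_inv c (x t))) ?T" by (simp add: transition_def o_def)
qed

lemma Ck_map_compose:
  fixes \<phi> :: "'p::euclidean_space \<Rightarrow> 'q::euclidean_space"
  assumes f: "Ck_map A k T f" and T: "open T" and S: "open S" and \<phi>: "Ck_on k \<phi> S" "\<phi> ` S \<subseteq> T"
  shows "Ck_map A k S (\<lambda>t. f (\<phi> t))"
  unfolding Ck_map_def
proof (intro conjI ballI)
  show cont: "continuous_on S (\<lambda>t. f (\<phi> t))"
    using f Ck_on_imp_continuous_on[OF \<phi>(1)] \<phi>(2) by (auto simp: Ck_map_def intro: continuous_on_compose2)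
  fix c assume c: "c \<in> A"
  have "Ck_on k (\<lambda>t. (chart_map c \<circ> f) (\<phi> t)) (S \<inter> (\<lambda>t. f (\<phi> t)) -` chart_dom c)"
  proof (rule Ck_on_compose[OF _ Ck_on_chart_curve[OF f c] Ck_on_subset[OF \<phi>(1)]])
    show "open (S \<inter> (\<lambda>t. f (\<phi> t)) -` chart_dom c)"
      by (rule continuous_open_preimage[OF cont S chart_facts(1)[OF c]])
  qed (use \<phi>(2) in auto)
  then show "Ck_on k (chart_map c \<circ> (\<lambda>t. f (\<phi> t))) (S \<inter> (\<lambda>t. f (\<phi> t)) -` chart_dom c)" by (simp add: o_def)
qed

lemma chart_curve_derivative:
  assumes I: "open I" and \<gamma>: "Ck_map A 2 I \<gamma>" and t: "t \<in> I" and c: "c \<in> A" "\<gamma> t \<in> chart_dom c"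
  shows "((chart_map c \<circ> \<gamma>) has_vector_derivative vector_derivative (chart_map c \<circ> \<gamma>) (at t)) (at t)"
proof -
  have "Ck_on (Suc (Suc 0)) (chart_map c \<circ> \<gamma>) (I \<inter> \<gamma> -` chart_dom c)"
    using Ck_on_chart_curve[OF \<gamma> c(1)] by (simp only: numeral_2_eq_2)
  from Ck_on_real_SucD(1)[OF this open_chart_preimage[OF I \<gamma> c(1)]] show ?thesis using t c(2) by blast
qed

lemma velocity_coordinates:
  assumes I: "open I" and \<gamma>: "Ck_map A 2 I \<gamma>" and t: "t \<in> I" and c: "c \<in> A" "\<gamma> t \<in> chart_dom c"
  shows "velocity A \<gamma> t = chart_vec A c (chart_map c (\<gamma> t), vector_derivative (chart_map c \<circ> \<gamma>) (at t))"
proof -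
  let ?x = "chart_map c \<circ> \<gamma>"
  have inv: "chart_inv c (chart_map c (\<gamma> t)) = \<gamma> t" by (rule chart_facts(5)[OF c])
  have "vector_derivative (chart_map c' \<circ> \<gamma>) (at t) =
      frechet_derivative (transition c c') (at (chart_map c (\<gamma> t))) (vector_derivative ?x (at t))"
    if c': "c' \<in> A" "\<gamma> t \<in> chart_dom c'" for c'
  proof (rule vector_derivative_at)
    have ov: "chart_map c (\<gamma> t) \<in> overlap c c'" using c c' by (auto simp: overlap_def)
    have "((transition c c' \<circ> ?x) has_vector_derivative
        frechet_derivative (transition c c') (at (chart_map c (\<gamma> t))) (vector_derivative ?x (at t))) (at t)"
      using vector_derivative_diff_chain_within[OF chart_curve_derivative[OF I \<gamma> t c] has_derivative_at_withinI]
        transition_derivative[OF c(1) c'(1) ov] by auto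
    then show "((chart_map c' \<circ> \<gamma>) has_vector_derivative
        frechet_derivative (transition c c') (at (chart_map c (\<gamma> t))) (vector_derivative ?x (at t))) (at t)"
    proof (rule has_vector_derivative_transform_within_open[OF _ open_chart_preimage[OF I \<gamma> c(1)]])
      show "t \<in> I \<inter> \<gamma> -` chart_dom c" using t c by auto
      show "(transition c c' \<circ> ?x) s = (chart_map c' \<circ> \<gamma>) s" if "s \<in> I \<inter> \<gamma> -` chart_dom c" for s
        using that chart_facts(5)[OF c(1)] by (simp add: transition_def)
    qed
  qed
  then show ?thesis unfolding velocity_def chart_vec_def prod.case inv by (auto simp: fun_eq_iff)
qed

lemma velocity_nonzero_iff:
  assumes I: "open I" and \<gamma>: "Ck_map A 2 I \<gamma>" and t: "t \<in> I" and c: "c \<in> A" "\<gamma> t \<in> chart_dom c"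
  shows "snd (velocity A \<gamma> t) \<noteq> (\<lambda>_. 0) \<longleftrightarrow> vector_derivative (chart_map c \<circ> \<gamma>) (at t) \<noteq> 0"
proof
  assume "vector_derivative (chart_map c \<circ> \<gamma>) (at t) \<noteq> 0"
  then have "snd (velocity A \<gamma> t) c \<noteq> 0" using c by (simp add: velocity_def)
  then show "snd (velocity A \<gamma> t) \<noteq> (\<lambda>_. 0)" by metis
next
  assume ne: "snd (velocity A \<gamma> t) \<noteq> (\<lambda>_. 0)"
  show "vector_derivative (chart_map c \<circ> \<gamma>) (at t) \<noteq> 0"
  proof
    assume 0: "vector_derivative (chart_map c \<circ> \<gamma>) (at t) = 0"
    have "frechet_derivative (transition c c') (at (chart_map c (\<gamma> t))) 0 = 0" if "c' \<in> A" "\<gamma> t \<in> chart_dom c'" for c'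
    proof -
      have "chart_map c (\<gamma> t) \<in> overlap c c'" using c that by (auto simp: overlap_def)
      from has_derivative_linear[OF transition_derivative[OF c(1) that(1) this]] show ?thesis by (rule linear_0)
    qed
    then have "snd (velocity A \<gamma> t) = (\<lambda>_. 0)"
      unfolding velocity_coordinates[OF I \<gamma> t c] 0 chart_vec_def prod.case chart_facts(5)[OF c]
      by (auto simp: fun_eq_iff)
    then show False using ne by simp
  qed
qed

abbreviation local_rep :: "(('m, 'e) tangent \<Rightarrow> real) \<Rightarrow> ('m, 'e) chart \<Rightarrow> 'e \<times> 'e \<Rightarrow> real" where
  "local_rep F c \<equiv> (\<lambda>z. F (chart_vec A c z))"

abbreviation slit :: "('m, 'e) chart \<Rightarrow> ('e \<times> 'e) set" where
  "slit c \<equiv> chart_range c \<times> - {0}"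

lemma open_slit: "c \<in> A \<Longrightarrow> open (slit c)"
  using chart_facts(2) by (intro open_Times) auto

lemma finsler_local:
  assumes F: "C2_finsler A F" and c: "c \<in> A"
  shows "Ck_on 2 (local_rep F c) (slit c)"
    "\<And>p u s. p \<in> chart_range c \<Longrightarrow> s \<ge> 0 \<Longrightarrow> local_rep F c (p, s *\<^sub>R u) = s * local_rep F c (p, u)"
    "\<And>p. p \<in> chart_range c \<Longrightarrow> local_rep F c (p, 0) = 0"
    "\<And>z. z \<in> slit c \<Longrightarrow> local_rep F c z > 0"
    "fibre_homogeneous (local_rep F c) (slit c)"
    "\<And>z e. z \<in> slit c \<Longrightarrow> e \<noteq> 0 \<Longrightarrow> frechet_derivative (\<lambda>z. vder (\<lambda>z. (local_rep F c z)\<^sup>2) z e) (at z) (0, e) > 0"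
proof -
  show C2: "Ck_on 2 (local_rep F c) (slit c)" using F c by (simp add: C2_finsler_def o_def)
  have M: "minkowski_norm (\<lambda>u. local_rep F c (p, u))" if "p \<in> chart_range c" for p
    using F c that by (simp add: C2_finsler_def)
  then have N: "asymmetric_norm (\<lambda>u. local_rep F c (p, u))" if "p \<in> chart_range c" for p
    using that by (simp add: minkowski_norm_def)
  show hom: "local_rep F c (p, s *\<^sub>R u) = s * local_rep F c (p, u)" if "p \<in> chart_range c" "s \<ge> 0" for p u s
    using N[OF that(1)] that(2) by (simp add: asymmetric_norm_def)
  show zero: "local_rep F c (p, 0) = 0" if "p \<in> chart_range c" for p
    using N[OF that(1)] by (simp add: asymmetric_norm_def)
  show "local_rep F c z > 0" if "z \<in> slit c" for z
  proof -
    obtain p u where z: "z = (p, u)" by (cases z)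
    then have "0 \<le> local_rep F c (p, u)" "local_rep F c (p, u) \<noteq> 0"
      using N[of p] that by (auto simp: asymmetric_norm_def)
    then show ?thesis by (simp add: z)
  qed
  show "fibre_homogeneous (local_rep F c) (slit c)"
    unfolding fibre_homogeneous_def using C2 hom open_slit[OF c] by auto
  let ?L = "\<lambda>z. (local_rep F c z)\<^sup>2"
  have L2: "Ck_on 2 ?L (slit c)" by (rule Ck_on_square[OF open_slit[OF c] C2])
  show "frechet_derivative (\<lambda>z. vder ?L z e) (at z) (0, e) > 0" if z: "z \<in> slit c" and e: "e \<noteq> 0" for z e
  proof -
    obtain q w where qw: "z = (q, w)" by (cases z)
    have q: "q \<in> chart_range c" and w: "w \<noteq> 0" using z qw by auto
    have o0: "open (- {0::'e})" by auto
    have d1: "frechet_derivative (\<lambda>v. ?L (q, v)) (at y) e = vder ?L (q, y) e" if "y \<noteq> 0" for y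
    proof -
      have "(q, y) \<in> slit c" using q that by auto
      note d = hder_vder_derivative[OF Ck_on_2_differentiable[OF L2 this]]
      have l: "((\<lambda>v. (q, v)) has_derivative (\<lambda>v. (0, v))) (at y)" by (auto intro!: derivative_eq_intros)
      from frechet_derivative_at[OF has_derivative_compose[OF l d]]
      show ?thesis using linear_0[OF linear_hder[OF Ck_on_2_differentiable[OF L2 \<open>(q, y) \<in> slit c\<close>]]]
        by (metis (no_types, lifting) add_0 fst_conv snd_conv)
    qed
    have "hessian (\<lambda>v. ?L (q, v)) w e e = frechet_derivative (\<lambda>y. vder ?L (q, y) e) (at w) e"
      unfolding hessian_def
      by (rule fun_cong[OF frechet_derivative_cong_open[OF o0]]) (use w d1 in auto)
    also have "\<dots> = frechet_derivative (\<lambda>z. vder ?L z e) (at (q, w)) (0, e)"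
    proof -
      have C1: "Ck_on (Suc 0) (\<lambda>z. vder ?L z e) (slit c)" using Ck_on_vder[OF L2] by simp
      have l: "((\<lambda>v. (q, v)) has_derivative (\<lambda>v. (0, v))) (at w)" by (auto intro!: derivative_eq_intros)
      have "((\<lambda>z. vder ?L z e) has_derivative frechet_derivative (\<lambda>z. vder ?L z e) (at (q, w))) (at (q, w))"
        by (rule Ck_on_SucD(1)[OF C1]) (use q w in auto)
      from frechet_derivative_at[OF has_derivative_compose[OF l this]] show ?thesis by metis
    qed
    finally have eq: "hessian (\<lambda>v. ?L (q, v)) w e e = frechet_derivative (\<lambda>z. vder ?L z e) (at (q, w)) (0, e)" .
    have "hessian (\<lambda>v. ?L (q, v)) w e e > 0"
      using M[OF q] w e unfolding minkowski_norm_def by blast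
    then show ?thesis unfolding qw eq .
  qed
qed

end

section \<open>The first variation of length\<close>

context smooth_manifold
begin

lemma variation_slice:
  fixes \<Gamma> :: "real \<times> real \<Rightarrow> 'm"
  assumes \<Gamma>: "Ck_map A 2 ({-\<epsilon><..<\<epsilon>} \<times> I) \<Gamma>" and I: "open I" and s: "s \<in> {-\<epsilon><..<\<epsilon>}"
  shows "Ck_map A 2 I (\<lambda>r. \<Gamma> (s, r))"
proof (rule Ck_map_compose[OF \<Gamma> _ I])
  show "open ({-\<epsilon><..<\<epsilon>} \<times> I)" by (intro open_Times I open_greaterThanLessThan)
  show "Ck_on 2 (\<lambda>r. (s, r)) I" by (intro Ck_on_Pair Ck_on_const Ck_on_ident I)
qed (use s in auto)

text \<open>On the set \<open>P\<close> where the chart \<open>c\<close> sees the variation, everything is expressed through the coordinate map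
  \<open>X\<close> and its time derivative \<open>Xt\<close>.\<close>

lemma variation_integrand:
  fixes \<Gamma> :: "real \<times> real \<Rightarrow> 'm"
  assumes F: "C2_finsler A F" and \<Gamma>: "Ck_map A 2 ({-\<epsilon><..<\<epsilon>} \<times> I) \<Gamma>" and I: "open I" and c: "c \<in> A"
  defines "P \<equiv> ({-\<epsilon><..<\<epsilon>} \<times> I) \<inter> \<Gamma> -` chart_dom c"
    and "X \<equiv> chart_map c \<circ> \<Gamma>"
  defines "Xt \<equiv> (\<lambda>y. frechet_derivative X (at y) (0, 1))"
  shows "open P" "Ck_on 2 X P" "Ck_on 1 Xt P"
    "\<And>s t. (s, t) \<in> P \<Longrightarrow> ((\<lambda>r. X (s, r)) has_vector_derivative Xt (s, t)) (at t)"
    "\<And>s t. (s, t) \<in> P \<Longrightarrow> ((\<lambda>r. X (r, t)) has_vector_derivative frechet_derivative X (at (s, t)) (1, 0)) (at s)"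
    "\<And>s t. (s, t) \<in> P \<Longrightarrow> F (velocity A (\<lambda>r. \<Gamma> (s, r)) t) = local_rep F c (X (s, t), Xt (s, t))"
    "\<And>s t. (s, t) \<in> P \<Longrightarrow> (snd (velocity A (\<lambda>r. \<Gamma> (s, r)) t) \<noteq> (\<lambda>_. 0)) = (Xt (s, t) \<noteq> 0)"
    "\<And>y. y \<in> P \<Longrightarrow> X y \<in> chart_range c"
proof -
  have U: "open ({-\<epsilon><..<\<epsilon>} \<times> I)" by (intro open_Times I open_greaterThanLessThan)
  show P: "open P" unfolding P_def by (rule open_chart_preimage[OF U \<Gamma> c])
  show X2: "Ck_on 2 X P" unfolding P_def X_def by (rule Ck_on_chart_curve[OF \<Gamma> c])
  then have X2': "Ck_on (Suc 1) X P" by (simp only: numeral_2_eq_2 One_nat_def)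
  show "Ck_on 1 Xt P" unfolding Xt_def by (rule Ck_on_SucD(2)[OF X2'])
  have dX: "(X has_derivative frechet_derivative X (at y)) (at y)" if "y \<in> P" for y
    by (rule Ck_on_SucD(1)[OF X2' that])
  show dt: "((\<lambda>r. X (s, r)) has_vector_derivative Xt (s, t)) (at t)" if "(s, t) \<in> P" for s t
  proof -
    have "((\<lambda>r. (s, r)) has_vector_derivative (0, 1)) (at t)" by (auto intro!: derivative_eq_intros)
    from vector_derivative_diff_chain_within[OF this has_derivative_at_withinI[OF dX[OF that]]]
    show ?thesis by (simp add: Xt_def o_def)
  qed
  show "((\<lambda>r. X (r, t)) has_vector_derivative frechet_derivative X (at (s, t)) (1, 0)) (at s)" if "(s, t) \<in> P" for s t
  proof -
    have "((\<lambda>r. (r, t)) has_vector_derivative (1, 0)) (at s)" by (auto intro!: derivative_eq_intros)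
    from vector_derivative_diff_chain_within[OF this has_derivative_at_withinI[OF dX[OF that]]]
    show ?thesis by (simp add: o_def)
  qed
  fix s t assume st: "(s, t) \<in> P"
  then have s: "s \<in> {-\<epsilon><..<\<epsilon>}" and t: "t \<in> I" and d: "\<Gamma> (s, t) \<in> chart_dom c" by (auto simp: P_def)
  have e: "vector_derivative (chart_map c \<circ> (\<lambda>r. \<Gamma> (s, r))) (at t) = Xt (s, t)"
    using vector_derivative_at[OF dt[OF st]] by (simp add: X_def o_def)
  show "F (velocity A (\<lambda>r. \<Gamma> (s, r)) t) = local_rep F c (X (s, t), Xt (s, t))"
    using velocity_coordinates[OF I variation_slice[OF \<Gamma> I s] t c] d e by (simp add: X_def)
  show "(snd (velocity A (\<lambda>r. \<Gamma> (s, r)) t) \<noteq> (\<lambda>_. 0)) = (Xt (s, t) \<noteq> 0)"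
    using velocity_nonzero_iff[OF I variation_slice[OF \<Gamma> I s] t c] d e by simp
next
  show "X y \<in> chart_range c" if "y \<in> P" for y
    using that chart_facts(6)[OF c] by (auto simp: P_def X_def)
qed

text \<open>The integrand is of class \<open>C^1\<close> only where the velocity does not vanish. This is an open set
  containing \<open>{0} \<times> {a..b}\<close>, hence a strip around it, on which one may differentiate under the integral.\<close>

lemma first_variation:
  fixes \<Gamma> :: "real \<times> real \<Rightarrow> 'm"
  assumes F: "C2_finsler A F" and \<Gamma>: "Ck_map A 2 ({-\<epsilon><..<\<epsilon>} \<times> I) \<Gamma>" and I: "open I"
    and \<epsilon>: "\<epsilon> > 0" and ab: "a < b" "{a..b} \<subseteq> I"
    and ne: "\<And>t. t \<in> {a..b} \<Longrightarrow> snd (velocity A (\<lambda>r. \<Gamma> (0, r)) t) \<noteq> (\<lambda>_. 0)"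
  shows "\<exists>H. continuous_on {a..b} H \<and>
    ((\<lambda>s. integral {a..b} (\<lambda>t. F (velocity A (\<lambda>r. \<Gamma> (s, r)) t))) has_real_derivative integral {a..b} H) (at 0) \<and>
    (\<forall>t\<in>{a..b}. \<forall>c\<in>A. \<Gamma> (0, t) \<in> chart_dom c \<longrightarrow>
      H t = hder (local_rep F c) (chart_map c (\<Gamma> (0, t)), frechet_derivative (chart_map c \<circ> \<Gamma>) (at (0, t)) (0, 1))
          (frechet_derivative (chart_map c \<circ> \<Gamma>) (at (0, t)) (1, 0))
        + vder (local_rep F c) (chart_map c (\<Gamma> (0, t)), frechet_derivative (chart_map c \<circ> \<Gamma>) (at (0, t)) (0, 1))
          (frechet_derivative (\<lambda>y. frechet_derivative (chart_map c \<circ> \<Gamma>) (at y) (0, 1)) (at (0, t)) (1, 0)))"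
proof -
  define h where "h = (\<lambda>(s, t). F (velocity A (\<lambda>r. \<Gamma> (s, r)) t))"
  define \<Omega> where "\<Omega> = {y. \<exists>T. open T \<and> y \<in> T \<and> Ck_on 1 h T}"
  have h: "Ck_on 1 h \<Omega>" by (rule Ck_on_local) (simp add: \<Omega>_def)
  have h': "Ck_on (Suc 0) h \<Omega>" using h by simp
  have "\<Omega> = \<Union>{T. open T \<and> Ck_on 1 h T}" unfolding \<Omega>_def by blast
  then have o: "open \<Omega>" by auto
  have loc: "(0, t) \<in> \<Omega> \<and> frechet_derivative h (at (0, t)) (1, 0) =
      hder (local_rep F c) (chart_map c (\<Gamma> (0, t)), frechet_derivative (chart_map c \<circ> \<Gamma>) (at (0, t)) (0, 1))
          (frechet_derivative (chart_map c \<circ> \<Gamma>) (at (0, t)) (1, 0))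
        + vder (local_rep F c) (chart_map c (\<Gamma> (0, t)), frechet_derivative (chart_map c \<circ> \<Gamma>) (at (0, t)) (0, 1))
          (frechet_derivative (\<lambda>y. frechet_derivative (chart_map c \<circ> \<Gamma>) (at y) (0, 1)) (at (0, t)) (1, 0))"
    if t: "t \<in> {a..b}" and c: "c \<in> A" "\<Gamma> (0, t) \<in> chart_dom c" for t c
  proof -
    define P where "P = ({-\<epsilon><..<\<epsilon>} \<times> I) \<inter> \<Gamma> -` chart_dom c"
    define X where "X = chart_map c \<circ> \<Gamma>"
    define Xt where "Xt = (\<lambda>y. frechet_derivative X (at y) (0, 1))"
    have XtE: "frechet_derivative X (at y) (0, 1) = Xt y" for y by (simp add: Xt_def)
    note V = variation_integrand[OF F \<Gamma> I c(1), folded P_def X_def, unfolded XtE]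
    note f = finsler_local[OF F c(1)]
    define P' where "P' = P \<inter> Xt -` (- {0})"
    have P': "open P'" "P' \<subseteq> P"
      unfolding P'_def using continuous_open_preimage[OF Ck_on_imp_continuous_on[OF V(3)] V(1)] by auto
    have tP: "(0, t) \<in> P" using t c ab \<epsilon> by (auto simp: P_def)
    then have tP': "(0, t) \<in> P'" using V(7)[OF tP] ne[OF t] by (simp add: P'_def)
    have pair: "Ck_on 1 (\<lambda>y. (X y, Xt y)) P'"
      using Ck_on_subset[OF Ck_on_le[OF V(2), of 1] P'(2)] Ck_on_subset[OF V(3) P'(2)]
      by (intro Ck_on_Pair P') auto
    have into: "(\<lambda>y. (X y, Xt y)) ` P' \<subseteq> slit c" using V(8) P'(2) by (auto simp: P'_def)
    have comp: "Ck_on 1 (\<lambda>y. local_rep F c (X y, Xt y)) P'"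
      by (rule Ck_on_compose[OF P'(1) Ck_on_le[OF f(1)] pair into]) simp
    have heq: "local_rep F c (X y, Xt y) = h y" if "y \<in> P'" for y
      using V(6)[of "fst y" "snd y"] that P'(2) by (simp add: h_def split_beta subset_eq)
    have "Ck_on 1 h P'" by (rule Ck_on_cong[OF P'(1) comp heq])
    then have "(0, t) \<in> \<Omega>" unfolding \<Omega>_def using P'(1) tP' by blast
    moreover have "frechet_derivative h (at (0, t)) (1, 0) =
      hder (local_rep F c) (X (0, t), Xt (0, t)) (frechet_derivative X (at (0, t)) (1, 0))
        + vder (local_rep F c) (X (0, t), Xt (0, t)) (frechet_derivative Xt (at (0, t)) (1, 0))"
    proof -
      have X2': "Ck_on (Suc 1) X P" using V(2) by (simp only: numeral_2_eq_2 One_nat_def)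
      have Xt1: "Ck_on (Suc 0) Xt P" using V(3) by simp
      have d: "((\<lambda>y. (X y, Xt y)) has_derivative
          (\<lambda>\<zeta>. (frechet_derivative X (at (0, t)) \<zeta>, frechet_derivative Xt (at (0, t)) \<zeta>))) (at (0, t))"
        by (intro has_derivative_Pair Ck_on_SucD(1)[OF X2' tP] Ck_on_SucD(1)[OF Xt1 tP])
      have "(X (0, t), Xt (0, t)) \<in> slit c" using into tP' by blast
      note d2 = hder_vder_derivative[OF Ck_on_2_differentiable[OF f(1) this]]
      have "((\<lambda>y. local_rep F c (X y, Xt y)) has_derivative
         (\<lambda>\<zeta>. hder (local_rep F c) (X (0, t), Xt (0, t)) (frechet_derivative X (at (0, t)) \<zeta>)
        + vder (local_rep F c) (X (0, t), Xt (0, t)) (frechet_derivative Xt (at (0, t)) \<zeta>))) (at (0, t))"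
        using has_derivative_compose[OF d d2] by simp
      then have "(h has_derivative
         (\<lambda>\<zeta>. hder (local_rep F c) (X (0, t), Xt (0, t)) (frechet_derivative X (at (0, t)) \<zeta>)
        + vder (local_rep F c) (X (0, t), Xt (0, t)) (frechet_derivative Xt (at (0, t)) \<zeta>))) (at (0, t))"
        by (rule has_derivative_transform_within_open[OF _ P'(1) tP' heq])
      from fun_cong[OF frechet_derivative_at[OF this], of "(1, 0)"] show ?thesis by simp
    qed
    ultimately show ?thesis by (simp add: X_def Xt_def)
  qed
  have "{0} \<times> {a..b} \<subseteq> \<Omega>" using loc ex_chart by blast
  from Elementary_Topology.tube_lemma[OF compact_Icc o this] obtain X0 where X0: "0 \<in> X0" "open X0" "X0 \<times> {a..b} \<subseteq> \<Omega>" by blast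
  obtain \<eta> where \<eta>: "\<eta> > 0" "ball 0 \<eta> \<subseteq> X0" using X0 by (meson openE)
  let ?U = "ball (0::real) \<eta>"
  have sub: "?U \<times> {a..b} \<subseteq> \<Omega>" using \<eta> X0 by auto
  define H where "H = (\<lambda>s t. frechet_derivative h (at (s, t)) (1, 0))"
  have cH: "continuous_on \<Omega> (\<lambda>y. frechet_derivative h (at y) (1, 0))"
    by (rule continuous_on_frechet_derivative[OF h'])
  have "((\<lambda>s. integral (cbox a b) (\<lambda>t. h (s, t))) has_field_derivative integral (cbox a b) (H 0)) (at 0 within ?U)"
  proof (rule leibniz_rule_field_derivative)
    fix s t assume st: "s \<in> ?U" "t \<in> cbox a b"
    then have "(s, t) \<in> \<Omega>" using sub by auto
    then have d: "(h has_derivative frechet_derivative h (at (s, t))) (at (s, t))" by (rule Ck_on_SucD(1)[OF h'])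
    have "((\<lambda>r. (r, t)) has_vector_derivative (1, 0)) (at s)" by (auto intro!: derivative_eq_intros)
    from vector_derivative_diff_chain_within[OF this has_derivative_at_withinI[OF d]]
    have "((\<lambda>r. h (r, t)) has_field_derivative H s t) (at s)"
      by (simp add: H_def o_def has_real_derivative_iff_has_vector_derivative)
    then show "((\<lambda>r. h (r, t)) has_field_derivative H s t) (at s within ?U)"
      by (rule has_field_derivative_at_within)
  next
    fix s assume s: "s \<in> ?U"
    have "continuous_on (cbox a b) (\<lambda>t. h (s, t))"
      by (rule continuous_on_compose2[OF Ck_on_imp_continuous_on[OF h]]) (use s sub in \<open>auto intro!: continuous_intros\<close>)
    then show "(\<lambda>t. h (s, t)) integrable_on cbox a b" by (rule integrable_continuous)
  next
    show "continuous_on (?U \<times> cbox a b) (\<lambda>(s, t). H s t)"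
      unfolding H_def using continuous_on_subset[OF cH sub] by (simp add: split_beta)
  qed (use \<eta> in auto)
  moreover have "at 0 within ?U = at 0" using \<eta> by (intro at_within_open) auto
  ultimately have "((\<lambda>s. integral {a..b} (\<lambda>t. h (s, t))) has_real_derivative integral {a..b} (H 0)) (at 0)" by simp
  moreover have "continuous_on {a..b} (H 0)"
    unfolding H_def
    by (rule continuous_on_compose2[OF cH]) (use sub \<eta> in \<open>auto intro!: continuous_intros\<close>)
  ultimately show ?thesis
    using loc unfolding h_def prod.case by (intro exI[of _ "H 0"]) (simp add: H_def h_def)
qed

end

lemma vector_derivative_cong_open:
  assumes "open S" "t \<in> S" "\<And>s. s \<in> S \<Longrightarrow> f s = g s"
  shows "vector_derivative f (at t) = vector_derivative g (at t)"
proof -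
  have "(f has_vector_derivative D) (at t) \<longleftrightarrow> (g has_vector_derivative D) (at t)" for D
    using has_vector_derivative_transform_within_open[OF _ assms(1,2), of f D g]
      has_vector_derivative_transform_within_open[OF _ assms(1,2), of g D f] assms(3) by auto
  then show ?thesis by (simp add: vector_derivative_def)
qed

lemma max_power_derivative:
  assumes "n = 2 \<or> n = 3"
  shows "((\<lambda>z. (max 0 z) ^ n) has_real_derivative of_nat n * (max 0 z) ^ (n - 1)) (at z)"
proof -
  consider "z < 0" | "z = 0" | "z > 0" by linarith
  then show ?thesis
  proof cases
    case 1
    have "((\<lambda>z. 0) has_real_derivative 0) (at z)" by simp
    then have "((\<lambda>z. (max 0 z) ^ n) has_real_derivative 0) (at z)"
      by (rule has_field_derivative_transform_within_open[where S = "{..<0}"]) (use 1 assms in auto)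
    then show ?thesis using 1 assms by auto
  next
    case 3
    have "((\<lambda>z. z ^ n) has_real_derivative of_nat n * z ^ (n - 1)) (at z)"
      using DERIV_pow[of n z UNIV] by simp
    then have "((\<lambda>z. (max 0 z) ^ n) has_real_derivative of_nat n * z ^ (n - 1)) (at z)"
      by (rule has_field_derivative_transform_within_open[where S = "{0<..}"]) (use 3 in auto)
    then show ?thesis using 3 by simp
  next
    case 2
    have "\<forall>\<^sub>F h::real in at 0. norm ((max 0 h) ^ n / h) \<le> \<bar>h\<bar>"
      unfolding eventually_at
    proof (intro exI[of _ 1] conjI ballI impI)
      fix h :: real assume h: "h \<noteq> 0 \<and> dist h 0 < 1"
      show "norm ((max 0 h) ^ n / h) \<le> \<bar>h\<bar>"
      proof (cases "h < 0")
        case False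
        then have "0 < h" "h < 1" using h by auto
        then show ?thesis using assms by (auto simp: power2_eq_square power3_eq_cube mult_le_one)
      qed (use assms in auto)
    qed simp
    moreover have "((\<lambda>h. \<bar>h\<bar>) \<longlongrightarrow> 0) (at (0::real))" by (auto intro!: tendsto_eq_intros)
    ultimately have "((\<lambda>h::real. ((max 0 h) ^ n) / h) \<longlongrightarrow> 0) (at 0)"
      by (rule Lim_null_comparison)
    then show ?thesis using 2 assms by (auto simp: DERIV_def)
  qed
qed

text \<open>The third power makes this function of class \<open>C^2\<close>.\<close>

definition bump :: "real \<Rightarrow> real \<Rightarrow> real \<Rightarrow> real" where
  "bump a b r = (max 0 ((r - a) * (b - r))) ^ 3"

lemma bump_properties:
  assumes "a < b"
  shows "Ck_on 2 (bump a b) S" "bump a b r \<ge> 0" "r \<notin> {a<..<b} \<Longrightarrow> bump a b r = 0" "r \<in> {a<..<b} \<Longrightarrow> bump a b r > 0"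
proof -
  have C: "Ck_on 2 (\<lambda>z::real. (max 0 z) ^ 3) UNIV"
  proof -
    have d1: "((\<lambda>z::real. (max 0 z) ^ 3) has_vector_derivative 3 * (max 0 z) ^ 2) (at z)" for z
      using max_power_derivative[of 3 z] by (simp add: has_real_derivative_iff_has_vector_derivative)
    have d2: "((\<lambda>z::real. 3 * (max 0 z) ^ 2) has_vector_derivative 3 * (2 * max 0 z)) (at z)" for z
      using DERIV_cmult[OF max_power_derivative[of 2 z], of 3] by (simp add: has_real_derivative_iff_has_vector_derivative)
    have "Ck_on (Suc (Suc 0)) (\<lambda>z::real. (max 0 z) ^ 3) UNIV"
      by (rule Ck_on_real_SucI[OF open_UNIV d1 Ck_on_real_SucI[OF open_UNIV d2]])
        (auto intro!: continuous_intros)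
    then show ?thesis by (simp add: numeral_2_eq_2)
  qed
  have L: "Ck_on 2 (\<lambda>r. (r - a) * (b - r)) (UNIV :: real set)"
    by (rule Ck_on_bilinear[OF bounded_bilinear_mult open_UNIV])
      (auto intro!: Ck_on_diff Ck_on_ident)
  have "Ck_on 2 (bump a b) UNIV"
    using Ck_on_compose[OF open_UNIV C L] by (simp add: bump_def[abs_def])
  then show "Ck_on 2 (bump a b) S" by (rule Ck_on_subset) simp
  show "bump a b r \<ge> 0" by (simp add: bump_def)
  show "bump a b r = 0" if "r \<notin> {a<..<b}"
    using that assms by (auto simp: bump_def max_def zero_le_mult_iff not_less)
  show "bump a b r > 0" if "r \<in> {a<..<b}" using that by (auto simp: bump_def max_def)
qed

context smooth_manifold
begin

lemma velocity_cong:
  assumes "open I" "t \<in> I" "\<And>s. s \<in> I \<Longrightarrow> \<gamma> s = \<delta> s"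
  shows "velocity A \<gamma> t = velocity A \<delta> t"
proof -
  have "vector_derivative (chart_map c \<circ> \<gamma>) (at t) = vector_derivative (chart_map c \<circ> \<delta>) (at t)" for c :: "('m, 'e) chart"
    by (rule vector_derivative_cong_open[OF assms(1,2)]) (simp add: assms(3))
  then show ?thesis by (simp only: velocity_def assms(3)[OF assms(2)])
qed

lemma chart_velocity_transition:
  assumes I: "open I" and \<gamma>: "Ck_map A 2 I \<gamma>" and t: "t \<in> I" and c: "c \<in> A" "\<gamma> t \<in> chart_dom c" and c': "c' \<in> A" "\<gamma> t \<in> chart_dom c'"
  shows "vector_derivative (chart_map c' \<circ> \<gamma>) (at t) =
    frechet_derivative (transition c c') (at (chart_map c (\<gamma> t))) (vector_derivative (chart_map c \<circ> \<gamma>) (at t))"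
proof -
  have "snd (velocity A \<gamma> t) c' = vector_derivative (chart_map c' \<circ> \<gamma>) (at t)" using c' by (simp add: velocity_def)
  moreover have "snd (velocity A \<gamma> t) c' = frechet_derivative (transition c c') (at (chart_map c (\<gamma> t))) (vector_derivative (chart_map c \<circ> \<gamma>) (at t))"
    unfolding velocity_coordinates[OF I \<gamma> t c] using c' chart_facts(5)[OF c] by (simp add: chart_vec_def)
  ultimately show ?thesis by simp
qed

lemma vder_transition:
  assumes F: "C2_finsler A F" and c: "c \<in> A" "c' \<in> A" and p: "p \<in> overlap c c'" and u: "u \<noteq> 0"
    and u': "frechet_derivative (transition c c') (at p) u \<noteq> 0"
  shows "vder (local_rep F c) (p, u) e =
    vder (local_rep F c') (transition c c' p, frechet_derivative (transition c c') (at p) u) (frechet_derivative (transition c c') (at p) e)"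
proof -
  let ?D = "frechet_derivative (transition c c') (at p)"
  have l: "linear ?D" using transition_derivative[OF c p] by (rule has_derivative_linear)
  have z: "(p, u) \<in> slit c" using p u overlap_iff[OF c(1), of _ c'] by simp
  have z': "(transition c c' p, ?D u) \<in> slit c'" using transition_in_range[OF c p] u' by simp
  have "((\<lambda>t. local_rep F c (p, u + t *\<^sub>R e)) has_real_derivative vder (local_rep F c) (p, u) e) (at 0)"
    by (rule vder_line[OF Ck_on_2_differentiable[OF finsler_local(1)[OF F c(1)] z]])
  moreover have "local_rep F c (p, u + t *\<^sub>R e) = local_rep F c' (transition c c' p, ?D u + t *\<^sub>R ?D e)" for t
    unfolding chart_vec_transition[OF c p] by (simp add: linear_add[OF l] linear_cmul[OF l])
  ultimately have "((\<lambda>t. local_rep F c' (transition c c' p, ?D u + t *\<^sub>R ?D e)) has_real_derivative vder (local_rep F c) (p, u) e) (at 0)"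
    by simp
  moreover have "((\<lambda>t. local_rep F c' (transition c c' p, ?D u + t *\<^sub>R ?D e)) has_real_derivative
      vder (local_rep F c') (transition c c' p, ?D u) (?D e)) (at 0)"
    by (rule vder_line[OF Ck_on_2_differentiable[OF finsler_local(1)[OF F c(2)] z']])
  ultimately show ?thesis by (rule DERIV_unique)
qed

text \<open>With the variation field \<open>J\<close>, the Euler-Lagrange equation says that \<open>H\<close> is the time
  derivative of \<open>vder F (\<gamma>') J\<close>. The latter number does not depend on the chart, so it is a function on all of
  \<open>{a..b}\<close>, although its derivative is computed in a chart that varies with the time; it vanishes at both ends.\<close>

lemma EL_imp_extremal:
  assumes F: "C2_finsler A F" and I: "open_interval I" and \<gamma>: "Ck_map A 2 I \<gamma>"
    and ne: "\<And>t. t \<in> I \<Longrightarrow> snd (velocity A \<gamma> t) \<noteq> (\<lambda>_. 0)"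
    and EL: "\<And>t. t \<in> I \<Longrightarrow> \<exists>c\<in>A. \<gamma> t \<in> chart_dom c \<and> EL (local_rep F c) (chart_map c \<circ> \<gamma>) t"
  shows "extremal A F I \<gamma>"
  unfolding extremal_def
proof (intro conjI ballI allI impI I \<gamma> ne)
  fix a b \<epsilon> :: real and \<Gamma> :: "real \<times> real \<Rightarrow> 'm"
  assume ab: "a < b" "{a..b} \<subseteq> I" and \<epsilon>: "\<epsilon> > 0" and var: "variation A I \<gamma> a b \<epsilon> \<Gamma>"
  have oI: "open I" using I by (simp add: open_interval_def)
  have \<Gamma>: "Ck_map A 2 ({-\<epsilon><..<\<epsilon>} \<times> I) \<Gamma>" and \<Gamma>0: "\<And>t. t \<in> I \<Longrightarrow> \<Gamma> (0, t) = \<gamma> t"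
    and \<Gamma>out: "\<And>s t. s \<in> {-\<epsilon><..<\<epsilon>} \<Longrightarrow> t \<in> I \<Longrightarrow> t \<notin> {a<..<b} \<Longrightarrow> \<Gamma> (s, t) = \<gamma> t"
    using var by (auto simp: variation_def)
  have vel: "velocity A (\<lambda>r. \<Gamma> (0, r)) t = velocity A \<gamma> t" if "t \<in> I" for t
    by (rule velocity_cong[OF oI that \<Gamma>0])
  have ne0: "snd (velocity A (\<lambda>r. \<Gamma> (0, r)) t) \<noteq> (\<lambda>_. 0)" if "t \<in> {a..b}" for t
    using vel ne ab(2) that by auto
  define J where "J = (\<lambda>(c :: ('m, 'e) chart) t. frechet_derivative (chart_map c \<circ> \<Gamma>) (at (0, t)) (1, 0))"
  define x where "x = (\<lambda>c :: ('m, 'e) chart. chart_map c \<circ> \<gamma>)"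
  define v where "v = (\<lambda>c t. vector_derivative (x c) (at t))"
  define g where "g = (\<lambda>c t. vder (local_rep F c) (x c t, v c t) (J c t))"
  have tP: "(0, t) \<in> ({-\<epsilon><..<\<epsilon>} \<times> I) \<inter> \<Gamma> -` chart_dom c" if "t \<in> I" "\<gamma> t \<in> chart_dom c" for c :: "('m, 'e) chart" and t
    using that \<Gamma>0 \<epsilon> by auto
  have Xt: "frechet_derivative (chart_map c \<circ> \<Gamma>) (at (0, t)) (0, 1) = v c t"
    if t: "t \<in> I" and c: "c \<in> A" "\<gamma> t \<in> chart_dom c" for c t
  proof -
    have "((\<lambda>r. (chart_map c \<circ> \<Gamma>) (0, r)) has_vector_derivative frechet_derivative (chart_map c \<circ> \<Gamma>) (at (0, t)) (0, 1)) (at t)"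
      by (rule variation_integrand(4)[OF F \<Gamma> oI c(1) tP[OF t c(2)]])
    then have "(x c has_vector_derivative frechet_derivative (chart_map c \<circ> \<Gamma>) (at (0, t)) (0, 1)) (at t)"
      by (rule has_vector_derivative_transform_within_open[OF _ oI t]) (simp add: \<Gamma>0 x_def)
    from vector_derivative_at[OF this] show ?thesis by (simp add: v_def)
  qed
  have vne: "v c t \<noteq> 0" if "t \<in> I" "c \<in> A" "\<gamma> t \<in> chart_dom c" for c t
    using velocity_nonzero_iff[OF oI \<gamma> that] ne[OF that(1)] by (simp add: v_def x_def)
  have slit: "(x c t, v c t) \<in> slit c" if "t \<in> I" "c \<in> A" "\<gamma> t \<in> chart_dom c" for c t
    using vne[OF that] chart_facts(6)[OF that(2,3)] by (simp add: x_def)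
  have indep: "g c t = g c' t" if t: "t \<in> I" and c: "c \<in> A" "\<gamma> t \<in> chart_dom c" and c': "c' \<in> A" "\<gamma> t \<in> chart_dom c'" for c c' t
  proof -
    have p: "x c t \<in> overlap c c'" using c c' by (auto simp: x_def overlap_def)
    let ?D = "frechet_derivative (transition c c') (at (x c t))"
    have vt: "?D (v c t) = v c' t"
      using chart_velocity_transition[OF oI \<gamma> t c c'] by (simp add: v_def x_def)
    have xt: "transition c c' (x c t) = x c' t" using chart_facts(5)[OF c] by (simp add: transition_def x_def)
    have Jt: "?D (J c t) = J c' t"
    proof -
      let ?P = "({-\<epsilon><..<\<epsilon>} \<times> I) \<inter> \<Gamma> -` chart_dom c"
      have X2: "Ck_on (Suc 1) (chart_map c \<circ> \<Gamma>) ?P"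
        using variation_integrand(2)[OF F \<Gamma> oI c(1)] by (simp only: numeral_2_eq_2 One_nat_def)
      have d1: "((chart_map c \<circ> \<Gamma>) has_derivative frechet_derivative (chart_map c \<circ> \<Gamma>) (at (0, t))) (at (0, t))"
        by (rule Ck_on_SucD(1)[OF X2 tP[OF t c(2)]])
      have e: "(chart_map c \<circ> \<Gamma>) (0, t) = x c t" by (simp add: x_def \<Gamma>0 t)
      have "((transition c c') has_derivative ?D) (at ((chart_map c \<circ> \<Gamma>) (0, t)))"
        unfolding e by (rule transition_derivative[OF c(1) c'(1) p])
      from diff_chain_at[OF d1 this]
      have "((chart_map c' \<circ> \<Gamma>) has_derivative ?D \<circ> frechet_derivative (chart_map c \<circ> \<Gamma>) (at (0, t))) (at (0, t))"
        by (rule has_derivative_transform_within_open[OF _ variation_integrand(1)[OF F \<Gamma> oI c(1)] tP[OF t c(2)]])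
          (use chart_facts(5)[OF c(1)] in \<open>auto simp: transition_def\<close>)
      from fun_cong[OF frechet_derivative_at[OF this], of "(1, 0)"] show ?thesis by (simp add: J_def)
    qed
    show ?thesis
      using vder_transition[OF F c(1) c'(1) p vne[OF t c], of "J c t"] vne[OF t c'] by (simp add: g_def vt xt Jt)
  qed
  define cc where "cc = (\<lambda>t. SOME c. c \<in> A \<and> \<gamma> t \<in> chart_dom c)"
  have cc: "cc t \<in> A" "\<gamma> t \<in> chart_dom (cc t)" for t
  proof -
    have "\<exists>c. c \<in> A \<and> \<gamma> t \<in> chart_dom c" using ex_chart by blast
    from someI_ex[OF this] show "cc t \<in> A" "\<gamma> t \<in> chart_dom (cc t)" unfolding cc_def by blast+
  qed
  obtain H where H: "continuous_on {a..b} H"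
    and HD: "((\<lambda>s. integral {a..b} (\<lambda>t. F (velocity A (\<lambda>r. \<Gamma> (s, r)) t))) has_real_derivative integral {a..b} H) (at 0)"
    and Hc: "\<And>t c. t \<in> {a..b} \<Longrightarrow> c \<in> A \<Longrightarrow> \<Gamma> (0, t) \<in> chart_dom c \<Longrightarrow>
      H t = hder (local_rep F c) (chart_map c (\<Gamma> (0, t)), frechet_derivative (chart_map c \<circ> \<Gamma>) (at (0, t)) (0, 1))
          (frechet_derivative (chart_map c \<circ> \<Gamma>) (at (0, t)) (1, 0))
        + vder (local_rep F c) (chart_map c (\<Gamma> (0, t)), frechet_derivative (chart_map c \<circ> \<Gamma>) (at (0, t)) (0, 1))
          (frechet_derivative (\<lambda>y. frechet_derivative (chart_map c \<circ> \<Gamma>) (at y) (0, 1)) (at (0, t)) (1, 0))"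
    using first_variation[OF F \<Gamma> oI \<epsilon> ab ne0] by blast
  have dg: "((\<lambda>t. g (cc t) t) has_vector_derivative H t) (at t)" if t: "t \<in> {a..b}" for t
  proof -
    have tI: "t \<in> I" using t ab by auto
    obtain c where c: "c \<in> A" "\<gamma> t \<in> chart_dom c" and ELc: "EL (local_rep F c) (x c) t"
      using EL[OF tI] by (auto simp: x_def)
    let ?I' = "I \<inter> \<gamma> -` chart_dom c" and ?P = "({-\<epsilon><..<\<epsilon>} \<times> I) \<inter> \<Gamma> -` chart_dom c" and ?X = "chart_map c \<circ> \<Gamma>"
    have oI': "open ?I'" by (rule open_chart_preimage[OF oI \<gamma> c(1)])
    have tI': "t \<in> ?I'" using tI c by auto
    note V = variation_integrand[OF F \<Gamma> oI c(1)]
    note C2 = finsler_local(1)[OF F c(1)]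
    have df: "local_rep F c differentiable (at (x c s, v c s))" if "s \<in> ?I'" for s
      using that by (intro Ck_on_2_differentiable[OF C2 slit]) (use c in auto)
    have dx: "(x c has_vector_derivative v c s) (at s)" if "s \<in> ?I'" for s
      using chart_curve_derivative[OF oI \<gamma>, of s c] that c by (auto simp: x_def v_def)
    have dv: "((\<lambda>t. vgrad (local_rep F c) (x c t, v c t)) has_vector_derivative hgrad (local_rep F c) (x c t, v c t)) (at t)"
      by (rule EL_vgrad[OF ELc oI' tI' dx df])
    let ?J' = "frechet_derivative (\<lambda>y. frechet_derivative ?X (at y) (0, 1)) (at (0, t)) (1, 0)"
    have dJ: "(J c has_vector_derivative ?J') (at t)"
    proof -
      have X2: "Ck_on (Suc 1) ?X ?P" using V(2) by (simp only: numeral_2_eq_2 One_nat_def)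
      have "Ck_on (Suc 0) (\<lambda>y. frechet_derivative ?X (at y) (1, 0)) ?P" using Ck_on_SucD(2)[OF X2] by simp
      from Ck_on_SucD(1)[OF this tP[OF tI c(2)]]
      have d: "((\<lambda>y. frechet_derivative ?X (at y) (1, 0)) has_derivative
          frechet_derivative (\<lambda>y. frechet_derivative ?X (at y) (1, 0)) (at (0, t))) (at (0, t))" .
      have "((\<lambda>r. (0, r)) has_vector_derivative (0::real, 1::real)) (at t)" by (auto intro!: derivative_eq_intros)
      from vector_derivative_diff_chain_within[OF this has_derivative_at_withinI[OF d]]
      show ?thesis
        using second_derivative_symmetric[OF V(2,1) tP[OF tI c(2)], of "(1, 0)" "(0, 1)"] by (simp add: J_def[abs_def] o_def)
    qed
    have d: "((\<lambda>t. vgrad (local_rep F c) (x c t, v c t) \<bullet> J c t) has_vector_derivative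
        vgrad (local_rep F c) (x c t, v c t) \<bullet> ?J' + hgrad (local_rep F c) (x c t, v c t) \<bullet> J c t) (at t)"
      by (rule bounded_bilinear.has_vector_derivative[OF bounded_bilinear_inner dv dJ])
    have e: "vgrad (local_rep F c) (x c t, v c t) \<bullet> ?J' + hgrad (local_rep F c) (x c t, v c t) \<bullet> J c t = H t"
      using Hc[OF t c(1)] c(2) \<Gamma>0[OF tI] Xt[OF tI c]
      by (simp add: vgrad_inner[OF df[OF tI']] hgrad_inner[OF df[OF tI']] J_def) (simp add: x_def)
    show ?thesis
    proof (rule has_vector_derivative_transform_within_open[OF d[unfolded e] oI' tI'])
      fix s assume s: "s \<in> ?I'"
      then have "g (cc s) s = g c s" by (intro indep cc c(1)) auto
      then show "vgrad (local_rep F c) (x c s, v c s) \<bullet> J c s = g (cc s) s"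
        by (simp add: g_def vgrad_inner[OF df[OF s]])
    qed
  qed
  have g0: "g (cc t) t = 0" if t: "t \<in> {a..b}" "t \<notin> {a<..<b}" for t
  proof -
    have tI: "t \<in> I" using t ab by auto
    note P = tP[OF tI cc(2)]
    have "((\<lambda>r. (chart_map (cc t) \<circ> \<Gamma>) (r, t)) has_vector_derivative J (cc t) t) (at 0)"
      unfolding J_def by (rule variation_integrand(5)[OF F \<Gamma> oI cc(1) P])
    moreover have "((\<lambda>r. (chart_map (cc t) \<circ> \<Gamma>) (r, t)) has_vector_derivative 0) (at 0)"
    proof (rule has_vector_derivative_transform_within_open[OF has_vector_derivative_const])
      show "chart_map (cc t) (\<gamma> t) = (chart_map (cc t) \<circ> \<Gamma>) (s, t)" if "s \<in> {-\<epsilon><..<\<epsilon>}" for s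
        using \<Gamma>out[OF that tI t(2)] by simp
    qed (use \<epsilon> in auto)
    ultimately have "J (cc t) t = 0" by (rule vector_derivative_unique_at)
    then show ?thesis
      using linear_0[OF linear_vder[OF Ck_on_2_differentiable[OF finsler_local(1)[OF F cc(1)] slit[OF tI cc]]]] by (simp add: g_def)
  qed
  have "(H has_integral (g (cc b) b - g (cc a) a)) {a..b}"
    using ab by (intro fundamental_theorem_of_calculus has_vector_derivative_at_within[OF dg]) auto
  then have "integral {a..b} H = 0" using g0[of a] g0[of b] ab by (simp add: integral_unique)
  then show "((\<lambda>s. integral {a..b} (\<lambda>t. F (velocity A (\<lambda>r. \<Gamma> (s, r)) t))) has_real_derivative 0) (at 0)"
    using HD by simp
qed

text \<open>The fundamental lemma of the calculus of variations, with variations supported in the domain of a single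
  chart. If the defect \<open>E\<close> of the equation did not vanish at \<open>t0\<close>, it would have a constant sign
  on a neighbourhood, and so would its integral against a bump function supported there.\<close>

lemma extremal_imp_EL:
  assumes F: "C2_finsler A F" and ext: "extremal A F I \<gamma>" and t0: "t0 \<in> I" and c: "c \<in> A" "\<gamma> t0 \<in> chart_dom c"
  shows "EL (local_rep F c) (chart_map c \<circ> \<gamma>) t0"
proof -
  have oI: "open I" and \<gamma>: "Ck_map A 2 I \<gamma>" and ne: "\<And>t. t \<in> I \<Longrightarrow> snd (velocity A \<gamma> t) \<noteq> (\<lambda>_. 0)"
    using ext by (auto simp: extremal_def open_interval_def)
  define x where "x = chart_map c \<circ> \<gamma>"
  define v where "v = (\<lambda>t. vector_derivative x (at t))"
  define I' where "I' = I \<inter> \<gamma> -` chart_dom c"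
  let ?f = "local_rep F c"
  have oI': "open I'" unfolding I'_def by (rule open_chart_preimage[OF oI \<gamma> c(1)])
  have t0': "t0 \<in> I'" using t0 c by (simp add: I'_def)
  have x2: "Ck_on 2 x I'" unfolding x_def I'_def by (rule Ck_on_chart_curve[OF \<gamma> c(1)])
  then have x2': "Ck_on (Suc 1) x I'" by (simp only: numeral_2_eq_2 One_nat_def)
  have dx: "(x has_vector_derivative v t) (at t)" if "t \<in> I'" for t
    unfolding v_def by (rule Ck_on_real_SucD(1)[OF x2' oI' that])
  have v1: "Ck_on 1 v I'" using Ck_on_real_SucD(2)[OF x2' oI'] by (simp add: v_def[abs_def])
  have xr: "x t \<in> chart_range c" if "t \<in> I'" for t
    using that chart_facts(6)[OF c(1)] by (simp add: x_def I'_def)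
  have slit: "(x t, v t) \<in> slit c" if "t \<in> I'" for t
    using velocity_nonzero_iff[OF oI \<gamma> _ c(1), of t] ne[of t] xr[OF that] that by (auto simp: I'_def v_def x_def)
  note C2 = finsler_local(1)[OF F c(1)]
  have z1: "Ck_on 1 (\<lambda>t. (x t, v t)) I'"
    using Ck_on_le[OF x2, of 1] v1 by (intro Ck_on_Pair oI') auto
  have zs: "(\<lambda>t. (x t, v t)) ` I' \<subseteq> slit c" using slit by blast
  have df: "?f differentiable (at (x t, v t))" if "t \<in> I'" for t
    by (rule Ck_on_2_differentiable[OF C2 slit[OF that]])
  show ?thesis
    unfolding EL_def x_def[symmetric]
  proof
    fix e
    define p where "p = (\<lambda>t. vder ?f (x t, v t) e)"
    have p1: "Ck_on (Suc 0) p I'"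
      unfolding p_def using Ck_on_compose[OF oI' Ck_on_vder[OF C2] z1 zs] by simp
    define p' where "p' = (\<lambda>t. vector_derivative p (at t))"
    have dp: "(p has_vector_derivative p' t) (at t)" if "t \<in> I'" for t
      unfolding p'_def by (rule Ck_on_real_SucD(1)[OF p1 oI' that])
    have cp': "continuous_on I' p'"
      using Ck_on_real_SucD(2)[OF p1 oI'] by (simp add: p'_def[abs_def])
    define E where "E = (\<lambda>t. hder ?f (x t, v t) e - p' t)"
    have cE: "continuous_on I' E"
      unfolding E_def using Ck_on_imp_continuous_on[OF Ck_on_compose[OF oI' Ck_on_hder[OF C2] z1 zs]] cp'
      by (intro continuous_on_diff) auto
    have "E t0 = 0"
    proof (rule ccontr)
      assume E0: "E t0 \<noteq> 0"
      \<comment> \<open>The factor \<open>E t0\<close> treats both signs of the defect at once.\<close>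
      have "open (I' \<inter> (\<lambda>t. E t * E t0) -` {0<..})"
        by (rule continuous_open_preimage[OF _ oI']) (auto intro!: continuous_intros cE)
      moreover have "t0 \<in> I' \<inter> (\<lambda>t. E t * E t0) -` {0<..}" using t0' E0 by (auto simp: zero_less_mult_iff)
      ultimately obtain \<rho> where \<rho>: "\<rho> > 0" "ball t0 \<rho> \<subseteq> I' \<inter> (\<lambda>t. E t * E t0) -` {0<..}" by (meson openE)
      define a where "a = t0 - \<rho> / 2"
      define b where "b = t0 + \<rho> / 2"
      have ab: "a < b" "t0 \<in> {a<..<b}" and abb: "{a..b} \<subseteq> ball t0 \<rho>"
        using \<rho>(1) by (auto simp: a_def b_def dist_real_def abs_less_iff)
      have ab': "{a..b} \<subseteq> I'" using abb \<rho>(2) by blast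
      have abI: "{a..b} \<subseteq> I" using ab' by (auto simp: I'_def)
      note B = bump_properties[OF ab(1)]
      define \<phi> where "\<phi> = bump a b"
      have phi2: "Ck_on 2 \<phi> S" for S unfolding \<phi>_def by (rule B(1))
      define \<phi>' where "\<phi>' = (\<lambda>t. vector_derivative \<phi> (at t))"
      have phi2': "Ck_on (Suc 1) \<phi> UNIV" using phi2 by (simp only: numeral_2_eq_2 One_nat_def)
      have dphi: "(\<phi> has_vector_derivative \<phi>' t) (at t)" for t
        unfolding \<phi>'_def by (rule Ck_on_real_SucD(1)[OF phi2' open_UNIV UNIV_I])
      have cphi: "continuous_on S \<phi>" for S by (rule Ck_on_imp_continuous_on[OF phi2])
      define y where "y = (\<lambda>(s, r). x r + (s * \<phi> r) *\<^sub>R e)"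
      have y2: "Ck_on 2 y (UNIV \<times> I')"
      proof -
        have o: "open ((UNIV :: real set) \<times> I')" by (intro open_Times oI' open_UNIV)
        have f1: "Ck_on 2 fst ((UNIV :: real set) \<times> I')" and f2: "Ck_on 2 snd ((UNIV :: real set) \<times> I')"
          by (intro Ck_on_bounded_linear_id o bounded_linear_fst bounded_linear_snd)+
        have "Ck_on 2 (\<lambda>z. x (snd z) + (fst z * \<phi> (snd z)) *\<^sub>R e) ((UNIV :: real set) \<times> I')"
          by (intro Ck_on_add o Ck_on_compose[OF o x2 f2] Ck_on_bounded_linear[OF bounded_linear_scaleR_left o]
            Ck_on_bilinear[OF bounded_bilinear_mult o f1] Ck_on_compose[OF o phi2[of UNIV] f2]) auto
        then show ?thesis by (simp add: y_def case_prod_unfold)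
      qed
      have oy: "open ((UNIV \<times> I') \<inter> y -` chart_range c)"
        by (rule continuous_open_preimage[OF Ck_on_imp_continuous_on[OF y2] _ chart_facts(2)[OF c(1)]])
          (intro open_Times oI' open_UNIV)
      have "{0} \<times> {a..b} \<subseteq> (UNIV \<times> I') \<inter> y -` chart_range c"
        using ab' xr by (auto simp: y_def)
      from Elementary_Topology.tube_lemma[OF compact_Icc oy this]
      obtain X0 where X0: "0 \<in> X0" "open X0" "X0 \<times> {a..b} \<subseteq> (UNIV \<times> I') \<inter> y -` chart_range c"
        by blast
      obtain \<epsilon> where \<epsilon>: "\<epsilon> > 0" "ball 0 \<epsilon> \<subseteq> X0" using X0 by (meson openE)
      have yr: "y (s, r) \<in> chart_range c" if s: "s \<in> {-\<epsilon><..<\<epsilon>}" and r: "r \<in> I'" for s r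
      proof (cases "r \<in> {a..b}")
        case True
        have "s \<in> X0" using s \<epsilon> by (auto simp: dist_real_def subset_eq)
        then show ?thesis using X0(3) True by blast
      next
        case False
        then have "\<phi> r = 0" unfolding \<phi>_def by (intro B(3)) auto
        then show ?thesis using xr[OF r] by (simp add: y_def)
      qed
      define \<Gamma> where "\<Gamma> = (\<lambda>(s, r). if r \<in> ball t0 \<rho> then chart_inv c (y (s, r)) else \<gamma> r)"
      let ?U = "{-\<epsilon><..<\<epsilon>} \<times> I"
      have \<Gamma>in: "\<Gamma> (s, r) = chart_inv c (y (s, r))" if "r \<in> ball t0 \<rho>" for s r using that by (simp add: \<Gamma>_def)
      have y0: "chart_inv c (y (s, r)) = \<gamma> r" if "r \<in> I'" "s = 0 \<or> r \<notin> {a<..<b}" for s r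
      proof -
        have "y (s, r) = x r" using that B(3)[of r] by (auto simp: y_def \<phi>_def)
        then show ?thesis using that chart_facts(5)[OF c(1)] by (simp add: x_def I'_def)
      qed
      have bI: "r \<in> I'" if "r \<in> ball t0 \<rho>" for r using \<rho>(2) that by blast
      have \<Gamma>out: "\<Gamma> (s, r) = \<gamma> r" if "s = 0 \<or> r \<notin> {a<..<b}" for s r
        using y0[OF bI that] by (simp add: \<Gamma>_def)
      have \<Gamma>2: "Ck_map A 2 ?U \<Gamma>"
      proof (rule Ck_map_local)
        fix z assume z: "z \<in> ?U"
        obtain s r where sr: "z = (s, r)" by (cases z)
        show "\<exists>T. open T \<and> z \<in> T \<and> Ck_map A 2 T \<Gamma>"
        proof (cases "r \<in> {a..b}")
          case True
          let ?T = "{-\<epsilon><..<\<epsilon>} \<times> ball t0 \<rho>"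
          have T: "open ?T" by (intro open_Times) auto
          have TT: "?T \<subseteq> UNIV \<times> I'" using bI by auto
          have "Ck_map A 2 ?T (\<lambda>z. chart_inv c (y z))"
            by (rule Ck_map_chart_inv[OF c(1) T Ck_on_subset[OF y2 TT]]) (use yr bI in auto)
          then have "Ck_map A 2 ?T \<Gamma>" by (rule Ck_map_cong[OF T]) (auto simp: \<Gamma>_def)
          moreover have "z \<in> ?T" using z sr True abb by auto
          ultimately show ?thesis using T by blast
        next
          case False
          let ?T = "{-\<epsilon><..<\<epsilon>} \<times> (I - {a..b})"
          have T: "open ?T" by (intro open_Times open_Diff oI) auto
          have "Ck_map A 2 ?T (\<lambda>z. \<gamma> (snd z))"
            by (rule Ck_map_compose[OF \<gamma> oI T Ck_on_bounded_linear_id[OF T bounded_linear_snd]]) auto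
          then have "Ck_map A 2 ?T \<Gamma>" by (rule Ck_map_cong[OF T]) (auto simp: \<Gamma>out)
          moreover have "z \<in> ?T" using z sr False by auto
          ultimately show ?thesis using T by blast
        qed
      qed
      have var: "variation A I \<gamma> a b \<epsilon> \<Gamma>"
        unfolding variation_def using \<Gamma>2 \<Gamma>out by auto
      have vel: "velocity A (\<lambda>r. \<Gamma> (0, r)) t = velocity A \<gamma> t" if "t \<in> I" for t
        by (rule velocity_cong[OF oI that]) (simp add: \<Gamma>out)
      have ne0: "snd (velocity A (\<lambda>r. \<Gamma> (0, r)) t) \<noteq> (\<lambda>_. 0)" if "t \<in> {a..b}" for t
      proof -
        have "t \<in> I" using that abI by blast
        then show ?thesis using vel ne by simp
      qed
      obtain H where H: "continuous_on {a..b} H"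
        and HD: "((\<lambda>s. integral {a..b} (\<lambda>t. F (velocity A (\<lambda>r. \<Gamma> (s, r)) t))) has_real_derivative integral {a..b} H) (at 0)"
        and Hc: "\<And>t c. t \<in> {a..b} \<Longrightarrow> c \<in> A \<Longrightarrow> \<Gamma> (0, t) \<in> chart_dom c \<Longrightarrow>
          H t = hder (local_rep F c) (chart_map c (\<Gamma> (0, t)), frechet_derivative (chart_map c \<circ> \<Gamma>) (at (0, t)) (0, 1))
              (frechet_derivative (chart_map c \<circ> \<Gamma>) (at (0, t)) (1, 0))
            + vder (local_rep F c) (chart_map c (\<Gamma> (0, t)), frechet_derivative (chart_map c \<circ> \<Gamma>) (at (0, t)) (0, 1))
              (frechet_derivative (\<lambda>y. frechet_derivative (chart_map c \<circ> \<Gamma>) (at y) (0, 1)) (at (0, t)) (1, 0))"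
        using first_variation[OF F \<Gamma>2 oI \<epsilon>(1) ab(1) abI ne0] by blast
      have "((\<lambda>s. integral {a..b} (\<lambda>t. F (velocity A (\<lambda>r. \<Gamma> (s, r)) t))) has_real_derivative 0) (at 0)"
        using ext ab(1) abI \<epsilon>(1) var unfolding extremal_def by blast
      with HD have H0: "integral {a..b} H = 0" by (rule DERIV_unique)
      let ?P = "?U \<inter> \<Gamma> -` chart_dom c" and ?X = "chart_map c \<circ> \<Gamma>"
      let ?Q = "{-\<epsilon><..<\<epsilon>} \<times> ball t0 \<rho>"
      note V = variation_integrand[OF F \<Gamma>2 oI c(1)]
      have QX: "?X (s, r) = x r + (s * \<phi> r) *\<^sub>R e" and QP: "(s, r) \<in> ?P" if "(s, r) \<in> ?Q" for s r
        using that yr[of s r] bI[of r] chart_facts(7,8)[OF c(1), of "y (s, r)"] \<Gamma>in[of r s]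
        by (auto simp: y_def I'_def)
      have Xt: "frechet_derivative ?X (at (s, r)) (0, 1) = v r + (s * \<phi>' r) *\<^sub>R e" if Q: "(s, r) \<in> ?Q" for s r
      proof (rule vector_derivative_unique_at[OF V(4)[OF QP[OF Q]]])
        have "((\<lambda>r. x r + (s * \<phi> r) *\<^sub>R e) has_vector_derivative v r + (s * \<phi>' r) *\<^sub>R e) (at r)"
        proof (intro has_vector_derivative_add dx)
          show "r \<in> I'" using Q bI by auto
          have "((\<lambda>r. s * \<phi> r) has_vector_derivative s * \<phi>' r) (at r)"
            using dphi by (auto intro!: has_vector_derivative_mult_right)
          from bounded_linear.has_vector_derivative[OF bounded_linear_scaleR_left this]
          show "((\<lambda>r. (s * \<phi> r) *\<^sub>R e) has_vector_derivative (s * \<phi>' r) *\<^sub>R e) (at r)" .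
        qed
        then show "((\<lambda>r. ?X (s, r)) has_vector_derivative v r + (s * \<phi>' r) *\<^sub>R e) (at r)"
          by (rule has_vector_derivative_transform_within_open[where S = "ball t0 \<rho>"])
            (use Q QX in auto)
      qed
      have Q0: "(0, r) \<in> ?Q" if "r \<in> {a..b}" for r using that abb \<epsilon>(1) by auto
      have Xs: "frechet_derivative ?X (at (0, r)) (1, 0) = \<phi> r *\<^sub>R e" if r: "r \<in> {a..b}" for r
      proof (rule vector_derivative_unique_at[OF V(5)[OF QP[OF Q0[OF r]]]])
        have "((\<lambda>s. x r + (s * \<phi> r) *\<^sub>R e) has_vector_derivative \<phi> r *\<^sub>R e) (at 0)"
          by (auto intro!: derivative_eq_intros)
        then show "((\<lambda>s. ?X (s, r)) has_vector_derivative \<phi> r *\<^sub>R e) (at 0)"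
          by (rule has_vector_derivative_transform_within_open[where S = "{-\<epsilon><..<\<epsilon>}"])
            (use Q0[OF r] QX in auto)
      qed
      have Xts: "frechet_derivative (\<lambda>y. frechet_derivative ?X (at y) (0, 1)) (at (0, r)) (1, 0) = \<phi>' r *\<^sub>R e" if r: "r \<in> {a..b}" for r
      proof -
        have "Ck_on (Suc 0) (\<lambda>y. frechet_derivative ?X (at y) (0, 1)) ?P" using V(3) by simp
        note d = Ck_on_SucD(1)[OF this QP[OF Q0[OF r]]]
        have "((\<lambda>s. (s, r)) has_vector_derivative (1::real, 0::real)) (at 0)" by (auto intro!: derivative_eq_intros)
        from vector_derivative_diff_chain_within[OF this has_derivative_at_withinI[OF d]]
        have "((\<lambda>s. frechet_derivative ?X (at (s, r)) (0, 1)) has_vector_derivative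
            frechet_derivative (\<lambda>y. frechet_derivative ?X (at y) (0, 1)) (at (0, r)) (1, 0)) (at 0)" by (simp add: o_def)
        moreover have "((\<lambda>s. v r + (s * \<phi>' r) *\<^sub>R e) has_vector_derivative \<phi>' r *\<^sub>R e) (at 0)"
          by (auto intro!: derivative_eq_intros)
        then have "((\<lambda>s. frechet_derivative ?X (at (s, r)) (0, 1)) has_vector_derivative \<phi>' r *\<^sub>R e) (at 0)"
          by (rule has_vector_derivative_transform_within_open[where S = "{-\<epsilon><..<\<epsilon>}"])
            (use Q0[OF r] Xt in auto)
        ultimately show ?thesis by (rule vector_derivative_unique_at)
      qed
      have Hr: "H r = \<phi> r * hder ?f (x r, v r) e + \<phi>' r * p r" if r: "r \<in> {a..b}" for r
      proof -
        have rI: "r \<in> I'" using ab' r by blast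
        have "\<Gamma> (0, r) = \<gamma> r" by (simp add: \<Gamma>out)
        then have "\<Gamma> (0, r) \<in> chart_dom c" "chart_map c (\<Gamma> (0, r)) = x r" using rI by (auto simp: I'_def x_def)
        then show ?thesis
          using Hc[OF r c(1)] Xt[OF Q0[OF r]] linear_cmul[OF linear_hder[OF df[OF rI]]] linear_cmul[OF linear_vder[OF df[OF rI]]]
          by (simp add: Xs[OF r] Xts[OF r] p_def)
      qed
      have "((\<lambda>r. \<phi> r * p r) has_vector_derivative \<phi> r * p' r + \<phi>' r * p r) (at r within {a..b})" if "r \<in> {a..b}" for r
        by (rule has_vector_derivative_at_within[OF has_vector_derivative_mult[OF dphi dp]]) (use ab' that in blast)
      from fundamental_theorem_of_calculus[OF less_imp_le[OF ab(1)] this]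
      have "((\<lambda>r. \<phi> r * p' r + \<phi>' r * p r) has_integral 0) {a..b}"
        using B(3)[of a] B(3)[of b] by (simp add: \<phi>_def)
      moreover have "(H has_integral 0) {a..b}"
        using integrable_integral[OF integrable_continuous_real[OF H]] H0 by simp
      ultimately have "((\<lambda>r. H r - (\<phi> r * p' r + \<phi>' r * p r)) has_integral 0 - 0) {a..b}"
        by (intro has_integral_diff)
      then have "((\<lambda>r. \<phi> r * E r) has_integral 0) {a..b}"
        by (rule has_integral_eq[rotated, where f = "\<lambda>r. H r - (\<phi> r * p' r + \<phi>' r * p r)", THEN has_integral_eq_rhs])
          (simp_all add: Hr E_def algebra_simps)
      from has_integral_mult_left[OF this, of "E t0"]
      have "((\<lambda>r. \<phi> r * E r * E t0) has_integral 0) {a..b}" by simp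
      then have int: "integral {a..b} (\<lambda>r. \<phi> r * E r * E t0) = 0" by (rule integral_unique)
      have cont: "continuous_on {a..b} (\<lambda>r. \<phi> r * E r * E t0)"
        by (intro continuous_intros cphi continuous_on_subset[OF cE ab'])
      have pos: "E r * E t0 > 0" if "r \<in> {a..b}" for r using \<rho>(2) abb that by auto
      have nn: "0 \<le> \<phi> r * E r * E t0" if "r \<in> {a..b}" for r
        using mult_nonneg_nonneg[OF B(2)[of r] less_imp_le[OF pos[OF that]]] by (simp add: \<phi>_def mult.assoc)
      have "\<forall>r\<in>{a..b}. \<phi> r * E r * E t0 = 0"
        using integral_eq_0_iff[OF cont ab(1) nn] int by blast
      moreover have "t0 \<in> {a..b}" using ab(2) by simp
      ultimately have "\<phi> t0 * E t0 * E t0 = 0" by (rule bspec)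
      then show False using B(4)[OF ab(2)] E0 by (simp add: \<phi>_def)
    qed
    then have "p' t0 = hder ?f (x t0, v t0) e" by (simp add: E_def)
    then show "((\<lambda>r. vder ?f (x r, vector_derivative x (at r)) e) has_real_derivative
        hder ?f (x t0, vector_derivative x (at t0)) e) (at t0)"
      using dp[OF t0'] by (simp add: p_def v_def has_real_derivative_iff_has_vector_derivative)
  qed
qed

end

section \<open>Reparametrization and maximal extension of extremals\<close>

lemma EL_cong:
  assumes "open S" "t \<in> S" "\<And>s. s \<in> S \<Longrightarrow> x s = y s" and EL: "EL f x t"
  shows "EL f y t"
proof -
  have v: "vector_derivative x (at s) = vector_derivative y (at s)" if "s \<in> S" for s
    by (rule vector_derivative_cong_open[OF assms(1) that assms(3)])
  show ?thesis
    unfolding EL_def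
  proof
    fix e
    have "((\<lambda>r. vder f (x r, vector_derivative x (at r)) e) has_real_derivative
        hder f (x t, vector_derivative x (at t)) e) (at t)" using EL by (simp add: EL_def)
    then have "((\<lambda>r. vder f (x r, vector_derivative x (at r)) e) has_real_derivative
        hder f (y t, vector_derivative y (at t)) e) (at t)" using v[OF assms(2)] assms(3)[OF assms(2)] by simp
    then show "((\<lambda>r. vder f (y r, vector_derivative y (at r)) e) has_real_derivative
        hder f (y t, vector_derivative y (at t)) e) (at t)"
      by (rule has_field_derivative_transform_within_open[OF _ assms(1,2)]) (simp add: v assms(3))
  qed
qed

lemma antiderivative_on_open_interval:
  fixes \<sigma> :: "real \<Rightarrow> real"
  assumes J: "open J" "is_interval J" and \<sigma>: "continuous_on J \<sigma>" and r1: "r1 \<in> J"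
  shows "\<exists>s. s r1 = c \<and> (\<forall>r\<in>J. (s has_vector_derivative \<sigma> r) (at r))"
proof -
  define s where "s = (\<lambda>r. c + (integral {r1..r} \<sigma> - integral {r..r1} \<sigma>))"
  have "(s has_vector_derivative \<sigma> r) (at r)" if r: "r \<in> J" for r
  proof -
    obtain e1 where e1: "e1 > 0" "cball r e1 \<subseteq> J" using J(1) r by (meson open_contains_cball)
    obtain e2 where e2: "e2 > 0" "cball r1 e2 \<subseteq> J" using J(1) r1 by (meson open_contains_cball)
    define p where "p = min (r - e1) (r1 - e2)"
    define q where "q = max (r + e1) (r1 + e2)"
    have "r - e1 \<in> J" "r + e1 \<in> J" "r1 - e2 \<in> J" "r1 + e2 \<in> J" using e1 e2 by (auto simp: dist_real_def subset_eq)
    then have "p \<in> J" "q \<in> J" by (auto simp: p_def q_def min_def max_def)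
    then have pq: "{p..q} \<subseteq> J" using J(2) by (meson atLeastAtMost_iff is_interval_1 subsetI)
    have in_pq: "r \<in> {p<..<q}" "r1 \<in> {p<..<q}" using e1(1) e2(1) by (auto simp: p_def q_def)
    have cont: "continuous_on {p..q} \<sigma>" by (rule continuous_on_subset[OF \<sigma> pq])
    have int: "\<sigma> integrable_on {u..v}" if "p \<le> u" "v \<le> q" for u v
      by (rule integrable_continuous_real[OF continuous_on_subset[OF cont]]) (use that in auto)
    have eq: "c + (integral {p..t} \<sigma> - integral {p..r1} \<sigma>) = s t" if t: "t \<in> {p<..<q}" for t
    proof (cases "r1 \<le> t")
      case True
      have "integral {p..r1} \<sigma> + integral {r1..t} \<sigma> = integral {p..t} \<sigma>"
        using in_pq t True by (intro Henstock_Kurzweil_Integration.integral_combine int) auto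
      moreover have "integral {t..r1} \<sigma> = 0" using True by (cases "t = r1") auto
      ultimately show ?thesis by (simp add: s_def)
    next
      case False
      have "integral {p..t} \<sigma> + integral {t..r1} \<sigma> = integral {p..r1} \<sigma>"
        using in_pq t False by (intro Henstock_Kurzweil_Integration.integral_combine int) auto
      moreover have "integral {r1..t} \<sigma> = 0" using False by simp
      ultimately show ?thesis by (simp add: s_def)
    qed
    have "((\<lambda>t. integral {p..t} \<sigma>) has_vector_derivative \<sigma> r) (at r within {p..q})"
      using integral_has_vector_derivative[OF cont] in_pq by auto
    moreover have "at r within {p..q} = at r" using in_pq by (intro at_within_interior) auto
    ultimately have d: "((\<lambda>t. integral {p..t} \<sigma>) has_vector_derivative \<sigma> r) (at r)" by simp
    have "((\<lambda>t. c + (integral {p..t} \<sigma> - integral {p..r1} \<sigma>)) has_vector_derivative \<sigma> r) (at r)"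
      using has_vector_derivative_add[OF has_vector_derivative_const has_vector_derivative_diff[OF d has_vector_derivative_const]]
      by simp
    then show ?thesis
      by (rule has_vector_derivative_transform_within_open[OF _ open_greaterThanLessThan in_pq(1) eq])
  qed
  moreover have "s r1 = c" by (simp add: s_def)
  ultimately show ?thesis by blast
qed

lemma inverse_of_increasing:
  fixes s :: "real \<Rightarrow> real"
  assumes J: "open J" "is_interval J" and \<sigma>: "Ck_on 1 \<sigma> J" "\<And>r. r \<in> J \<Longrightarrow> \<sigma> r > 0"
    and s: "\<And>r. r \<in> J \<Longrightarrow> (s has_vector_derivative \<sigma> r) (at r)"
  shows "\<exists>\<psi>. open (s ` J) \<and> is_interval (s ` J) \<and> Ck_on 2 \<psi> (s ` J) \<and> (\<forall>r\<in>J. \<psi> (s r) = r) \<and>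
    (\<forall>t\<in>s ` J. (\<psi> has_vector_derivative inverse (\<sigma> (\<psi> t))) (at t))"
proof -
  have ds: "(s has_real_derivative \<sigma> r) (at r)" if "r \<in> J" for r
    using s[OF that] by (simp add: has_real_derivative_iff_has_vector_derivative)
  have cs: "continuous_on J s" by (intro continuous_at_imp_continuous_on ballI DERIV_isCont[OF ds])
  have mono: "s r < s r'" if "r \<in> J" "r' \<in> J" "r < r'" for r r'
  proof (rule DERIV_pos_imp_increasing[OF that(3)])
    fix z assume "r \<le> z" "z \<le> r'"
    then have "z \<in> J" using J(2) that by (meson is_interval_1)
    then show "\<exists>y. (s has_real_derivative y) (at z) \<and> 0 < y" using ds \<sigma>(2) by blast
  qed
  have inj: "inj_on s J" using mono by (intro linorder_inj_onI) (auto simp: less_imp_neq)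
  have o: "open (s ` J)" by (rule injective_into_1d_imp_open_map_UNIV[OF J(1) cs inj order_refl])
  have "connected J" using J(2) by (simp add: is_interval_connected_1)
  then have int: "is_interval (s ` J)" using connected_continuous_image[OF cs] by (simp add: is_interval_connected_1)
  define \<psi> where "\<psi> = inv_into J s"
  have \<psi>: "\<psi> (s r) = r" if "r \<in> J" for r using inj that by (simp add: \<psi>_def)
  have sp: "s (\<psi> t) = t" "\<psi> t \<in> J" if "t \<in> s ` J" for t
    using that by (auto simp: \<psi>_def f_inv_into_f inv_into_into)
  have cpsi: "continuous_on (s ` J) \<psi>"
    unfolding continuous_on_open_vimage[OF o]
  proof (intro allI impI)
    fix B :: "real set" assume B: "open B"
    have "\<psi> -` B \<inter> s ` J = s ` (J \<inter> B)" using \<psi> sp by auto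
    then show "open (\<psi> -` B \<inter> s ` J)"
      using injective_into_1d_imp_open_map_UNIV[OF open_Int[OF J(1) B] cs inj] by auto
  qed
  have d\<psi>: "(\<psi> has_vector_derivative inverse (\<sigma> (\<psi> t))) (at t)" if t: "t \<in> s ` J" for t
  proof -
    obtain e where e: "e > 0" "ball t e \<subseteq> s ` J" using o t by (meson openE)
    have "(\<psi> has_real_derivative inverse (\<sigma> (\<psi> t))) (at t)"
    proof (rule DERIV_inverse_function[where f = s and a = "t - e" and b = "t + e"])
      show "(s has_real_derivative \<sigma> (\<psi> t)) (at (\<psi> t))" by (rule ds[OF sp(2)[OF t]])
      show "\<sigma> (\<psi> t) \<noteq> 0" using \<sigma>(2)[OF sp(2)[OF t]] by simp
      show "s (\<psi> y) = y" if "t - e < y" "y < t + e" for y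
        by (rule sp(1)) (use that e in \<open>auto simp: subset_eq dist_real_def abs_less_iff\<close>)
      show "isCont \<psi> t" using cpsi t unfolding continuous_on_eq_continuous_at[OF o] by blast
    qed (use e in auto)
    then show ?thesis by (simp add: has_real_derivative_iff_has_vector_derivative)
  qed
  have psiJ: "\<psi> ` (s ` J) \<subseteq> J" using sp by auto
  have "continuous_on (s ` J) (\<lambda>t. inverse (\<sigma> (\<psi> t)))"
    using sp \<sigma>(2) by (intro continuous_on_inverse continuous_on_compose2[OF Ck_on_imp_continuous_on[OF \<sigma>(1)] cpsi psiJ]) force
  then have "Ck_on (Suc 0) \<psi> (s ` J)" by (intro Ck_on_real_SucI[OF o d\<psi>]) auto
  then have p1: "Ck_on 1 \<psi> (s ` J)" by simp
  have "Ck_on 1 (\<lambda>t. inverse (\<sigma> (\<psi> t))) (s ` J)"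
  proof (rule Ck_on_compose[OF o Ck_on_inverse])
    show "Ck_on 1 (\<lambda>t. \<sigma> (\<psi> t)) (s ` J)" by (rule Ck_on_compose[OF o \<sigma>(1) p1 psiJ])
    show "(\<lambda>t. \<sigma> (\<psi> t)) ` s ` J \<subseteq> - {0}" using sp \<sigma>(2) by force
  qed
  then have "Ck_on (Suc 1) \<psi> (s ` J)" by (intro Ck_on_real_SucI[OF o d\<psi>])
  then have "Ck_on 2 \<psi> (s ` J)" by (simp only: numeral_2_eq_2 One_nat_def)
  then show ?thesis using o int \<psi> d\<psi> by blast
qed

context smooth_manifold
begin

lemma extremal_iff_EL:
  assumes F: "C2_finsler A F"
  shows "extremal A F I \<gamma> \<longleftrightarrow> open_interval I \<and> Ck_map A 2 I \<gamma> \<and> (\<forall>t\<in>I. snd (velocity A \<gamma> t) \<noteq> (\<lambda>_. 0)) \<and>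
    (\<forall>t\<in>I. \<exists>c\<in>A. \<gamma> t \<in> chart_dom c \<and> EL (local_rep F c) (chart_map c \<circ> \<gamma>) t)" (is "?E \<longleftrightarrow> ?R")
proof
  assume E: ?E
  have "\<exists>c\<in>A. \<gamma> t \<in> chart_dom c \<and> EL (local_rep F c) (chart_map c \<circ> \<gamma>) t" if "t \<in> I" for t
    using extremal_imp_EL[OF F E that] ex_chart[of "\<gamma> t"] by blast
  then show ?R using E unfolding extremal_def by blast
next
  assume R: ?R
  show ?E by (rule EL_imp_extremal[OF F]) (use R in blast)+
qed

lemma extremalD:
  assumes "extremal A F I \<gamma>"
  shows "open I" "is_interval I" "I \<noteq> {}" "Ck_map A 2 I \<gamma>" "\<And>t. t \<in> I \<Longrightarrow> snd (velocity A \<gamma> t) \<noteq> (\<lambda>_. 0)"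
  using assms by (auto simp: extremal_def open_interval_def)

text \<open>The Euler-Lagrange equations, unlike the definition of extremals by variations, are visibly local.\<close>

lemma extremal_glue:
  assumes F: "C2_finsler A F" and I: "open_interval I"
    and loc: "\<And>t. t \<in> I \<Longrightarrow> \<exists>J \<delta>. t \<in> J \<and> extremal A F J \<delta> \<and> (\<forall>s\<in>J. \<gamma> s = \<delta> s)"
  shows "extremal A F I \<gamma>"
  unfolding extremal_iff_EL[OF F]
proof (intro conjI ballI I)
  show "Ck_map A 2 I \<gamma>"
  proof (rule Ck_map_local)
    fix t assume "t \<in> I"
    then obtain J \<delta> where J: "t \<in> J" "extremal A F J \<delta>" "\<And>s. s \<in> J \<Longrightarrow> \<delta> s = \<gamma> s" using loc by metis
    show "\<exists>T. open T \<and> t \<in> T \<and> Ck_map A 2 T \<gamma>"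
      using Ck_map_cong[OF extremalD(1,4)[OF J(2)] J(3)] extremalD(1)[OF J(2)] J(1) by blast
  qed
  fix t assume "t \<in> I"
  then obtain J \<delta> where J: "t \<in> J" "extremal A F J \<delta>" "\<And>s. s \<in> J \<Longrightarrow> \<delta> s = \<gamma> s" using loc by metis
  show "snd (velocity A \<gamma> t) \<noteq> (\<lambda>_. 0)"
    using extremalD(5)[OF J(2,1)] velocity_cong[OF extremalD(1)[OF J(2)] J(1,3)] by simp
  obtain c where c: "c \<in> A" "\<gamma> t \<in> chart_dom c" using ex_chart by blast
  have "EL (local_rep F c) (chart_map c \<circ> \<delta>) t"
    by (rule extremal_imp_EL[OF F J(2,1) c(1)]) (use c(2) J(1,3) in simp)
  then have "EL (local_rep F c) (chart_map c \<circ> \<gamma>) t"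
    by (rule EL_cong[OF extremalD(1)[OF J(2)] J(1), rotated]) (simp add: J(3))
  then show "\<exists>c\<in>A. \<gamma> t \<in> chart_dom c \<and> EL (local_rep F c) (chart_map c \<circ> \<gamma>) t" using c by blast
qed

lemma extremal_reparametrize:
  assumes F: "C2_finsler A F" and \<delta>: "extremal A F J \<delta>" and I: "open_interval I"
    and \<phi>: "Ck_on 2 \<phi> I" "\<And>t. t \<in> I \<Longrightarrow> vector_derivative \<phi> (at t) > 0" "\<phi> ` I \<subseteq> J"
  shows "extremal A F I (\<lambda>t. \<delta> (\<phi> t))"
    "\<And>t. t \<in> I \<Longrightarrow> F (velocity A (\<lambda>t. \<delta> (\<phi> t)) t) = vector_derivative \<phi> (at t) * F (velocity A \<delta> (\<phi> t))"
proof -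
  have oI: "open I" using I by (simp add: open_interval_def)
  note D = extremalD[OF \<delta>]
  let ?\<gamma> = "\<lambda>t. \<delta> (\<phi> t)"
  have \<gamma>: "Ck_map A 2 I ?\<gamma>" by (rule Ck_map_compose[OF D(4,1) oI \<phi>(1,3)])
  have phi2: "Ck_on (Suc 1) \<phi> I" using \<phi>(1) by (simp only: numeral_2_eq_2 One_nat_def)
  have loc: "snd (velocity A ?\<gamma> t) \<noteq> (\<lambda>_. 0) \<and> EL (local_rep F c) (chart_map c \<circ> ?\<gamma>) t \<and>
      F (velocity A ?\<gamma> t) = vector_derivative \<phi> (at t) * F (velocity A \<delta> (\<phi> t))"
    if t: "t \<in> I" and c: "c \<in> A" "?\<gamma> t \<in> chart_dom c" for t c
  proof -
    define x where "x = chart_map c \<circ> \<delta>"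
    define J' where "J' = J \<inter> \<delta> -` chart_dom c"
    define I' where "I' = I \<inter> ?\<gamma> -` chart_dom c"
    have pt: "\<phi> t \<in> J" using \<phi>(3) t by blast
    have oJ': "open J'" unfolding J'_def by (rule open_chart_preimage[OF D(1,4) c(1)])
    have oI': "open I'" unfolding I'_def by (rule open_chart_preimage[OF oI \<gamma> c(1)])
    have tI': "t \<in> I'" using t c by (simp add: I'_def)
    have pI': "\<phi> ` I' \<subseteq> J'" using \<phi>(3) by (auto simp: I'_def J'_def)
    have slit: "(x r, vector_derivative x (at r)) \<in> slit c" if "r \<in> J'" for r
      using velocity_nonzero_iff[OF D(1,4) _ c(1), of r] D(5)[of r] chart_facts(6)[OF c(1)] that
      by (auto simp: J'_def x_def)
    have x1: "Ck_on 1 x J'" unfolding x_def J'_def by (rule Ck_on_le[OF Ck_on_chart_curve[OF D(4) c(1)]]) simp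
    have "EL (local_rep F c) (x \<circ> \<phi>) t"
    proof (rule EL_reparametrize[OF finsler_local(5)[OF F c(1)] oJ' oI' tI' x1 _ pI' _ slit])
      show "EL (local_rep F c) x (\<phi> t)" unfolding x_def by (rule extremal_imp_EL[OF F \<delta> pt c])
      show "Ck_on 1 \<phi> I'" by (rule Ck_on_subset[OF Ck_on_le[OF \<phi>(1)]]) (auto simp: I'_def)
      show "vector_derivative \<phi> (at s) > 0" if "s \<in> I'" for s using that \<phi>(2) by (simp add: I'_def)
    qed
    then have EL: "EL (local_rep F c) (chart_map c \<circ> ?\<gamma>) t" by (simp add: x_def o_def)
    have vd: "vector_derivative (chart_map c \<circ> ?\<gamma>) (at t) = vector_derivative \<phi> (at t) *\<^sub>R vector_derivative x (at (\<phi> t))"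
    proof (rule vector_derivative_at)
      show "((chart_map c \<circ> ?\<gamma>) has_vector_derivative vector_derivative \<phi> (at t) *\<^sub>R vector_derivative x (at (\<phi> t))) (at t)"
        using vector_diff_chain_at[OF Ck_on_real_SucD(1)[OF phi2 oI t] chart_curve_derivative[OF D(1,4) pt c]]
        by (simp add: x_def o_def)
    qed
    have pJ': "\<phi> t \<in> J'" using pI' tI' by blast
    have "snd (velocity A ?\<gamma> t) \<noteq> (\<lambda>_. 0)"
      unfolding velocity_nonzero_iff[OF oI \<gamma> t c] vd using slit[OF pJ'] \<phi>(2)[OF t] by auto
    moreover have "F (velocity A ?\<gamma> t) = vector_derivative \<phi> (at t) * F (velocity A \<delta> (\<phi> t))"
      unfolding velocity_coordinates[OF oI \<gamma> t c] velocity_coordinates[OF D(1,4) pt c] vd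
      using finsler_local(2)[OF F c(1) chart_facts(6)[OF c]] \<phi>(2)[OF t] by (simp add: x_def)
    ultimately show ?thesis using EL by blast
  qed
  show "extremal A F I ?\<gamma>"
  proof (rule EL_imp_extremal[OF F I \<gamma>])
    fix t assume t: "t \<in> I"
    obtain c where c: "c \<in> A" "?\<gamma> t \<in> chart_dom c" using ex_chart by blast
    show "snd (velocity A ?\<gamma> t) \<noteq> (\<lambda>_. 0)" using loc[OF t c] by blast
    show "\<exists>c\<in>A. ?\<gamma> t \<in> chart_dom c \<and> EL (local_rep F c) (chart_map c \<circ> ?\<gamma>) t" using loc[OF t c] c by blast
  qed
  fix t assume t: "t \<in> I"
  obtain c where c: "c \<in> A" "?\<gamma> t \<in> chart_dom c" using ex_chart by blast
  show "F (velocity A ?\<gamma> t) = vector_derivative \<phi> (at t) * F (velocity A \<delta> (\<phi> t))" using loc[OF t c] by blast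
qed

lemma speed_C1:
  assumes F: "C2_finsler A F" and \<delta>: "extremal A F J \<delta>"
  shows "Ck_on 1 (\<lambda>t. F (velocity A \<delta> t)) J" "\<And>t. t \<in> J \<Longrightarrow> F (velocity A \<delta> t) > 0"
proof -
  note D = extremalD[OF \<delta>]
  have loc: "F (velocity A \<delta> t) > 0 \<and> (\<exists>T. open T \<and> t \<in> T \<and> Ck_on 1 (\<lambda>t. F (velocity A \<delta> t)) T)" if t: "t \<in> J" for t
  proof -
    obtain c where c: "c \<in> A" "\<delta> t \<in> chart_dom c" using ex_chart by blast
    define x where "x = chart_map c \<circ> \<delta>"
    define J' where "J' = J \<inter> \<delta> -` chart_dom c"
    have oJ': "open J'" unfolding J'_def by (rule open_chart_preimage[OF D(1,4) c(1)])
    have tJ': "t \<in> J'" using t c by (simp add: J'_def)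
    have slit: "(x r, vector_derivative x (at r)) \<in> slit c" if "r \<in> J'" for r
      using velocity_nonzero_iff[OF D(1,4) _ c(1), of r] D(5)[of r] chart_facts(6)[OF c(1)] that
      by (auto simp: J'_def x_def)
    have x2: "Ck_on 2 x J'" unfolding x_def J'_def by (rule Ck_on_chart_curve[OF D(4) c(1)])
    then have x2': "Ck_on (Suc 1) x J'" by (simp only: numeral_2_eq_2 One_nat_def)
    have z1: "Ck_on 1 (\<lambda>r. (x r, vector_derivative x (at r))) J'"
      using Ck_on_le[OF x2, of 1] Ck_on_real_SucD(2)[OF x2' oJ'] by (intro Ck_on_Pair oJ') auto
    have eq: "local_rep F c (x r, vector_derivative x (at r)) = F (velocity A \<delta> r)" if "r \<in> J'" for r
      using velocity_coordinates[OF D(1,4) _ c(1), of r] that by (simp add: J'_def x_def)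
    have "Ck_on 1 (\<lambda>r. local_rep F c (x r, vector_derivative x (at r))) J'"
      by (rule Ck_on_compose[OF oJ' Ck_on_le[OF finsler_local(1)[OF F c(1)]] z1]) (use slit in auto)
    then have "Ck_on 1 (\<lambda>t. F (velocity A \<delta> t)) J'" by (rule Ck_on_cong[OF oJ' _ eq])
    moreover have "F (velocity A \<delta> t) > 0" using finsler_local(4)[OF F c(1) slit[OF tJ']] eq[OF tJ'] by simp
    ultimately show ?thesis using oJ' tJ' by blast
  qed
  show "Ck_on 1 (\<lambda>t. F (velocity A \<delta> t)) J" by (rule Ck_on_local) (use loc in blast)
  show "F (velocity A \<delta> t) > 0" if "t \<in> J" for t using loc[OF that] by blast
qed

lemma arclength_reparametrization:
  assumes F: "C2_finsler A F" and \<delta>: "extremal A F J \<delta>" and k: "k > 0" and r1: "r1 \<in> J"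
  shows "\<exists>s \<psi>. s r1 = t1 \<and> inj_on s J \<and> (\<forall>r\<in>J. (s has_vector_derivative F (velocity A \<delta> r) / k) (at r)) \<and>
    (\<forall>r\<in>J. \<psi> (s r) = r) \<and>
    extremal A F (s ` J) (\<lambda>t. \<delta> (\<psi> t)) \<and> (\<forall>t\<in>s ` J. F (velocity A (\<lambda>t. \<delta> (\<psi> t)) t) = k)"
proof -
  note D = extremalD[OF \<delta>]
  define \<sigma> where "\<sigma> = (\<lambda>r. F (velocity A \<delta> r) / k)"
  have "Ck_on 1 (\<lambda>r. inverse k * F (velocity A \<delta> r)) J"
    by (rule Ck_on_bounded_linear[OF bounded_linear_mult_right D(1) speed_C1(1)[OF F \<delta>]])
  then have \<sigma>1: "Ck_on 1 \<sigma> J" by (simp add: \<sigma>_def field_simps)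
  have \<sigma>0: "\<sigma> r > 0" if "r \<in> J" for r using speed_C1(2)[OF F \<delta> that] k by (simp add: \<sigma>_def)
  obtain s where s: "s r1 = t1" "\<And>r. r \<in> J \<Longrightarrow> (s has_vector_derivative \<sigma> r) (at r)"
    using antiderivative_on_open_interval[OF D(1,2) Ck_on_imp_continuous_on[OF \<sigma>1] r1] by blast
  obtain \<psi> where \<psi>: "open (s ` J)" "is_interval (s ` J)" "Ck_on 2 \<psi> (s ` J)" "\<And>r. r \<in> J \<Longrightarrow> \<psi> (s r) = r"
    "\<And>t. t \<in> s ` J \<Longrightarrow> (\<psi> has_vector_derivative inverse (\<sigma> (\<psi> t))) (at t)"
    using inverse_of_increasing[OF D(1,2) \<sigma>1 \<sigma>0 s(2)] by blast
  have oi: "open_interval (s ` J)" using \<psi>(1,2) D(3) by (simp add: open_interval_def)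
  have psiJ: "\<psi> t \<in> J" if "t \<in> s ` J" for t using \<psi>(4) that by auto
  have vd: "vector_derivative \<psi> (at t) = inverse (\<sigma> (\<psi> t))" if "t \<in> s ` J" for t
    by (rule vector_derivative_at[OF \<psi>(5)[OF that]])
  have pos: "vector_derivative \<psi> (at t) > 0" if "t \<in> s ` J" for t
    using vd[OF that] \<sigma>0[OF psiJ[OF that]] by simp
  have sub: "\<psi> ` (s ` J) \<subseteq> J" using psiJ by blast
  have ext: "extremal A F (s ` J) (\<lambda>t. \<delta> (\<psi> t))"
    by (rule extremal_reparametrize(1)[OF F \<delta> oi \<psi>(3) pos sub])
  have speed: "F (velocity A (\<lambda>t. \<delta> (\<psi> t)) t) = k" if t: "t \<in> s ` J" for t
  proof -
    have "F (velocity A (\<lambda>t. \<delta> (\<psi> t)) t) = vector_derivative \<psi> (at t) * F (velocity A \<delta> (\<psi> t))"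
      by (rule extremal_reparametrize(2)[OF F \<delta> oi \<psi>(3) pos sub t])
    also have "\<dots> = k" using vd[OF t] speed_C1(2)[OF F \<delta> psiJ[OF t]] k by (simp add: \<sigma>_def)
    finally show ?thesis .
  qed
  have inj: "inj_on s J" by (rule inj_on_inverseI[where g = \<psi>]) (rule \<psi>(4))
  show ?thesis
    using s inj \<psi>(4) ext speed unfolding \<sigma>_def by blast
qed

text \<open>Zorn's lemma is applied to the graphs of the extremals of the given constant speed. Fixing the
  speed turns extension up to reparametrization into inclusion of graphs: an extremal that continues the maximal one after
  a reparametrization can be brought to this speed, and then its graph contains the maximal one.\<close>

lemma extremal_extends_to_geodesic:
  assumes F: "C2_finsler A F" and ext0: "extremal A F I0 \<gamma>0" and k: "k > 0"
    and speed0: "\<And>t. t \<in> I0 \<Longrightarrow> F (velocity A \<gamma>0 t) = k"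
  shows "\<exists>I \<gamma>. geodesic A F I \<gamma> \<and> I0 \<subseteq> I \<and> (\<forall>t\<in>I0. \<gamma> t = \<gamma>0 t) \<and> (\<forall>t\<in>I. F (velocity A \<gamma> t) = k)"
proof -
  define G where "G = (\<lambda>I (\<gamma> :: real \<Rightarrow> 'm). (\<lambda>t. (t, \<gamma> t)) ` I)"
  have G: "(t, y) \<in> G I \<gamma> \<longleftrightarrow> t \<in> I \<and> y = \<gamma> t" for t y I \<gamma> by (auto simp: G_def)
  have Gsub: "G I \<gamma> \<subseteq> G J \<delta> \<longleftrightarrow> I \<subseteq> J \<and> (\<forall>t\<in>I. \<gamma> t = \<delta> t)" for I \<gamma> J \<delta> by (auto simp: G_def)
  define good where "good = (\<lambda>I \<gamma>. extremal A F I \<gamma> \<and> (\<forall>t\<in>I. F (velocity A \<gamma> t) = k) \<and> I0 \<subseteq> I \<and> (\<forall>t\<in>I0. \<gamma> t = \<gamma>0 t))"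
  define \<G> where "\<G> = {G I \<gamma> | I \<gamma>. good I \<gamma>}"
  have "\<exists>M\<in>\<G>. \<forall>X\<in>\<G>. M \<subseteq> X \<longrightarrow> X = M"
  proof (rule subset_Zorn_nonempty)
    show "\<G> \<noteq> {}" using ext0 speed0 unfolding \<G>_def good_def by blast
    fix \<C> assume ne: "\<C> \<noteq> {}" and ch: "subset.chain \<G> \<C>"
    have sub: "\<C> \<subseteq> \<G>" and lin: "\<And>X Y. X \<in> \<C> \<Longrightarrow> Y \<in> \<C> \<Longrightarrow> X \<subseteq> Y \<or> Y \<subseteq> X"
      using ch by (auto simp: subset.chain_def)
    define P where "P = {(J, \<delta>). good J \<delta> \<and> G J \<delta> \<in> \<C>}"
    have CP: "\<exists>J \<delta>. (J, \<delta>) \<in> P \<and> X = G J \<delta>" if "X \<in> \<C>" for X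
      using sub that unfolding \<G>_def P_def by blast
    have agree: "\<delta> t = \<delta>' t" if "(J, \<delta>) \<in> P" "(J', \<delta>') \<in> P" "t \<in> J" "t \<in> J'" for J \<delta> J' \<delta>' t
      using lin[of "G J \<delta>" "G J' \<delta>'"] that unfolding P_def Gsub by auto
    define I where "I = \<Union>(fst ` P)"
    define \<gamma> where "\<gamma> = (\<lambda>t. SOME y. \<exists>J \<delta>. (J, \<delta>) \<in> P \<and> t \<in> J \<and> y = \<delta> t)"
    have \<gamma>: "\<gamma> t = \<delta> t" if "(J, \<delta>) \<in> P" "t \<in> J" for J \<delta> t
    proof -
      have "\<exists>J \<delta>. (J, \<delta>) \<in> P \<and> t \<in> J \<and> \<gamma> t = \<delta> t"
        unfolding \<gamma>_def by (rule someI_ex) (use that in blast)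
      then show ?thesis using agree that by metis
    qed
    have IP: "\<exists>J \<delta>. (J, \<delta>) \<in> P \<and> t \<in> J" if "t \<in> I" for t using that by (auto simp: I_def)
    have JI: "J \<subseteq> I" if "(J, \<delta>) \<in> P" for J \<delta> using that by (force simp: I_def)
    have ext: "extremal A F J \<delta>" "\<And>t. t \<in> J \<Longrightarrow> F (velocity A \<delta> t) = k" "I0 \<subseteq> J" "\<And>t. t \<in> I0 \<Longrightarrow> \<delta> t = \<gamma>0 t"
      if "(J, \<delta>) \<in> P" for J \<delta> using that by (auto simp: P_def good_def)
    have oP: "open J" "connected J" if "(J, \<delta>) \<in> P" for J \<delta>
      using extremalD(1,2)[OF ext(1)[OF that]] by (auto simp: is_interval_connected_1)
    obtain X0 where "X0 \<in> \<C>" using ne by blast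
    then obtain J0 \<delta>0 where J0: "(J0, \<delta>0) \<in> P" using CP by blast
    obtain i0 where i0: "i0 \<in> I0" using extremalD(3)[OF ext0] by blast
    have oiI: "open_interval I"
      unfolding open_interval_def
    proof (intro conjI)
      show "open I" unfolding I_def using oP(1) by (intro open_Union) auto
      have "connected I" unfolding I_def
      proof (rule connected_Union)
        show "connected T" if "T \<in> fst ` P" for T
          using that oP(2) by auto
        show "\<Inter>(fst ` P) \<noteq> {}" using ext(3) i0 by fastforce
      qed
      then show "is_interval I" by (simp add: is_interval_connected_1)
      show "I \<noteq> {}" using JI[OF J0] ext(3)[OF J0] i0 by blast
    qed
    have extI: "extremal A F I \<gamma>"
    proof (rule extremal_glue[OF F oiI])
      fix t assume "t \<in> I"
      then obtain J \<delta> where "(J, \<delta>) \<in> P" "t \<in> J" using IP by blast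
      then show "\<exists>J \<delta>. t \<in> J \<and> extremal A F J \<delta> \<and> (\<forall>s\<in>J. \<gamma> s = \<delta> s)" using ext(1) \<gamma> by blast
    qed
    have "F (velocity A \<gamma> t) = k" if tI: "t \<in> I" for t
    proof -
      obtain J \<delta> where J: "(J, \<delta>) \<in> P" "t \<in> J" using IP[OF tI] by blast
      have "velocity A \<gamma> t = velocity A \<delta> t"
        by (rule velocity_cong[OF extremalD(1)[OF ext(1)[OF J(1)]] J(2) \<gamma>[OF J(1)]])
      then show ?thesis using ext(2)[OF J] by simp
    qed
    moreover have "I0 \<subseteq> I" using JI[OF J0] ext(3)[OF J0] by blast
    moreover have "\<gamma> t = \<gamma>0 t" if "t \<in> I0" for t
    proof -
      have "t \<in> J0" using ext(3)[OF J0] that by blast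
      then show ?thesis using \<gamma>[OF J0] ext(4)[OF J0 that] by simp
    qed
    ultimately have "good I \<gamma>" using extI by (simp add: good_def)
    moreover have "\<Union>\<C> = G I \<gamma>"
    proof (intro set_eqI iffI)
      fix z assume "z \<in> \<Union>\<C>"
      then obtain J \<delta> where "(J, \<delta>) \<in> P" "z \<in> G J \<delta>" using CP by blast
      then show "z \<in> G I \<gamma>" using JI \<gamma> by (cases z) (auto simp: G)
    next
      fix z assume "z \<in> G I \<gamma>"
      then obtain t where t: "t \<in> I" "z = (t, \<gamma> t)" by (auto simp: G_def)
      then obtain J \<delta> where J: "(J, \<delta>) \<in> P" "t \<in> J" using IP by blast
      then have "z \<in> G J \<delta>" "G J \<delta> \<in> \<C>" using t \<gamma>[OF J] by (auto simp: G P_def)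
      then show "z \<in> \<Union>\<C>" by blast
    qed
    ultimately show "\<Union>\<C> \<in> \<G>" unfolding \<G>_def by blast
  qed
  then obtain M where M: "M \<in> \<G>" "\<forall>X\<in>\<G>. M \<subseteq> X \<longrightarrow> X = M" by (elim bexE)
  obtain I \<gamma> where MG: "M = G I \<gamma>" and good: "good I \<gamma>" using M(1) unfolding \<G>_def by (elim CollectE exE conjE)
  have max: "X = G I \<gamma>" if "X \<in> \<G>" "G I \<gamma> \<subseteq> X" for X
    using bspec[OF M(2) that(1)] that(2) unfolding MG by (rule mp)
  have ext: "extremal A F I \<gamma>" and speed: "\<And>t. t \<in> I \<Longrightarrow> F (velocity A \<gamma> t) = k" using good by (auto simp: good_def)
  note D = extremalD[OF ext]
  have "geodesic A F I \<gamma>"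
    unfolding geodesic_def
  proof (intro conjI allI impI ext)
    fix J \<delta> \<phi> K
    assume \<delta>: "extremal A F J \<delta>" and rep: "reparametrization \<phi> I K" and KJ: "K \<subseteq> J" and eq: "\<forall>t\<in>I. \<gamma> t = \<delta> (\<phi> t)"
    have \<phi>2: "Ck_on 2 \<phi> I" and \<phi>': "\<And>t. t \<in> I \<Longrightarrow> vector_derivative \<phi> (at t) > 0" and \<phi>K: "\<phi> ` I = K"
      using rep by (auto simp: reparametrization_def field_derivative_eq_vector_derivative)
    have oiI: "open_interval I" using ext by (simp add: extremal_def)
    have phiJ: "\<phi> ` I \<subseteq> J" using \<phi>K KJ by simp
    have phi2': "Ck_on (Suc 1) \<phi> I" using \<phi>2 by (simp only: numeral_2_eq_2 One_nat_def)
    obtain t1 where t1: "t1 \<in> I" using D(3) by blast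
    obtain s \<psi> where s: "s (\<phi> t1) = t1" "inj_on s J"
      and ds: "\<And>r. r \<in> J \<Longrightarrow> (s has_vector_derivative F (velocity A \<delta> r) / k) (at r)"
      and \<psi>: "\<And>r. r \<in> J \<Longrightarrow> \<psi> (s r) = r"
      and ext': "extremal A F (s ` J) (\<lambda>t. \<delta> (\<psi> t))" and speed': "\<And>t. t \<in> s ` J \<Longrightarrow> F (velocity A (\<lambda>t. \<delta> (\<psi> t)) t) = k"
      using arclength_reparametrization[OF F \<delta> k, of "\<phi> t1" t1] phiJ t1 by blast
    \<comment> \<open>Both curves have speed \<open>k\<close>, so the change of parameter between them is a translation.\<close>
    have der: "((\<lambda>t. s (\<phi> t) - t) has_vector_derivative 0) (at t)" if t: "t \<in> I" for t
    proof -
      have pt: "\<phi> t \<in> J" using phiJ t by blast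
      have "F (velocity A \<gamma> t) = F (velocity A (\<lambda>t. \<delta> (\<phi> t)) t)"
        using velocity_cong[OF D(1) t, of \<gamma> "\<lambda>t. \<delta> (\<phi> t)"] eq by simp
      also have "\<dots> = vector_derivative \<phi> (at t) * F (velocity A \<delta> (\<phi> t))"
        by (rule extremal_reparametrize(2)[OF F \<delta> oiI \<phi>2 \<phi>' phiJ t])
      finally have "vector_derivative \<phi> (at t) * F (velocity A \<delta> (\<phi> t)) = k" using speed[OF t] by simp
      then have one: "vector_derivative \<phi> (at t) *\<^sub>R (F (velocity A \<delta> (\<phi> t)) / k) = 1" using k by simp
      have "((\<lambda>t. s (\<phi> t)) has_vector_derivative 1) (at t)"
        using vector_diff_chain_at[OF Ck_on_real_SucD(1)[OF phi2' D(1) t] ds[OF pt]] unfolding one by (simp add: o_def)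
      from has_vector_derivative_diff[OF this has_vector_derivative_id] show ?thesis by simp
    qed
    have "convex I" using D(2) by (simp add: is_interval_convex)
    then obtain C where C: "\<And>t. t \<in> I \<Longrightarrow> s (\<phi> t) - t = C"
      using has_vector_derivative_zero_constant[of I "\<lambda>t. s (\<phi> t) - t"] has_vector_derivative_at_within[OF der] by blast
    have id: "s (\<phi> t) = t" if "t \<in> I" for t using C[OF that] C[OF t1] s(1) by simp
    have IJ: "I \<subseteq> s ` J" using id phiJ by force
    have same: "\<gamma> t = \<delta> (\<psi> t)" if "t \<in> I" for t
    proof -
      have "\<phi> t \<in> J" using phiJ that by blast
      then have "\<psi> t = \<phi> t" using \<psi>[of "\<phi> t"] id[OF that] by simp
      then show ?thesis using eq that by simp
    qed
    have "good (s ` J) (\<lambda>t. \<delta> (\<psi> t))"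
      unfolding good_def
    proof (intro conjI ballI ext' speed')
      show "I0 \<subseteq> s ` J" using IJ good unfolding good_def by blast
      show "\<delta> (\<psi> t) = \<gamma>0 t" if "t \<in> I0" for t
      proof -
        have "t \<in> I" "\<gamma> t = \<gamma>0 t" using good that unfolding good_def by blast+
        then show ?thesis using same by simp
      qed
    qed
    then have "G (s ` J) (\<lambda>t. \<delta> (\<psi> t)) \<in> \<G>" unfolding \<G>_def by blast
    moreover have "G I \<gamma> \<subseteq> G (s ` J) (\<lambda>t. \<delta> (\<psi> t))" using IJ same by (simp add: Gsub)
    ultimately have "G (s ` J) (\<lambda>t. \<delta> (\<psi> t)) = G I \<gamma>" by (rule max)
    then have "G (s ` J) (\<lambda>t. \<delta> (\<psi> t)) \<subseteq> G I \<gamma>" by (rule equalityD1)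
    then have "s ` J \<subseteq> I" unfolding Gsub by (rule conjunct1)
    also have "I = s ` K" using id \<phi>K by force
    finally have "J \<subseteq> K" using inj_on_image_subset_iff[OF s(2) order_refl KJ] by simp
    then show "K = J" using KJ by blast
  qed
  then show ?thesis using good unfolding good_def by blast
qed

end

section \<open>The difference of the two metrics\<close>

lemma locally_exactE:
  assumes "locally_exact f z"
  obtains N S where "open N" "z \<in> N"
    "\<And>q u. (q, u) \<in> N \<Longrightarrow> S differentiable (at q) \<and> f (q, u) = frechet_derivative S (at q) u"
  using assms unfolding locally_exact_def by blast

lemma locally_exact_witness:
  assumes "open N" "z \<in> N"
    "\<And>q u. (q, u) \<in> N \<Longrightarrow> S differentiable (at q) \<and> f (q, u) = frechet_derivative S (at q) u"
  shows "locally_exact f z"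
  using assms unfolding locally_exact_def by blast

context smooth_manifold
begin

lemma locally_exact_transition:
  assumes c: "c \<in> A" "c' \<in> A" and p: "p \<in> overlap c c'"
    and exact: "locally_exact (\<lambda>z. local_rep F2 c z - local_rep F1 c z) (p, u)"
  shows "locally_exact (\<lambda>z. local_rep F2 c' z - local_rep F1 c' z)
    (transition c c' p, frechet_derivative (transition c c') (at p) u)"
proof -
  let ?\<tau> = "transition c c'" and ?\<sigma> = "transition c' c"
  let ?D = "\<lambda>p. frechet_derivative ?\<tau> (at p)" and ?E = "\<lambda>q. frechet_derivative ?\<sigma> (at q)"
  obtain N S where N: "open N" "(p, u) \<in> N"
    and S: "\<And>q v. (q, v) \<in> N \<Longrightarrow> S differentiable (at q) \<and> local_rep F2 c (q, v) - local_rep F1 c (q, v) = frechet_derivative S (at q) v"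
    by (rule locally_exactE[OF exact]) (rule that)
  have p': "?\<tau> p \<in> overlap c' c"
    using p overlap_iff[OF c(1), of p c'] overlap_iff[OF c(2), of "?\<tau> p" c] chart_facts(5,6)[OF c(2)] chart_facts(8)[OF c(1)]
    by (simp add: transition_def)
  have inv: "?\<sigma> (?\<tau> q) = q" if "q \<in> overlap c c'" for q
    using that overlap_iff[OF c(1), of q c'] chart_facts(5)[OF c(2)] chart_facts(7)[OF c(1)] by (simp add: transition_def)
  have ED: "?E (?\<tau> p) (?D p v) = v" for v
  proof -
    have "(?\<sigma> \<circ> ?\<tau> has_derivative ?E (?\<tau> p) \<circ> ?D p) (at p)"
      by (rule diff_chain_at[OF transition_derivative[OF c p] transition_derivative[OF c(2,1) p']])
    then have "((\<lambda>q. q) has_derivative ?E (?\<tau> p) \<circ> ?D p) (at p)"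
      by (rule has_derivative_transform_within_open[OF _ open_overlap[OF c] p]) (simp add: inv)
    from has_derivative_unique[OF this has_derivative_ident] show ?thesis by (simp add: fun_eq_iff)
  qed
  define \<Phi> where "\<Phi> = (\<lambda>z. (?\<sigma> (fst z), ?E (fst z) (snd z)))"
  let ?O = "overlap c' c \<times> (UNIV :: 'e set)"
  have c\<Phi>: "continuous_on ?O \<Phi>"
    unfolding \<Phi>_def
  proof (intro continuous_on_Pair)
    have k1: "Ck_on (Suc 0) ?\<sigma> (overlap c' c)" by (rule Ck_on_transition[OF c(2,1)])
    show "continuous_on ?O (\<lambda>z. ?\<sigma> (fst z))"
      by (rule continuous_on_compose2[OF Ck_on_imp_continuous_on[OF k1] continuous_on_fst[OF continuous_on_id]]) auto
    show "continuous_on ?O (\<lambda>z. ?E (fst z) (snd z))"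
    proof (rule continuous_on_linear_family[where D = ?E and B = "overlap c' c" and g = fst and h = snd])
      show "continuous_on (overlap c' c) (\<lambda>q. ?E q \<zeta>)" for \<zeta> by (rule continuous_on_frechet_derivative[OF k1])
      show "linear (?E q)" if "q \<in> overlap c' c" for q
        using transition_derivative[OF c(2,1) that] by (rule has_derivative_linear)
    qed (auto intro!: continuous_intros)
  qed
  define N' where "N' = ?O \<inter> \<Phi> -` N"
  have N'1: "open N'" unfolding N'_def
    by (rule continuous_open_preimage[OF c\<Phi> _ N(1)]) (intro open_Times open_overlap c open_UNIV)
  have N'2: "(?\<tau> p, ?D p u) \<in> N'" using p' N(2) by (simp add: N'_def \<Phi>_def inv[OF p] ED)
  have N'3: "(\<lambda>q. S (?\<sigma> q)) differentiable (at q) \<and>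
      local_rep F2 c' (q, v) - local_rep F1 c' (q, v) = frechet_derivative (\<lambda>q. S (?\<sigma> q)) (at q) v" if qv: "(q, v) \<in> N'" for q v
  proof -
    have q: "q \<in> overlap c' c" and "(?\<sigma> q, ?E q v) \<in> N" using qv by (auto simp: N'_def \<Phi>_def)
    note Sq = S[OF this(2)]
    have dS: "(S has_derivative frechet_derivative S (at (?\<sigma> q))) (at (?\<sigma> q))"
      using Sq by (simp add: frechet_derivative_works)
    have d: "((\<lambda>q. S (?\<sigma> q)) has_derivative (\<lambda>v. frechet_derivative S (at (?\<sigma> q)) (?E q v))) (at q)"
      by (rule has_derivative_compose[OF transition_derivative[OF c(2,1) q] dS])
    have "frechet_derivative (\<lambda>q. S (?\<sigma> q)) (at q) v = frechet_derivative S (at (?\<sigma> q)) (?E q v)"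
      using fun_cong[OF frechet_derivative_at[OF d], of v] by simp
    then show ?thesis
      using differentiableI[OF d] Sq unfolding chart_vec_transition[OF c(2,1) q] by simp
  qed
  show ?thesis by (rule locally_exact_witness[OF N'1 N'2 N'3])
qed

lemma chart_curve_to_geodesic:
  assumes F1: "C2_finsler A F1" and c: "c \<in> A" and \<tau>: "0 < \<tau>" and x: "Ck_on 2 x {-\<tau><..<\<tau>}"
    and slit: "\<And>t. t \<in> {-\<tau><..<\<tau>} \<Longrightarrow> (x t, vector_derivative x (at t)) \<in> slit c"
    and EL: "\<And>t. t \<in> {-\<tau><..<\<tau>} \<Longrightarrow> EL (local_rep F1 c) x t"
    and speed: "\<And>t. t \<in> {-\<tau><..<\<tau>} \<Longrightarrow> local_rep F1 c (x t, vector_derivative x (at t)) = k"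
  shows "\<exists>I \<gamma>. geodesic A F1 I \<gamma> \<and> {-\<tau><..<\<tau>} \<subseteq> I \<and> (\<forall>t\<in>I. F1 (velocity A \<gamma> t) = k) \<and>
    (\<forall>t\<in>{-\<tau><..<\<tau>}. \<gamma> t \<in> chart_dom c \<and> chart_map c (\<gamma> t) = x t)"
proof -
  let ?I = "{-\<tau><..<\<tau>}"
  let ?\<gamma> = "\<lambda>t. chart_inv c (x t)"
  have oI: "open ?I" by simp
  have oi: "open_interval ?I"
    using \<tau> by (auto simp: open_interval_def is_interval_connected_1)
  have xr: "x t \<in> chart_range c" if "t \<in> ?I" for t using slit[OF that] by auto
  have \<gamma>: "Ck_map A 2 ?I ?\<gamma>" by (rule Ck_map_chart_inv[OF c oI x]) (use xr in blast)
  have dom: "?\<gamma> t \<in> chart_dom c" if "t \<in> ?I" for t by (rule chart_facts(8)[OF c xr[OF that]])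
  have xx: "x t = (chart_map c \<circ> ?\<gamma>) t" if "t \<in> ?I" for t using chart_facts(7)[OF c xr[OF that]] by simp
  have v: "vector_derivative (chart_map c \<circ> ?\<gamma>) (at t) = vector_derivative x (at t)" if "t \<in> ?I" for t
    by (rule vector_derivative_cong_open[OF oI that]) (simp only: xx)
  have ext: "extremal A F1 ?I ?\<gamma>"
  proof (rule EL_imp_extremal[OF F1 oi \<gamma>])
    fix t assume t: "t \<in> ?I"
    show "snd (velocity A ?\<gamma> t) \<noteq> (\<lambda>_. 0)"
      unfolding velocity_nonzero_iff[OF oI \<gamma> t c dom[OF t]] v[OF t] using slit[OF t] by simp
    have "EL (local_rep F1 c) (chart_map c \<circ> ?\<gamma>) t" by (rule EL_cong[OF oI t xx EL[OF t]])
    then show "\<exists>c\<in>A. ?\<gamma> t \<in> chart_dom c \<and> EL (local_rep F1 c) (chart_map c \<circ> ?\<gamma>) t" using c dom[OF t] by blast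
  qed
  have sp: "F1 (velocity A ?\<gamma> t) = k" if t: "t \<in> ?I" for t
    unfolding velocity_coordinates[OF oI \<gamma> t c dom[OF t]] v[OF t] using speed[OF t] chart_facts(7)[OF c xr[OF t]] by simp
  have "0 \<in> ?I" using \<tau> by simp
  then have "k > 0" using sp speed_C1(2)[OF F1 ext] by metis
  from extremal_extends_to_geodesic[OF F1 ext this sp] obtain I \<gamma> where
    g: "geodesic A F1 I \<gamma>" "?I \<subseteq> I" and e: "\<forall>t\<in>?I. \<gamma> t = ?\<gamma> t" and s: "\<forall>t\<in>I. F1 (velocity A \<gamma> t) = k" by blast
  show ?thesis
  proof (intro exI[of _ I] exI[of _ \<gamma>] conjI g s ballI)
    fix t assume t: "t \<in> ?I"
    have "\<gamma> t = ?\<gamma> t" using e t by (rule bspec)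
    then show "\<gamma> t \<in> chart_dom c" "chart_map c (\<gamma> t) = x t" using dom[OF t] chart_facts(7)[OF c xr[OF t]] by simp_all
  qed
qed

text \<open>The curve is a reparametrized geodesic of \<open>F2\<close>, and the equations are invariant under
  reparametrization.\<close>

lemma geodesic_imp_other_EL:
  assumes F2: "C2_finsler A F2" and same: "same_unparametrized_geodesics A F1 F2"
    and geo: "geodesic A F1 I \<gamma>" and t: "t \<in> I" and c: "c \<in> A" "\<gamma> t \<in> chart_dom c"
  shows "EL (local_rep F2 c) (chart_map c \<circ> \<gamma>) t"
proof -
  obtain J \<delta> \<phi> where \<delta>: "geodesic A F2 J \<delta>" and rep: "reparametrization \<phi> I J" and eq: "\<forall>t\<in>I. \<gamma> t = \<delta> (\<phi> t)"
    using same geo unfolding same_unparametrized_geodesics_def same_oriented_curve_def by metis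
  have ext1: "extremal A F1 I \<gamma>" and ext2: "extremal A F2 J \<delta>" using geo \<delta> by (auto simp: geodesic_def)
  have oi: "open_interval I" using ext1 by (simp add: extremal_def)
  have "extremal A F2 I (\<lambda>t. \<delta> (\<phi> t))"
    by (rule extremal_reparametrize(1)[OF F2 ext2 oi])
      (use rep in \<open>auto simp: reparametrization_def field_derivative_eq_vector_derivative\<close>)
  then have ext: "extremal A F2 I \<gamma>" by (intro extremal_glue[OF F2 oi]) (use eq in blast)
  show ?thesis by (rule extremal_imp_EL[OF F2 ext t c])
qed

text \<open>The geodesic of \<open>F1\<close> through the given vector passes through the set where the metrics agree. Being
  locally exact is independent of the chart and, by propagation, locally constant in time; the interval of the
  geodesic is connected.\<close>

lemma everywhere_locally_exact:
  assumes F1: "C2_finsler A F1" and F2: "C2_finsler A F2" and same: "same_unparametrized_geodesics A F1 F2"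
    and agree: "\<And>I \<gamma>. geodesic A F1 I \<gamma> \<Longrightarrow>
           \<exists>W. openin (tangent_topology A) W \<and> (\<forall>v\<in>W. F1 v = F2 v) \<and> (\<exists>t\<in>I. velocity A \<gamma> t \<in> W)"
    and c: "c \<in> A" and z: "z \<in> slit c"
  shows "locally_exact (\<lambda>z. local_rep F2 c z - local_rep F1 c z) z"
proof -
  let ?d = "\<lambda>c z. local_rep F2 c z - local_rep F1 c z"
  obtain a b where ab: "z = (a, b)" by (cases z)
  have compat: "EL (local_rep F2 c) x t"
    if c: "c \<in> A" and \<tau>: "0 < \<tau>" and x: "Ck_on 2 x {-\<tau><..<\<tau>}"
      and xt: "\<And>t. t \<in> {-\<tau><..<\<tau>} \<Longrightarrow> (x t, vector_derivative x (at t)) \<in> slit c \<and> EL (local_rep F1 c) x t \<and>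
          local_rep F1 c (x t, vector_derivative x (at t)) = local_rep F1 c (x 0, vector_derivative x (at 0))"
      and t: "t \<in> {-\<tau><..<\<tau>}" for c x \<tau> t
  proof -
    have "\<exists>I \<gamma>. geodesic A F1 I \<gamma> \<and> {-\<tau><..<\<tau>} \<subseteq> I \<and>
      (\<forall>t\<in>I. F1 (velocity A \<gamma> t) = local_rep F1 c (x 0, vector_derivative x (at 0))) \<and>
      (\<forall>t\<in>{-\<tau><..<\<tau>}. \<gamma> t \<in> chart_dom c \<and> chart_map c (\<gamma> t) = x t)"
      by (rule chart_curve_to_geodesic[OF F1 c \<tau> x]) (use xt in blast)+
    then obtain I \<gamma> where geo: "geodesic A F1 I \<gamma>" and sub: "{-\<tau><..<\<tau>} \<subseteq> I"
      and \<gamma>: "\<And>t. t \<in> {-\<tau><..<\<tau>} \<Longrightarrow> \<gamma> t \<in> chart_dom c \<and> chart_map c (\<gamma> t) = x t" by blast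
    have "EL (local_rep F2 c) (chart_map c \<circ> \<gamma>) t"
      by (rule geodesic_imp_other_EL[OF F2 same geo _ c]) (use sub t \<gamma> in blast)+
    then show ?thesis
      by (rule EL_cong[OF open_greaterThanLessThan t, rotated]) (simp add: \<gamma>)
  qed
  have h: "fibre_homogeneous (local_rep F1 c) (slit c)" "fibre_homogeneous (local_rep F2 c) (slit c)" if "c \<in> A" for c
    using finsler_local(5) F1 F2 that by blast+
  from local_flow[OF h(1)[OF c] finsler_local(4)[OF F1 c] finsler_local(6)[OF F1 c] z[unfolded ab]]
  obtain B W C \<tau> q u where B: "B \<subseteq> slit c" and zW: "z \<in> W" and fl: "flow_box (local_rep F1 c) B W C \<tau> q u"
    unfolding ab[symmetric] by blast
  note fD = flow_boxD[OF fl]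
  let ?I = "{-\<tau><..<\<tau>}"
  have I0: "0 \<in> ?I" using fD(1) by simp
  have vd: "vector_derivative (q z) (at t) = u z t" if "t \<in> ?I" for t
    by (rule vector_derivative_at[OF fD(8)[OF zW that]])
  have "\<exists>I \<gamma>. geodesic A F1 I \<gamma> \<and> ?I \<subseteq> I \<and> (\<forall>t\<in>I. F1 (velocity A \<gamma> t) = local_rep F1 c z) \<and>
    (\<forall>t\<in>?I. \<gamma> t \<in> chart_dom c \<and> chart_map c (\<gamma> t) = q z t)"
  proof (rule chart_curve_to_geodesic[OF F1 c fD(1) fD(6)[OF zW] _ fD(10)[OF zW]])
    fix t assume t: "t \<in> ?I"
    show "(q z t, vector_derivative (q z) (at t)) \<in> slit c" unfolding vd[OF t] using fD(7)[OF zW t] B by blast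
    show "local_rep F1 c (q z t, vector_derivative (q z) (at t)) = local_rep F1 c z"
      unfolding vd[OF t] by (rule fD(9)[OF zW t])
  qed
  then obtain I \<gamma> where geo: "geodesic A F1 I \<gamma>" and sub: "?I \<subseteq> I"
    and speed': "\<forall>t\<in>I. F1 (velocity A \<gamma> t) = local_rep F1 c z"
    and \<gamma>q: "\<And>t. t \<in> ?I \<Longrightarrow> \<gamma> t \<in> chart_dom c \<and> chart_map c (\<gamma> t) = q z t" by blast
  define k where "k = local_rep F1 c z"
  have speed: "F1 (velocity A \<gamma> t) = k" if "t \<in> I" for t using speed' that by (simp add: k_def)
  have ext: "extremal A F1 I \<gamma>" using geo by (simp add: geodesic_def)
  note D = extremalD[OF ext]
  define coord where "coord = (\<lambda>(c :: ('m, 'e) chart) t. (chart_map c (\<gamma> t), vector_derivative (chart_map c \<circ> \<gamma>) (at t)))"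
  define P where "P = (\<lambda>t. \<forall>c\<in>A. \<gamma> t \<in> chart_dom c \<longrightarrow> locally_exact (?d c) (coord c t))"
  have PI: "P t" if t: "t \<in> I" and c: "c \<in> A" "\<gamma> t \<in> chart_dom c" and le: "locally_exact (?d c) (coord c t)" for t c
    unfolding P_def
  proof (intro ballI impI)
    fix c' assume c': "c' \<in> A" "\<gamma> t \<in> chart_dom c'"
    have p: "chart_map c (\<gamma> t) \<in> overlap c c'" using c c' by (auto simp: overlap_def)
    have "transition c c' (chart_map c (\<gamma> t)) = chart_map c' (\<gamma> t)"
      using chart_facts(5)[OF c] by (simp add: transition_def)
    then show "locally_exact (?d c') (coord c' t)"
      using locally_exact_transition[OF c(1) c'(1) p le[unfolded coord_def]]
      unfolding coord_def chart_velocity_transition[OF D(1,4) t c c'] by simp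
  qed
  obtain W' t1 where W': "openin (tangent_topology A) W'" "\<And>v. v \<in> W' \<Longrightarrow> F1 v = F2 v" and t1: "t1 \<in> I" "velocity A \<gamma> t1 \<in> W'"
    using agree[OF geo] by blast
  have P1: "P t1"
  proof -
    obtain c where c: "c \<in> A" "\<gamma> t1 \<in> chart_dom c" using ex_chart by blast
    let ?N = "(chart_range c \<times> UNIV) \<inter> chart_vec A c -` W'"
    have N1: "open ?N" using W'(1) c(1) unfolding openin_tangent_topology by blast
    have N2: "coord c t1 \<in> ?N"
      using t1 velocity_coordinates[OF D(1,4) t1(1) c] chart_facts(6)[OF c] by (simp add: coord_def)
    have N3: "(\<lambda>_. 0 :: real) differentiable (at q) \<and> ?d c (q, v) = frechet_derivative (\<lambda>_. 0 :: real) (at q) v"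
      if "(q, v) \<in> ?N" for q v
      using W'(2)[of "chart_vec A c (q, v)"] that by (simp add: frechet_derivative_const)
    have "locally_exact (?d c) (coord c t1)" by (rule locally_exact_witness[OF N1 N2 N3])
    then show ?thesis by (rule PI[OF t1(1) c])
  qed
  have "P 0"
  proof (rule connected_induction_simple[of I t1 0 P])
    show "connected I" using D(2) by (simp add: is_interval_connected_1)
    show "t1 \<in> I" "0 \<in> I" "P t1" using t1 sub I0 P1 by auto
    fix t0 assume t0: "t0 \<in> I"
    obtain c where c: "c \<in> A" "\<gamma> t0 \<in> chart_dom c" using ex_chart by blast
    let ?I' = "I \<inter> \<gamma> -` chart_dom c" and ?x = "chart_map c \<circ> \<gamma>"
    have oI': "open ?I'" by (rule open_chart_preimage[OF D(1,4) c(1)])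
    have slit': "(?x t, vector_derivative ?x (at t)) \<in> slit c" if "t \<in> ?I'" for t
      using velocity_nonzero_iff[OF D(1,4) _ c(1), of t] D(5)[of t] chart_facts(6)[OF c(1)] that by auto
    have "\<exists>\<delta>>0. \<forall>s\<in>ball t0 \<delta>. \<forall>t\<in>ball t0 \<delta>.
      locally_exact (?d c) (?x s, vector_derivative ?x (at s)) \<longrightarrow> locally_exact (?d c) (?x t, vector_derivative ?x (at t))"
    proof (rule locally_exact_propagates[OF h[OF c(1)] finsler_local(4)[OF F1 c(1)] finsler_local(6)[OF F1 c(1)] compat[OF c(1)]
        Ck_on_chart_curve[OF D(4) c(1)] oI'])
      show "t0 \<in> ?I'" using t0 c by simp
      show "(?x t, vector_derivative ?x (at t)) \<in> slit c" if "t \<in> ?I'" for t by (rule slit'[OF that])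
      show "EL (local_rep F1 c) ?x t" if "t \<in> ?I'" for t
        by (rule extremal_imp_EL[OF F1 ext _ c(1)]) (use that in auto)
      show "local_rep F1 c (?x t, vector_derivative ?x (at t)) = k" if "t \<in> ?I'" for t
        using speed[of t] velocity_coordinates[OF D(1,4) _ c(1), of t] that by simp
    qed
    then obtain \<delta> where \<delta>: "\<delta> > 0" "\<And>s t. s \<in> ball t0 \<delta> \<Longrightarrow> t \<in> ball t0 \<delta> \<Longrightarrow>
        locally_exact (?d c) (coord c s) \<Longrightarrow> locally_exact (?d c) (coord c t)"
      unfolding coord_def o_apply by blast
    let ?T = "ball t0 \<delta> \<inter> ?I'"
    have "P s \<longrightarrow> P t" if "s \<in> ?T" "t \<in> ?T" for s t
    proof
      assume "P s"
      then have "locally_exact (?d c) (coord c s)" using that(1) c(1) unfolding P_def by blast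
      then have "locally_exact (?d c) (coord c t)" using \<delta>(2)[of s t] that by blast
      then show "P t" using that(2) by (intro PI[OF _ c(1)]) auto
    qed
    moreover have "openin (top_of_set I) ?T"
      using open_Int[OF open_ball oI'] by (intro open_subset) auto
    moreover have "t0 \<in> ?T" using t0 c(2) \<delta>(1) by simp
    ultimately show "\<exists>T. openin (top_of_set I) T \<and> t0 \<in> T \<and> (\<forall>s\<in>T. \<forall>t\<in>T. P s \<longrightarrow> P t)" by blast
  qed
  then have "locally_exact (?d c) (coord c 0)" using c \<gamma>q[OF I0] unfolding P_def by blast
  moreover have "coord c 0 = z"
  proof -
    have "vector_derivative (chart_map c \<circ> \<gamma>) (at 0) = vector_derivative (q z) (at 0)"
      by (rule vector_derivative_cong_open[OF open_greaterThanLessThan I0]) (simp add: \<gamma>q)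
    then show ?thesis using fD(5)[OF zW] vd[OF I0] \<gamma>q[OF I0] by (simp add: coord_def)
  qed
  ultimately show ?thesis by simp
qed

text \<open>A primitive \<open>S\<close> near \<open>(p, u)\<close> has at \<open>p\<close> the gradient \<open>vgrad\<close> of the difference at every \<open>(p, v)\<close> close to
  \<open>(p, u)\<close>, so this gradient is locally constant in the velocity. Two dimensions are needed for the nonzero
  vectors to be connected.\<close>

lemma fibrewise_linear:
  assumes dim: "DIM('e) \<ge> 2" and F1: "C2_finsler A F1" and F2: "C2_finsler A F2"
    and c: "c \<in> A" and p: "p \<in> chart_range c"
    and exact: "\<And>u. u \<noteq> 0 \<Longrightarrow> locally_exact (\<lambda>z. local_rep F2 c z - local_rep F1 c z) (p, u)"
  shows "\<exists>l. \<forall>u. local_rep F2 c (p, u) - local_rep F1 c (p, u) = l \<bullet> u"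
proof -
  let ?d = "\<lambda>z. local_rep F2 c z - local_rep F1 c z"
  have h: "fibre_homogeneous ?d (slit c)"
    by (rule fibre_homogeneous_diff[OF finsler_local(5)[OF F2 c] finsler_local(5)[OF F1 c]])
  have C2: "Ck_on 2 ?d (slit c)" using h by (simp add: fibre_homogeneous_def)
  have dif: "?d differentiable (at (p, u))" if "u \<noteq> 0" for u
    using p that by (intro Ck_on_2_differentiable[OF C2]) auto
  have con: "connected (- {0::'e})"
    by (rule connected_complement_bounded_convex) (use dim in auto)
  have "\<exists>T. openin (top_of_set (- {0})) T \<and> u \<in> T \<and> (\<forall>v\<in>T. vgrad ?d (p, v) = vgrad ?d (p, u))" if u: "u \<in> - {0}" for u
  proof -
    have "u \<noteq> 0" using u by simp
    obtain N S where N: "open N" "(p, u) \<in> N"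
      and S: "\<And>q v. (q, v) \<in> N \<Longrightarrow> S differentiable (at q) \<and> ?d (q, v) = frechet_derivative S (at q) v"
      by (rule locally_exactE[OF exact[OF \<open>u \<noteq> 0\<close>]]) (rule that)
    let ?T = "(\<lambda>v. (p, v)) -` N \<inter> - {0}"
    have "open ?T" by (intro open_Int open_vimage N continuous_intros)
    then have "openin (top_of_set (- {0})) ?T" by (intro open_subset) auto
    moreover have "vgrad ?d (p, v) = vgrad ?d (p, u)" if "v \<in> ?T" for v
    proof -
      have v: "(p, v) \<in> N" "v \<noteq> 0" using that by auto
      have "(S has_derivative (\<lambda>e. vgrad ?d (p, v) \<bullet> e)) (at p)"
        using exact_gradient[OF N(1) v(1) dif[OF v(2)] S] by simp
      moreover have "(S has_derivative (\<lambda>e. vgrad ?d (p, u) \<bullet> e)) (at p)"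
        using exact_gradient[OF N dif[OF \<open>u \<noteq> 0\<close>] S] by simp
      ultimately have "(\<lambda>e. vgrad ?d (p, v) \<bullet> e) = (\<lambda>e. vgrad ?d (p, u) \<bullet> e)" by (rule has_derivative_unique)
      then show ?thesis by (intro vector_eq_rdot[THEN iffD1]) (simp add: fun_eq_iff)
    qed
    moreover have "u \<in> ?T" using N(2) u by simp
    ultimately show ?thesis by blast
  qed
  from locally_constant_imp_constant[OF con this]
  have const: "(\<lambda>u. vgrad ?d (p, u)) constant_on (- {0})" by blast
  then obtain l where l: "\<And>u. u \<noteq> 0 \<Longrightarrow> vgrad ?d (p, u) = l" by (auto simp: constant_on_def)
  have "?d (p, u) = l \<bullet> u" for u
  proof (cases "u = 0")
    case True
    then show ?thesis using finsler_local(3)[OF F1 c p] finsler_local(3)[OF F2 c p] by simp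
  next
    case False
    have "?d (p, u) = vder ?d (p, u) u"
      by (rule fibre_homogeneous_Euler[OF h, symmetric]) (use p False in auto)
    also have "\<dots> = vgrad ?d (p, u) \<bullet> u" by (rule vgrad_inner[OF dif[OF False], symmetric])
    finally show ?thesis using l[OF False] by simp
  qed
  then show ?thesis by blast
qed

text \<open>A single vector \<open>b\<close> yields a local primitive \<open>S\<close> near \<open>(p, b)\<close>; by linearity on the fibres it is a
  primitive on all tangent spaces near \<open>p\<close>. Hence \<open>S\<close> is of class \<open>C^2\<close>, and its second derivative is symmetric.\<close>

lemma difference_closed:
  assumes dim: "DIM('e) \<ge> 2" and F1: "C2_finsler A F1" and F2: "C2_finsler A F2"
    and exact: "\<And>c z. c \<in> A \<Longrightarrow> z \<in> slit c \<Longrightarrow> locally_exact (\<lambda>z. local_rep F2 c z - local_rep F1 c z) z"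
  shows "closed_one_form A (\<lambda>v. F2 v - F1 v)"
  unfolding closed_one_form_def one_form_def
proof (intro conjI ballI allI)
  fix c assume c: "c \<in> A"
  let ?d = "\<lambda>z. local_rep F2 c z - local_rep F1 c z"
  have lin: "\<exists>l. \<forall>u. ?d (p, u) = l \<bullet> u" if "p \<in> chart_range c" for p
    using that by (intro fibrewise_linear[OF dim F1 F2 c that] exact[OF c]) auto
  show lin': "linear (\<lambda>u. ?d (p, u))" if "p \<in> chart_range c" for p
    using lin[OF that] by (auto intro!: linearI simp: inner_right_distrib)
  have h: "fibre_homogeneous ?d (slit c)"
    by (rule fibre_homogeneous_diff[OF finsler_local(5)[OF F2 c] finsler_local(5)[OF F1 c]])
  have C2: "Ck_on 2 ?d (slit c)" using h by (simp add: fibre_homogeneous_def)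
  have oR: "open (chart_range c)" by (rule chart_facts(2)[OF c])
  show C1: "Ck_on 1 (\<lambda>p. ?d (p, u)) (chart_range c)" for u
  proof (cases "u = 0")
    case True
    show ?thesis
      by (rule Ck_on_cong[OF oR Ck_on_const[OF oR, of 1 0]])
        (simp add: True finsler_local(3)[OF F1 c] finsler_local(3)[OF F2 c])
  next
    case False
    show ?thesis
    proof (rule Ck_on_compose[OF oR Ck_on_le[OF C2]])
      show "Ck_on 1 (\<lambda>p. (p, u)) (chart_range c)" by (intro Ck_on_Pair Ck_on_ident Ck_on_const oR)
    qed (use False in auto)
  qed
  fix p u w assume p: "p \<in> chart_range c"
  obtain b :: 'e where b: "b \<noteq> 0" using nonzero_Basis SOME_Basis by blast
  have pb: "(p, b) \<in> slit c" using p b by simp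
  obtain N S where N: "open N" "(p, b) \<in> N"
    and S: "\<And>q v. (q, v) \<in> N \<Longrightarrow> S differentiable (at q) \<and> ?d (q, v) = frechet_derivative S (at q) v"
    by (rule locally_exactE[OF exact[OF c pb]]) (rule that)
  let ?U = "(\<lambda>q. (q, b)) -` N \<inter> chart_range c"
  have U: "open ?U" by (intro open_Int open_vimage N oR continuous_intros)
  have pU: "p \<in> ?U" using N p by simp
  have dS: "(S has_derivative (\<lambda>w. ?d (q, w))) (at q)" if q: "q \<in> ?U" for q
  proof -
    have qr: "q \<in> chart_range c" and qN: "(q, b) \<in> N" using q by auto
    have df: "?d differentiable (at (q, b))" using qr b by (intro Ck_on_2_differentiable[OF C2]) auto
    have g: "(S has_derivative (\<lambda>e. vgrad ?d (q, b) \<bullet> e)) (at q)"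
      using exact_gradient[OF N(1) qN df S] by simp
    obtain l where l: "\<And>u. ?d (q, u) = l \<bullet> u" using lin[OF qr] by blast
    have "vder ?d (q, b) e = l \<bullet> e" for e
    proof (rule DERIV_unique[OF vder_line[OF df]])
      show "((\<lambda>t. ?d (q, b + t *\<^sub>R e)) has_real_derivative l \<bullet> e) (at 0)"
        unfolding l inner_right_distrib inner_scaleR_right by (auto intro!: derivative_eq_intros)
    qed
    then have "vgrad ?d (q, b) \<bullet> e = ?d (q, e)" for e by (simp only: vgrad_inner[OF df] l)
    then show ?thesis using g by simp
  qed
  have S2: "Ck_on 2 S ?U"
    unfolding numeral_2_eq_2
    by (rule Ck_on_SucI[OF U dS]) (use Ck_on_subset[OF C1, of ?U] in simp_all)
  have eq: "frechet_derivative (\<lambda>y. frechet_derivative S (at y) v) (at p) = frechet_derivative (\<lambda>y. ?d (y, v)) (at p)" for v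
  proof (rule frechet_derivative_cong_open[OF U pU])
    show "frechet_derivative S (at y) v = ?d (y, v)" if "y \<in> ?U" for y
      using fun_cong[OF frechet_derivative_at[OF dS[OF that]], of v] by simp
  qed
  show "frechet_derivative (\<lambda>q. ?d (q, w)) (at p) u - frechet_derivative (\<lambda>q. ?d (q, u)) (at p) w = 0"
    using second_derivative_symmetric[OF S2 U pU, of w u] unfolding eq by simp
qed

end

theorem mainTheorem7:
  fixes A :: "('m::{t2_space,second_countable_topology}, 'e::euclidean_space) chart set"
    and F1 F2 :: "('m, 'e) tangent \<Rightarrow> real"
  assumes "smooth_atlas A"
    and "DIM('e) \<ge> 2"
    and "C2_finsler A F1" and "C2_finsler A F2"
    and "same_unparametrized_geodesics A F1 F2"
    and "\<And>I \<gamma>. geodesic A F1 I \<gamma> \<Longrightarrow>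
           \<exists>W. openin (tangent_topology A) W \<and> (\<forall>v\<in>W. F1 v = F2 v) \<and>
               (\<exists>t\<in>I. velocity A \<gamma> t \<in> W)"
  shows "\<exists>\<beta>. closed_one_form A \<beta> \<and> (\<forall>v\<in>tangent_bundle A. F2 v = F1 v + \<beta> v)"
proof -
  interpret smooth_manifold A by unfold_locales (rule assms(1))
  have "closed_one_form A (\<lambda>v. F2 v - F1 v)"
    by (rule difference_closed[OF assms(2-4) everywhere_locally_exact[OF assms(3-6)]])
  then show ?thesis by (intro exI[of _ "\<lambda>v. F2 v - F1 v"]) simp
qed

end
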